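(* Let $\beta\in(0,1)$. Suppose that the offspring generating function $G$ has mean $1$ and that $H(u)=G(1-u)-1+u$, $u\in[0,1]$, satisfies: (i) $H(x)=Kx^{1+\beta}W(x)$ for all $x\in[0,1]$, where $K>0$ is a constant and $W$ is a nonnegative bounded function with $\lim_{x\to0+}W(x)=1$; (ii) there is a constant $C>0$ such that $0\le H(y)-H(x)\le C(y-x)y^{\beta}$ for all $0\le x\le y\le 1$. Suppose moreover that there exists $\delta>0$ such that $\int_0^\infty s^{\beta+\delta}\varphi(s)\,ds<\infty$. Let $F_T=T^{1+\beta}$ and $Y_T(t)=\frac{1}{F_T}N(tT)$, $t\ge 0$. Then, as $T\to\infty$, the process $Y_T$ converges in the sense of finite dimensional distributions, and also in law in $D([0,\infty))$ equipped with the $M_1$ topology, to the process $K^{-1}L_{1/(1+\beta)}$, where $L_{1/(1+\beta)}$ is a $\frac1{1+\beta}$-stable subordinator, that is, a nondecreasing L\'evy process (with stationary and independent increments) whose one-dimensional distributions have the Laplace transform $$E\exp\{-\theta L_{1/(1+\beta)}(t)\}=\exp\{-t\,\theta^{1/(1+\beta)}\},\qquad t\ge0,\ \theta\ge0.$$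
   Context: Branching particle system on $\mathbb R_+=[0,\infty)$. Parameters: a constant $\mu>0$; a Borel function $\varphi:\mathbb R\to\mathbb R_+$ vanishing on $(-\infty,0)$ with $\int_0^\infty\varphi(t)\,dt=1$; and a generating function $G(s)=E s^\rho$, $s\in[0,1]$, of a random variable $\rho$ with values in $\{0,1,2,\dots\}$ and $E\rho=1$, where the trivial case $\rho=1$ a.s. is excluded. Generation-$0$ (immigrant) particles are the points of a Poisson random measure on $\mathbb R_+$ with intensity $\mu\ell$, where $\ell$ is Lebesgue measure. Each particle $I$ in the system, at position $\tau_I$, independently has a random number $\rho_I$ of children with generating function $G$, located at $\tau_I+\xi_{I,j}$, $j=1,\dots,\rho_I$, where the $\xi_{I,j}$ are i.i.d. with density $\varphi$ and independent of $\rho_I$. The children reproduce by the same mechanism, and all branching and displacement events in the system are independent. For a Borel set $B\subset\mathbb R_+$, $N(B)$ is the number of particles of all generations (including immigrants) located in $B$, and $N(t):=N([0,t])$. $D([0,\infty))$ is the Skorokhod space of real-valued c\`adl\`ag functions on $[0,\infty)$; $M_1$ is Skorokhod's $M_1$ topology.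
   Formalization: The limit is stated as μ^{1+β}K^{-1}L_{1/(1+β)} instead of K^{-1}L_{1/(1+β)}: with immigration intensity μ the limiting Laplace transform is exp(-μt(θ/K)^{1/(1+β)}), so the printed limit is false unless μ=1, where both agree. *)

theory Defs
  imports "HOL-Probability.Probability"
begin

section \<open>The branching particle system\<close>

definition poisson_random_measure :: "'a measure \<Rightarrow> 'b measure \<Rightarrow> ('a \<Rightarrow> 'b measure) \<Rightarrow> bool" where
  "poisson_random_measure M \<nu> N \<longleftrightarrow>
     (\<forall>\<omega>\<in>space M. sets (N \<omega>) = sets \<nu>) \<and>
     (\<forall>B\<in>sets \<nu>. (\<lambda>\<omega>. emeasure (N \<omega>) B) \<in> borel_measurable M) \<and>
     (\<forall>B\<in>sets \<nu>. emeasure \<nu> B < \<infinity> \<longrightarrow>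
        (\<forall>k::nat. measure M {\<omega>\<in>space M. emeasure (N \<omega>) B = of_nat k} =
                  exp (- measure \<nu> B) * measure \<nu> B ^ k / fact k)) \<and>
     (\<forall>B\<in>sets \<nu>. emeasure \<nu> B = \<infinity> \<longrightarrow> (AE \<omega> in M. emeasure (N \<omega>) B = \<infinity>)) \<and>
     (\<forall>B::nat \<Rightarrow> 'b set. range B \<subseteq> sets \<nu> \<and> disjoint_family B \<longrightarrow>
        prob_space.indep_vars M (\<lambda>_. borel) (\<lambda>n \<omega>. emeasure (N \<omega>) (B n)) UNIV)"

text \<open>Ulam--Harris labels: \<open>(i, [])\<close> is the \<open>i\<close>-th immigrant, and \<open>(i, j # u)\<close> is the \<open>j\<close>-th child
  (counting from \<open>0\<close>) of \<open>(i, u)\<close>, so the most recent birth index comes first.  Marks are attached to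
  all labels; a label belongs to the population only if it is \<open>alive\<close>.\<close>

type_synonym label = "nat \<times> nat list"

fun alive :: "(label \<Rightarrow> 'a \<Rightarrow> nat) \<Rightarrow> 'a \<Rightarrow> label \<Rightarrow> bool" where
  "alive \<rho> \<omega> (i, []) = True"
| "alive \<rho> \<omega> (i, j # u) = (alive \<rho> \<omega> (i, u) \<and> j < \<rho> (i, u) \<omega>)"

fun position :: "(nat \<Rightarrow> 'a \<Rightarrow> real) \<Rightarrow> (label \<Rightarrow> nat \<Rightarrow> 'a \<Rightarrow> real) \<Rightarrow> 'a \<Rightarrow> label \<Rightarrow> real" where
  "position S \<xi> \<omega> (i, []) = S i \<omega>"
| "position S \<xi> \<omega> (i, j # u) = position S \<xi> \<omega> (i, u) + \<xi> (i, u) j \<omega>"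

definition particle_count ::
  "(nat \<Rightarrow> 'a \<Rightarrow> real) \<Rightarrow> (label \<Rightarrow> 'a \<Rightarrow> nat) \<Rightarrow> (label \<Rightarrow> nat \<Rightarrow> 'a \<Rightarrow> real) \<Rightarrow> 'a \<Rightarrow> real set \<Rightarrow> ennreal" where
  "particle_count S \<rho> \<xi> \<omega> B =
     emeasure (count_space UNIV) {v. alive \<rho> \<omega> v \<and> position S \<xi> \<omega> v \<in> B}"

text \<open>The independent sources of randomness: the whole immigration process, one offspring number per
  label, and one displacement per label and birth index.\<close>

datatype source = Immigration | Offspring label | Displacement label nat

text \<open>\<open>S\<close> enumerates the immigrants, in an arbitrary measurable way (almost surely there are infinitely
  many); \<open>p\<close> is the offspring law and \<open>\<phi>\<close> the displacement density.\<close>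

locale branching_particle_system = prob_space M
  for M :: "'a measure" and \<mu> :: real and \<phi> :: "real \<Rightarrow> real" and p :: "nat pmf"
    and S :: "nat \<Rightarrow> 'a \<Rightarrow> real" and \<rho> :: "label \<Rightarrow> 'a \<Rightarrow> nat" and \<xi> :: "label \<Rightarrow> nat \<Rightarrow> 'a \<Rightarrow> real" +
  assumes immigrants_measurable: "\<And>i. S i \<in> borel_measurable M"
    and immigrants_nonneg: "\<And>i \<omega>. \<omega> \<in> space M \<Longrightarrow> 0 \<le> S i \<omega>"
    and immigrants_poisson:
      "poisson_random_measure M (scale_measure (ennreal \<mu>) (restrict_space lborel {0..}))
         (\<lambda>\<omega>. distr (count_space UNIV) (restrict_space borel {0..}) (\<lambda>i. S i \<omega>))"
    and offspring_measurable: "\<And>v. \<rho> v \<in> measurable M (count_space UNIV)"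
    and offspring_law: "\<And>v. distr M (count_space UNIV) (\<rho> v) = measure_pmf p"
    and displacement_density: "\<And>v j. distributed M lborel (\<xi> v j) (\<lambda>x. ennreal (\<phi> x))"
    and independent:
      "indep_sets
         (\<lambda>s. case s of
             Immigration \<Rightarrow> sets (vimage_algebra (space M) (\<lambda>\<omega> i. S i \<omega>) (\<Pi>\<^sub>M i\<in>UNIV. borel))
           | Offspring v \<Rightarrow> sets (vimage_algebra (space M) (\<rho> v) (count_space UNIV))
           | Displacement v j \<Rightarrow> sets (vimage_algebra (space M) (\<xi> v j) borel))
         UNIV"

definition generating_function :: "nat pmf \<Rightarrow> real \<Rightarrow> real" where
  "generating_function p s = measure_pmf.expectation p (\<lambda>k. s ^ k)"

text \<open>\<open>enn2real\<close> sends \<open>\<infinity>\<close> to \<open>0\<close>; this matters only on the null set where some bounded interval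
  contains infinitely many particles.\<close>

definition scaled_count ::
  "real \<Rightarrow> (nat \<Rightarrow> 'a \<Rightarrow> real) \<Rightarrow> (label \<Rightarrow> 'a \<Rightarrow> nat) \<Rightarrow> (label \<Rightarrow> nat \<Rightarrow> 'a \<Rightarrow> real) \<Rightarrow>
   real \<Rightarrow> real \<Rightarrow> 'a \<Rightarrow> real" where
  "scaled_count \<beta> S \<rho> \<xi> T t \<omega> =
     enn2real (particle_count S \<rho> \<xi> \<omega> {0..t * T}) / T powr (1 + \<beta>)"


section \<open>The \<open>M\<^sub>1\<close> topology\<close>

text \<open>Elements of \<open>D([0,\<infinity>))\<close> are functions \<open>real \<Rightarrow> real\<close> that equal \<open>undefined\<close> on negative reals.\<close>

definition skorokhod_space :: "(real \<Rightarrow> real) set" where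
  "skorokhod_space = {x \<in> extensional {0..}.
     (\<forall>t\<ge>0. (x \<longlongrightarrow> x t) (at_right t)) \<and> (\<forall>t>0. \<exists>l. (x \<longlongrightarrow> l) (at_left t))}"

definition left_limit :: "(real \<Rightarrow> real) \<Rightarrow> real \<Rightarrow> real" where
  "left_limit x s = (if s = 0 then x 0 else Lim (at_left s) x)"

definition completed_graph :: "real \<Rightarrow> (real \<Rightarrow> real) \<Rightarrow> (real \<times> real) set" where
  "completed_graph t x = {(z, s). s \<in> {0..t} \<and> z \<in> closed_segment (left_limit x s) (x s)}"

definition graph_le :: "(real \<Rightarrow> real) \<Rightarrow> real \<times> real \<Rightarrow> real \<times> real \<Rightarrow> bool" where
  "graph_le x a b \<longleftrightarrow> snd a < snd b \<or>
     (snd a = snd b \<and> \<bar>left_limit x (snd a) - fst a\<bar> \<le> \<bar>left_limit x (snd a) - fst b\<bar>)"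

definition parametric_reps :: "real \<Rightarrow> (real \<Rightarrow> real) \<Rightarrow> ((real \<Rightarrow> real) \<times> (real \<Rightarrow> real)) set" where
  "parametric_reps t x = {(u, r).
     continuous_on {0..1} u \<and> continuous_on {0..1} r \<and>
     (\<lambda>a. (u a, r a)) ` {0..1} = completed_graph t x \<and>
     (\<forall>a b. 0 \<le> a \<and> a \<le> b \<and> b \<le> 1 \<longrightarrow> graph_le x (u a, r a) (u b, r b))}"

text \<open>Skorokhod's metric on \<open>D([0,t])\<close>, applied to restrictions to \<open>[0,t]\<close>.\<close>

definition m1_dist :: "real \<Rightarrow> (real \<Rightarrow> real) \<Rightarrow> (real \<Rightarrow> real) \<Rightarrow> real" where
  "m1_dist t x y = Inf {max (SUP a\<in>{0..1}. \<bar>u a - v a\<bar>) (SUP a\<in>{0..1}. \<bar>r a - q a\<bar>) | u r v q.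
     (u, r) \<in> parametric_reps t x \<and> (v, q) \<in> parametric_reps t y}"

text \<open>Convergence in \<open>D([0,\<infinity>))\<close> is convergence of the restrictions to \<open>[0,t]\<close> for all continuity points
  \<open>t\<close> of the limit.  This is metrizable convergence, so the open sets of the topology are exactly the
  sequentially open ones.\<close>

definition m1_tendsto :: "(nat \<Rightarrow> real \<Rightarrow> real) \<Rightarrow> (real \<Rightarrow> real) \<Rightarrow> bool" where
  "m1_tendsto xs x \<longleftrightarrow> (\<forall>t>0. isCont x t \<longrightarrow> (\<lambda>n. m1_dist t (xs n) x) \<longlonglongrightarrow> 0)"

definition m1_open :: "(real \<Rightarrow> real) set \<Rightarrow> bool" where
  "m1_open U \<longleftrightarrow> U \<subseteq> skorokhod_space \<and>
     (\<forall>x\<in>U. \<forall>xs. range xs \<subseteq> skorokhod_space \<and> m1_tendsto xs x \<longrightarrow> (\<forall>\<^sub>F n in sequentially. xs n \<in> U))"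

definition m1_topology :: "(real \<Rightarrow> real) topology" where
  "m1_topology = topology m1_open"

lemma istopology_m1_open: "istopology m1_open"
  unfolding istopology_def
proof (intro conjI allI impI)
  fix U V assume "m1_open U" "m1_open V"
  then show "m1_open (U \<inter> V)"
    unfolding m1_open_def by (auto intro!: eventually_conj)
next
  fix \<U> assume *: "\<forall>U\<in>\<U>. m1_open U"
  show "m1_open (\<Union>\<U>)"
    unfolding m1_open_def
  proof (intro conjI ballI allI impI)
    show "\<Union>\<U> \<subseteq> skorokhod_space" using * by (auto simp: m1_open_def)
    fix x xs assume "x \<in> \<Union>\<U>" and xs: "range xs \<subseteq> skorokhod_space \<and> m1_tendsto xs x"
    then obtain U where U: "U \<in> \<U>" "x \<in> U" by auto
    with * xs have "\<forall>\<^sub>F n in sequentially. xs n \<in> U" by (auto simp: m1_open_def)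
    then show "\<forall>\<^sub>F n in sequentially. xs n \<in> \<Union>\<U>"
      by eventually_elim (use U in auto)
  qed
qed

lemma openin_m1_topology: "openin m1_topology = m1_open"
  unfolding m1_topology_def by (rule topology_inverse'[OF istopology_m1_open])

lemma topspace_m1_topology: "topspace m1_topology = skorokhod_space"
proof -
  have "m1_open skorokhod_space"
    unfolding m1_open_def by (auto intro!: always_eventually)
  then show ?thesis unfolding topspace_def openin_m1_topology by (auto simp: m1_open_def)
qed


section \<open>Convergence in law of processes\<close>

definition borel_of :: "'s topology \<Rightarrow> 's measure" where
  "borel_of X = sigma (topspace X) {U. openin X U}"

definition converges_in_law ::
  "'s topology \<Rightarrow> 'i filter \<Rightarrow> 'a measure \<Rightarrow> ('i \<Rightarrow> 'a \<Rightarrow> 's) \<Rightarrow> 'b measure \<Rightarrow> ('b \<Rightarrow> 's) \<Rightarrow> bool" where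
  "converges_in_law X F M Z M' Z' \<longleftrightarrow>
     (\<forall>\<^sub>F i in F. Z i \<in> measurable M (borel_of X)) \<and> Z' \<in> measurable M' (borel_of X) \<and>
     (\<forall>f. continuous_map X euclideanreal f \<and> bounded (f ` topspace X) \<longrightarrow>
        ((\<lambda>i. \<integral>\<omega>. f (Z i \<omega>) \<partial>M) \<longlongrightarrow> (\<integral>\<omega>. f (Z' \<omega>) \<partial>M')) F)"

definition converges_fdd ::
  "'i filter \<Rightarrow> 'a measure \<Rightarrow> ('i \<Rightarrow> real \<Rightarrow> 'a \<Rightarrow> real) \<Rightarrow> 'b measure \<Rightarrow> (real \<Rightarrow> 'b \<Rightarrow> real) \<Rightarrow> bool" where
  "converges_fdd F M Y M' Y' \<longleftrightarrow>
     (\<forall>J. finite J \<and> J \<subseteq> {0..} \<longrightarrow>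
        converges_in_law (product_topology (\<lambda>_. euclideanreal) J) F
          M (\<lambda>i \<omega>. \<lambda>t\<in>J. Y i t \<omega>) M' (\<lambda>\<omega>. \<lambda>t\<in>J. Y' t \<omega>))"

definition sample_path :: "(real \<Rightarrow> 'a \<Rightarrow> real) \<Rightarrow> 'a \<Rightarrow> real \<Rightarrow> real" where
  "sample_path Y \<omega> = (\<lambda>t\<in>{0..}. Y t \<omega>)"

definition cadlag_path :: "(real \<Rightarrow> 'a \<Rightarrow> real) \<Rightarrow> 'a \<Rightarrow> real \<Rightarrow> real" where
  "cadlag_path Y \<omega> = (if sample_path Y \<omega> \<in> skorokhod_space then sample_path Y \<omega> else (\<lambda>t\<in>{0..}. 0))"

text \<open>The processes have paths in \<open>D([0,\<infinity>))\<close> almost surely.  On the exceptional null set the path is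
  replaced by the zero path; passing to the completion keeps the modified map measurable and does not
  change laws.\<close>

definition converges_in_law_M1 ::
  "'i filter \<Rightarrow> 'a measure \<Rightarrow> ('i \<Rightarrow> real \<Rightarrow> 'a \<Rightarrow> real) \<Rightarrow> 'b measure \<Rightarrow> (real \<Rightarrow> 'b \<Rightarrow> real) \<Rightarrow> bool" where
  "converges_in_law_M1 F M Y M' Y' \<longleftrightarrow>
     (\<forall>\<^sub>F i in F. AE \<omega> in M. sample_path (Y i) \<omega> \<in> skorokhod_space) \<and>
     (AE \<omega> in M'. sample_path Y' \<omega> \<in> skorokhod_space) \<and>
     converges_in_law m1_topology F (completion M) (\<lambda>i. cadlag_path (Y i)) (completion M') (cadlag_path Y')"


section \<open>Stable subordinators\<close>

locale subordinator = prob_space M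
  for M :: "'a measure" and L :: "real \<Rightarrow> 'a \<Rightarrow> real" +
  assumes random_variables: "\<And>t. 0 \<le> t \<Longrightarrow> L t \<in> borel_measurable M"
    and starts_at_zero: "AE \<omega> in M. L 0 \<omega> = 0"
    and cadlag_paths: "AE \<omega> in M. sample_path L \<omega> \<in> skorokhod_space"
    and nondecreasing: "AE \<omega> in M. mono_on {0..} (sample_path L \<omega>)"
    and independent_increments:
      "\<And>(s::nat \<Rightarrow> real) n. 0 \<le> s 0 \<Longrightarrow> mono s \<Longrightarrow>
         indep_vars (\<lambda>_. borel) (\<lambda>i \<omega>. L (s (Suc i)) \<omega> - L (s i) \<omega>) {..<n}"
    and stationary_increments:
      "\<And>s t. 0 \<le> s \<Longrightarrow> 0 \<le> t \<Longrightarrow> distr M borel (\<lambda>\<omega>. L (s + t) \<omega> - L s \<omega>) = distr M borel (L t)"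

locale stable_subordinator = subordinator M L
  for M :: "'a measure" and L :: "real \<Rightarrow> 'a \<Rightarrow> real" and \<alpha> :: real +
  assumes laplace: "\<And>t \<theta>. 0 \<le> t \<Longrightarrow> 0 \<le> \<theta> \<Longrightarrow> expectation (\<lambda>\<omega>. exp (- \<theta> * L t \<omega>)) = exp (- t * \<theta> powr \<alpha>)"

text \<open>The scaling limit of the particle count is \<open>(\<mu> powr (1 + \<beta>) / K) L\<close>, with \<open>L\<close> stable of index
  \<open>1 / (1 + \<beta>)\<close>; for \<open>\<mu> = 1\<close> it is \<open>L / K\<close>.  The power of \<open>\<mu>\<close> cannot be absent for general \<open>\<mu>\<close>:
  two independent systems with \<open>\<mu> = 1\<close> superpose to one with \<open>\<mu> = 2\<close>, and the sum of two independent
  copies of \<open>L\<close> has the law of \<open>2 powr (1 + \<beta>) * L\<close>.\<close>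

end

theory Submission
  imports Defs
begin

text \<open>For a nonnegative function \<open>f\<close> supported in \<open>[0, a]\<close> let \<open>1 - v x\<close> be the expectation of
  the product of the values of \<open>exp (- f)\<close> at a particle at \<open>x\<close> and all its descendants.  The Poisson
  structure of the immigrants gives
  \<open>exp (- \<mu> * (LINT x:{0..a}|lborel. v x))\<close> for the Laplace functional of the population
  (\<open>laplace_functional\<close>, \<open>laplace_particle_counts\<close>), and branching at the first particle gives
  \<open>1 - v x = exp (- f x) * G (1 - u x)\<close> with \<open>u x = (\<integral>y. v (x + y) \<partial>D)\<close>, where \<open>D\<close> is the law of a displacement
  (\<open>cluster_limit_fixed_point\<close>).  In terms of \<open>H\<close> the equation is
  \<open>v - u = (1 - u + H u) * (1 - exp (- f)) - H u\<close>, and for small \<open>f\<close> it says that \<open>H u\<close> is nearly \<open>f - (v - u)\<close>.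

  The finite-dimensional distributions of the counts \<open>N [0, t T]\<close> only involve step functions \<open>f\<close> that decrease
  on \<open>[0, \<infinity>)\<close>.  Then \<open>v\<close> decreases as well, displacements being nonnegative, and so \<open>u \<le> v\<close>.  This sign yields
  \<open>H u \<le> f\<close> pointwise, hence \<open>v\<close> is at most of the order \<open>f powr (1 / (1 + \<beta>))\<close>.  Moreover the integral of \<open>v - u\<close> over
  \<open>[0, a]\<close> is at most \<open>sup v\<close> times the mean of \<open>min y a\<close> under \<open>D\<close>.  For \<open>f\<close> of size \<open>T powr - (1 + \<beta>)\<close> on an
  interval of length proportional to \<open>T\<close>, the moment of order larger than \<open>\<beta>\<close> makes this small compared with
  \<open>T powr - \<beta>\<close>, the size of the integral of \<open>f\<close>.  Consequently \<open>H u\<close> and \<open>f\<close> agree in the limit, and since \<open>H u\<close> behaves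
  like \<open>K * u powr (1 + \<beta>)\<close>, the integral of \<open>v\<close> converges to that of \<open>(g / K) powr (1 / (1 + \<beta>))\<close>, where \<open>g\<close> is
  the step function before scaling (\<open>defect_integral_tendsto\<close>).  This is the Laplace exponent of the stable
  subordinator (\<open>laplace_functional\<close> in its locale).

  Convergence of these Laplace transforms gives convergence of the finite-dimensional distributions, by
  Stone--Weierstrass in the coordinates \<open>exp (- x)\<close> (\<open>converges_fdd_of_laplace\<close>).

  For nondecreasing paths that start at \<open>0\<close>, convergence at the continuity points of the limit implies convergence in
  \<open>M\<^sub>1\<close> (\<open>m1_tendsto_monotone_paths\<close>).  Therefore an \<open>M\<^sub>1\<close>-open set agrees, on such paths, with a countable union of
  sets each of which is given by strict inequalities at finitely many rational times (\<open>m1_open_monotone_paths\<close>).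
  So lower bounds for probabilities of open sets, and with them convergence in law, pass from finite-dimensional
  distributions to the path space (\<open>converges_in_law_M1_of_fdd\<close>).\<close>

section \<open>Completed graphs of nondecreasing paths\<close>


text \<open>The paths start at \<open>0\<close>.  Otherwise mass could escape into a jump at time \<open>0\<close>, and convergence at
  positive continuity points would not imply convergence in \<open>M\<^sub>1\<close>.\<close>

definition monotone_paths :: "(real \<Rightarrow> real) set" where
  "monotone_paths = {x \<in> skorokhod_space. x 0 = 0 \<and> mono_on {0..} x}"

lemma monotone_pathsD:
  assumes "x \<in> monotone_paths"
  shows "x 0 = 0" "0 \<le> r \<Longrightarrow> r \<le> s \<Longrightarrow> x r \<le> x s" "0 \<le> s \<Longrightarrow> 0 \<le> x s"
    "0 \<le> s \<Longrightarrow> (x \<longlongrightarrow> x s) (at_right s)"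
proof -
  show *: "x 0 = 0" and **: "0 \<le> r \<Longrightarrow> r \<le> s \<Longrightarrow> x r \<le> x s" for r s
    using assms by (auto simp: monotone_paths_def mono_on_def)
  show "0 \<le> s \<Longrightarrow> 0 \<le> x s" using **[of 0 s] * by auto
  show "0 \<le> s \<Longrightarrow> (x \<longlongrightarrow> x s) (at_right s)"
    using assms by (auto simp: monotone_paths_def skorokhod_space_def)
qed

text \<open>The slack \<open>s - r\<close> in the last bound disappears in the limit; bounds in this form come from
  comparing values of \<open>x r + r\<close>.\<close>

lemma left_limit_monotone_path:
  assumes x: "x \<in> monotone_paths" and s: "0 \<le> s"
  shows left_limit_ge: "0 \<le> r \<Longrightarrow> r < s \<Longrightarrow> x r \<le> left_limit x s"
    and left_limit_le: "left_limit x s \<le> x s"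
    and left_limit_leI: "0 < s \<Longrightarrow> (\<And>r. 0 \<le> r \<Longrightarrow> r < s \<Longrightarrow> x r \<le> b + (s - r)) \<Longrightarrow> left_limit x s \<le> b"
proof -
  have lim: "(x \<longlongrightarrow> left_limit x s) (at_left s)" if "0 < s"
  proof -
    have "\<exists>l. (x \<longlongrightarrow> l) (at_left s)"
      using x that by (simp add: monotone_paths_def skorokhod_space_def)
    then obtain l where "(x \<longlongrightarrow> l) (at_left s)" ..
    then show ?thesis using that tendsto_Lim[of "at_left s" x l] by (auto simp: left_limit_def)
  qed
  have near: "\<forall>\<^sub>F r' in at_left s. r < r' \<and> r' < s" if "r < s" for r
    using that by (intro eventually_conj eventually_at_leftI) auto
  show "x r \<le> left_limit x s" if "0 \<le> r" "r < s"
  proof (rule tendsto_lowerbound[OF lim])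
    show "\<forall>\<^sub>F r' in at_left s. x r \<le> x r'"
      using near[OF that(2)] by eventually_elim (use that monotone_pathsD[OF x] in auto)
  qed (use that in auto)
  show "left_limit x s \<le> x s"
  proof (cases "s = 0")
    case False
    then have "0 < s" using s by auto
    show ?thesis
    proof (rule tendsto_upperbound[OF lim])
      show "\<forall>\<^sub>F r in at_left s. x r \<le> x s"
        using near[OF \<open>0 < s\<close>] by eventually_elim (use monotone_pathsD[OF x] in auto)
    qed (use \<open>0 < s\<close> in auto)
  qed (simp add: left_limit_def)
  show "left_limit x s \<le> b" if "0 < s" "\<And>r. 0 \<le> r \<Longrightarrow> r < s \<Longrightarrow> x r \<le> b + (s - r)"
  proof (rule tendsto_le[OF _ _ lim])
    show "((\<lambda>r. b + (s - r)) \<longlongrightarrow> b) (at_left s)"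
      by (rule tendsto_eq_intros refl | simp)+
    show "\<forall>\<^sub>F r in at_left s. x r \<le> b + (s - r)"
      using near[OF \<open>0 < s\<close>] by eventually_elim (use that in auto)
  qed (use that in auto)
qed

text \<open>A point \<open>(z, s)\<close> of the completed graph of a nondecreasing path is determined by \<open>z + s\<close>, which
  increases from \<open>0\<close> to \<open>x t + t\<close> along the graph.  The two functions below are the coordinates of the point
  with \<open>z + s = a * (x t + t)\<close>.  In this parametrization, and only because \<open>x\<close> is nondecreasing, both
  coordinates are Lipschitz continuous.\<close>

definition graph_time :: "real \<Rightarrow> (real \<Rightarrow> real) \<Rightarrow> real \<Rightarrow> real" where
  "graph_time t x a = Inf {s \<in> {0..t}. a * (x t + t) \<le> x s + s}"

definition graph_height :: "real \<Rightarrow> (real \<Rightarrow> real) \<Rightarrow> real \<Rightarrow> real" where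
  "graph_height t x a = a * (x t + t) - graph_time t x a"

context
  fixes x :: "real \<Rightarrow> real" and t :: real
  assumes x: "x \<in> monotone_paths" and t: "0 < t"
begin

lemma total_pos: "0 < x t + t"
  using monotone_pathsD(3)[OF x, of t] t by linarith

lemma graph_time_le:
  assumes "0 \<le> s" "s \<le> t" "a * (x t + t) \<le> x s + s" shows "graph_time t x a \<le> s"
  unfolding graph_time_def by (rule cInf_lower) (use assms in \<open>auto intro!: bdd_belowI[of _ 0]\<close>)

lemma graph_time_ge:
  assumes "a \<le> 1" "0 \<le> s" "s \<le> t" "x s + s < a * (x t + t)" shows "s \<le> graph_time t x a"
  unfolding graph_time_def
proof (rule cInf_greatest)
  have "a * (x t + t) \<le> 1 * (x t + t)" using assms total_pos by (intro mult_right_mono) auto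
  then show "{s \<in> {0..t}. a * (x t + t) \<le> x s + s} \<noteq> {}" using t by auto
  fix s' assume "s' \<in> {s \<in> {0..t}. a * (x t + t) \<le> x s + s}"
  then show "s \<le> s'" using assms monotone_pathsD(2)[OF x, of s' s] by (cases "s \<le> s'") auto
qed

lemma graph_time_bounds:
  assumes "a \<le> 1" shows "0 \<le> graph_time t x a" "graph_time t x a \<le> t"
proof -
  have le: "a * (x t + t) \<le> 1 * (x t + t)" using assms total_pos by (intro mult_right_mono) auto
  show "graph_time t x a \<le> t" by (rule graph_time_le) (use le t in auto)
  show "0 \<le> graph_time t x a" unfolding graph_time_def
    by (rule cInf_greatest) (use le t in auto)
qed

text \<open>Right continuity of \<open>x\<close> turns the infimum into a minimum.\<close>

lemma graph_time_attained:
  assumes "a \<le> 1" shows "a * (x t + t) \<le> x (graph_time t x a) + graph_time t x a"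
proof (rule ccontr)
  let ?r = "graph_time t x a"
  assume neg: "\<not> ?thesis"
  have r: "0 \<le> ?r" "?r \<le> t" using graph_time_bounds[OF assms] by auto
  have le: "a * (x t + t) \<le> 1 * (x t + t)" using assms total_pos by (intro mult_right_mono) auto
  have "?r \<noteq> t" using neg le by auto
  then have "?r < t" using r by auto
  have "((\<lambda>s. x s + s) \<longlongrightarrow> x ?r + ?r) (at_right ?r)"
    by (intro tendsto_intros monotone_pathsD(4)[OF x] r)
  then have "\<forall>\<^sub>F s in at_right ?r. x s + s < a * (x t + t)"
    using neg by (intro order_tendstoD) auto
  moreover have "\<forall>\<^sub>F s in at_right ?r. ?r < s \<and> s < t"
    using \<open>?r < t\<close> by (intro eventually_conj eventually_at_rightI) auto
  ultimately have "\<forall>\<^sub>F s in at_right ?r. ?r < s \<and> s < t \<and> x s + s < a * (x t + t)"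
    by eventually_elim auto
  then obtain s where "?r < s" "s < t" "x s + s < a * (x t + t)"
    by (metis (mono_tags, lifting) eventually_happens trivial_limit_at_right_real)
  then show False using graph_time_ge[OF assms, of s] r by auto
qed

lemma graph_time_mono:
  assumes "a \<le> b" "b \<le> 1" shows "graph_time t x a \<le> graph_time t x b"
proof (rule graph_time_le)
  have "a * (x t + t) \<le> b * (x t + t)" using assms total_pos by (intro mult_right_mono) auto
  also note graph_time_attained[OF assms(2)]
  finally show "a * (x t + t) \<le> x (graph_time t x b) + graph_time t x b" .
qed (use graph_time_bounds[OF assms(2)] in auto)

lemma graph_time_Lipschitz:
  assumes "a \<le> b" "b \<le> 1"
  shows "graph_time t x b \<le> graph_time t x a + (b - a) * (x t + t)"
proof (cases "graph_time t x a + (b - a) * (x t + t) \<le> t")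
  case True
  let ?s = "graph_time t x a + (b - a) * (x t + t)"
  have a: "0 \<le> graph_time t x a" using graph_time_bounds[of a] assms by auto
  have s: "graph_time t x a \<le> ?s" using assms total_pos by auto
  have "b * (x t + t) = a * (x t + t) + (b - a) * (x t + t)" by (simp add: algebra_simps)
  also have "\<dots> \<le> x (graph_time t x a) + ?s" using graph_time_attained[of a] assms by auto
  also have "\<dots> \<le> x ?s + ?s" using monotone_pathsD(2)[OF x a s] by auto
  finally show ?thesis using True a s by (intro graph_time_le) auto
qed (use graph_time_bounds[of b] assms in auto)

lemma graph_height_mono:
  "a \<le> b \<Longrightarrow> b \<le> 1 \<Longrightarrow> graph_height t x a \<le> graph_height t x b"
  using graph_time_Lipschitz[of a b] by (auto simp: graph_height_def algebra_simps)

lemma graph_height_bounds: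
  assumes "0 \<le> a" "a \<le> 1"
  shows "left_limit x (graph_time t x a) \<le> graph_height t x a"
    and "graph_height t x a \<le> x (graph_time t x a)"
proof -
  let ?r = "graph_time t x a"
  have r: "0 \<le> ?r" "?r \<le> t" using graph_time_bounds[OF assms(2)] by auto
  show "graph_height t x a \<le> x ?r"
    using graph_time_attained[OF assms(2)] by (auto simp: graph_height_def)
  show "left_limit x ?r \<le> graph_height t x a"
  proof (cases "?r = 0")
    case True
    then show ?thesis using assms total_pos monotone_pathsD(1)[OF x]
      by (auto simp: graph_height_def left_limit_def)
  next
    case False
    then have "0 < ?r" using r by auto
    show ?thesis
    proof (rule left_limit_leI[OF x r(1) \<open>0 < ?r\<close>])
      fix s assume s: "0 \<le> s" "s < ?r"
      then have "\<not> a * (x t + t) \<le> x s + s" using graph_time_le[of s a] r by auto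
      then show "x s \<le> graph_height t x a + (?r - s)" by (auto simp: graph_height_def)
    qed
  qed
qed

lemma continuous_on_graph:
  "continuous_on {0..1} (graph_time t x)" "continuous_on {0..1} (graph_height t x)"
proof -
  have "\<bar>graph_time t x a - graph_time t x b\<bar> \<le> (x t + t) * \<bar>a - b\<bar>"
    if "a \<in> {0..1}" "b \<in> {0..1}" for a b
    using that graph_time_Lipschitz[of a b] graph_time_mono[of a b]
      graph_time_Lipschitz[of b a] graph_time_mono[of b a]
    by (cases "a \<le> b") (auto simp: algebra_simps)
  then have "(x t + t)-lipschitz_on {0..1} (graph_time t x)"
    using total_pos by (intro lipschitz_onI) (auto simp: dist_real_def)
  then show "continuous_on {0..1} (graph_time t x)" by (rule lipschitz_on_continuous_on)
  then show "continuous_on {0..1} (graph_height t x)"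
    unfolding graph_height_def by (intro continuous_intros)
qed

lemma graph_parametric: "(graph_height t x, graph_time t x) \<in> parametric_reps t x"
proof -
  have "(\<lambda>a. (graph_height t x a, graph_time t x a)) ` {0..1} = completed_graph t x"
  proof (intro equalityI subsetI)
    fix q assume "q \<in> (\<lambda>a. (graph_height t x a, graph_time t x a)) ` {0..1}"
    then obtain a where a: "0 \<le> a" "a \<le> 1" and q: "q = (graph_height t x a, graph_time t x a)" by auto
    then show "q \<in> completed_graph t x"
      using graph_height_bounds[OF a] graph_time_bounds[OF a(2)]
      by (auto simp: completed_graph_def closed_segment_eq_real_ivl)
  next
    fix q assume "q \<in> completed_graph t x"
    then obtain z s where q: "q = (z, s)" "0 \<le> s" "s \<le> t" and seg: "z \<in> closed_segment (left_limit x s) (x s)"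
      by (auto simp: completed_graph_def)
    then have z: "left_limit x s \<le> z" "z \<le> x s"
      using left_limit_le[OF x q(2)] by (auto simp: closed_segment_eq_real_ivl split: if_splits)
    have "0 \<le> z"
      using z left_limit_ge[OF x q(2), of 0] q(2) monotone_pathsD(1)[OF x]
      by (cases "s = 0") (auto simp: left_limit_def)
    define a where "a = (z + s) / (x t + t)"
    have al: "a * (x t + t) = z + s" using total_pos by (auto simp: a_def)
    have "z + s \<le> x t + t" using z monotone_pathsD(2)[OF x q(2,3)] q by auto
    then have a: "0 \<le> a" "a \<le> 1" using \<open>0 \<le> z\<close> q total_pos by (auto simp: a_def)
    have "graph_time t x a = s"
    proof (rule antisym)
      show "graph_time t x a \<le> s" by (rule graph_time_le) (use q z al in auto)
      show "s \<le> graph_time t x a"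
      proof (rule ccontr)
        assume "\<not> ?thesis"
        then have lt: "graph_time t x a < s" by auto
        then have "x (graph_time t x a) \<le> left_limit x s"
          using left_limit_ge[OF x q(2)] graph_time_bounds[OF a(2)] by auto
        then show False using graph_time_attained[OF a(2)] al lt z by auto
      qed
    qed
    then have "q = (graph_height t x a, graph_time t x a)" using al q by (auto simp: graph_height_def)
    then show "q \<in> (\<lambda>a. (graph_height t x a, graph_time t x a)) ` {0..1}" using a by auto
  qed
  moreover have "graph_le x (graph_height t x a, graph_time t x a) (graph_height t x b, graph_time t x b)"
    if "0 \<le> a" "a \<le> b" "b \<le> 1" for a b
    using graph_time_mono[of a b] graph_height_mono[of a b] graph_height_bounds[of a] that
    by (auto simp: graph_le_def)
  ultimately show ?thesis
    unfolding parametric_reps_def using continuous_on_graph by auto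
qed

end

text \<open>The distance is an infimum of maxima of suprema.  These are nonnegative because continuous functions
  are bounded on the unit interval, so that the suprema are genuine.\<close>

lemma m1_dist_nonneg_le:
  assumes "(u, r) \<in> parametric_reps t x" "(v, q) \<in> parametric_reps t y"
    and "\<And>a. a \<in> {0..1} \<Longrightarrow> \<bar>u a - v a\<bar> \<le> e" "\<And>a. a \<in> {0..1} \<Longrightarrow> \<bar>r a - q a\<bar> \<le> e"
  shows "0 \<le> m1_dist t x y" "m1_dist t x y \<le> e"
proof -
  let ?A = "{max (SUP a\<in>{0..1}. \<bar>u a - v a\<bar>) (SUP a\<in>{0..1}. \<bar>r a - q a\<bar>) | u r v q.
     (u, r) \<in> parametric_reps t x \<and> (v, q) \<in> parametric_reps t y}"
  let ?m = "max (SUP a\<in>{0..1}. \<bar>u a - v a\<bar>) (SUP a\<in>{0..1}. \<bar>r a - q a\<bar>)"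
  have pos: "0 \<le> m" if m: "m \<in> ?A" for m
  proof -
    obtain u r v q where u: "(u, r) \<in> parametric_reps t x" "(v, q) \<in> parametric_reps t y"
      and m: "m = max (SUP a\<in>{0..1}. \<bar>u a - v a\<bar>) (SUP a\<in>{0..1}. \<bar>r a - q a\<bar>)" using m by auto
    have "continuous_on {0..1} (\<lambda>a. \<bar>u a - v a\<bar>)"
      using u by (intro continuous_intros) (auto simp: parametric_reps_def)
    then have "bdd_above ((\<lambda>a. \<bar>u a - v a\<bar>) ` {0..1})"
      by (intro bounded_imp_bdd_above compact_imp_bounded compact_continuous_image) auto
    then have "\<bar>u 0 - v 0\<bar> \<le> (SUP a\<in>{0..1}. \<bar>u a - v a\<bar>)" by (intro cSUP_upper) auto
    then show ?thesis using m by linarith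
  qed
  have mem: "?m \<in> ?A" using assms(1,2) by blast
  define A where "A = ?A"
  have A: "m1_dist t x y = Inf A" "?m \<in> A" "\<And>m. m \<in> A \<Longrightarrow> 0 \<le> m"
    unfolding A_def m1_dist_def by (rule refl mem pos; assumption?)+
  show "0 \<le> m1_dist t x y" unfolding A(1)
    by (rule cInf_greatest) (use A(2,3) in blast)+
  have "m1_dist t x y \<le> ?m" unfolding A(1)
    by (rule cInf_lower[OF A(2)]) (rule bdd_belowI, rule A(3))
  also have "\<dots> \<le> e" using assms(3,4) by (intro max.boundedI cSUP_least) auto
  finally show "m1_dist t x y \<le> e" .
qed


lemma continuity_point_between:
  assumes x: "x \<in> monotone_paths" and ab: "0 \<le> a" "a < b"
  obtains s where "a < s" "s < b" "isCont x s"
proof -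
  define y where "y s = (if s < 0 then 0 else x s)" for s
  have "mono y"
    using monotone_pathsD(2,3)[OF x] by (auto simp: mono_def y_def)
  then have "countable {s. \<not> isCont y s}" by (rule mono_ctble_discont)
  moreover have "uncountable {a<..<b}" using ab by (simp add: uncountable_open_interval)
  ultimately have "\<not> {a<..<b} \<subseteq> {s. \<not> isCont y s}" using countable_subset by blast
  then obtain s where s: "a < s" "s < b" "isCont y s" by auto
  have "\<forall>\<^sub>F r in nhds s. y r = x r"
    using eventually_nhds_in_open[of "{0<..}" s] s ab by (auto simp: y_def elim!: eventually_mono)
  then have "isCont x s" using s(3) isCont_cong by blast
  then show ?thesis using that s by auto
qed

text \<open>The inverse of the function \<open>x s + s\<close> of \<open>s\<close> depends continuously on \<open>x\<close>: it lies between two continuity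
  points as soon as the values at these two points are close to the limit values.\<close>

lemma graph_time_tendsto:
  assumes x: "x \<in> monotone_paths" and xs: "\<And>n. xs n \<in> monotone_paths"
    and conv: "\<And>s. 0 < s \<Longrightarrow> isCont x s \<Longrightarrow> (\<lambda>n. xs n s) \<longlonglongrightarrow> x s"
    and t: "0 < t" "isCont x t" and a: "0 \<le> a" "a \<le> 1"
  shows "(\<lambda>n. graph_time t (xs n) a) \<longlonglongrightarrow> graph_time t x a"
proof (rule order_tendstoI)
  let ?r = "graph_time t x a"
  have r: "0 \<le> ?r" "?r \<le> t" using graph_time_bounds[OF x t(1) a(2)] by auto
  have lim: "(\<lambda>n. (xs n s + s) - a * (xs n t + t)) \<longlonglongrightarrow> (x s + s) - a * (x t + t)"
    if "0 < s" "isCont x s" for s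
    by (intro tendsto_intros conv that t)
  fix b assume b: "b < ?r"
  show "\<forall>\<^sub>F n in sequentially. b < graph_time t (xs n) a"
  proof (cases "b < 0")
    case True
    then show ?thesis
      using graph_time_bounds[OF xs t(1) a(2)] by (auto intro!: always_eventually intro: less_le_trans)
  next
    case False
    then obtain s where s: "b < s" "s < ?r" "isCont x s"
      using continuity_point_between[OF x _ b] by auto
    then have "(x s + s) - a * (x t + t) < 0"
      using graph_time_le[OF x t(1), of s a] r False by fastforce
    then have "\<forall>\<^sub>F n in sequentially. (xs n s + s) - a * (xs n t + t) < 0"
      using order_tendstoD(2)[OF lim[of s], of 0] s False by linarith
    then show ?thesis
    proof eventually_elim
      case (elim n)
      then have "s \<le> graph_time t (xs n) a"
        using graph_time_ge[OF xs t(1) a(2), of s n] s False r by auto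
      then show ?case using s by auto
    qed
  qed
next
  let ?r = "graph_time t x a"
  have r: "0 \<le> ?r" "?r \<le> t" using graph_time_bounds[OF x t(1) a(2)] by auto
  have lim: "(\<lambda>n. (xs n s + s) - a * (xs n t + t)) \<longlonglongrightarrow> (x s + s) - a * (x t + t)"
    if "0 < s" "isCont x s" for s
    by (intro tendsto_intros conv that t)
  fix b assume b: "?r < b"
  show "\<forall>\<^sub>F n in sequentially. graph_time t (xs n) a < b"
  proof (cases "t < b")
    case True
    then show ?thesis
      using graph_time_bounds[OF xs t(1) a(2)] by (auto intro!: always_eventually intro: le_less_trans)
  next
    case False
    then obtain s where s: "?r < s" "s < b" "isCont x s"
      using continuity_point_between[OF x r(1) b] by auto
    have "x ?r + ?r < x s + s" using monotone_pathsD(2)[OF x r(1), of s] s by auto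
    then have "0 < (x s + s) - a * (x t + t)"
      using graph_time_attained[OF x t(1) a(2)] by auto
    then have "\<forall>\<^sub>F n in sequentially. 0 < (xs n s + s) - a * (xs n t + t)"
      using order_tendstoD(1)[OF lim[of s], of 0] s r by linarith
    then show ?thesis
    proof eventually_elim
      case (elim n)
      then have "graph_time t (xs n) a \<le> s"
        using graph_time_le[OF xs t(1), of s a n] s False r by auto
      then show ?case using s by auto
    qed
  qed
qed

text \<open>All functions are nondecreasing and the limit is Lipschitz continuous.  Convergence on a finite grid
  therefore controls the whole unit interval.\<close>

lemma graph_time_uniform:
  assumes x: "x \<in> monotone_paths" and xs: "\<And>n. xs n \<in> monotone_paths"
    and conv: "\<And>s. 0 < s \<Longrightarrow> isCont x s \<Longrightarrow> (\<lambda>n. xs n s) \<longlonglongrightarrow> x s"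
    and t: "0 < t" "isCont x t" and e: "0 < e"
  shows "\<forall>\<^sub>F n in sequentially. \<forall>a\<in>{0..1}. \<bar>graph_time t (xs n) a - graph_time t x a\<bar> \<le> e"
proof -
  let ?l = "x t + t"
  obtain N :: nat where N: "?l * 2 / e < N" using reals_Archimedean2 by blast
  have l: "0 < ?l" by (rule total_pos[OF x t(1)])
  have N0: "0 < real N" using N l e by (smt (verit) divide_pos_pos mult_pos_pos)
  then have lN: "1 / N * ?l \<le> e / 2" using N e by (simp add: field_simps)
  have "\<forall>\<^sub>F n in sequentially. \<forall>i\<in>{..N}. dist (graph_time t (xs n) (i / N)) (graph_time t x (i / N)) < e / 2"
    using e N0 by (intro eventually_ball_finite finite_atMost ballI tendstoD graph_time_tendsto[OF x xs conv t])
      auto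
  then show ?thesis
  proof (eventually_elim, intro ballI)
    fix n a assume near: "\<forall>i\<in>{..N}. dist (graph_time t (xs n) (i / N)) (graph_time t x (i / N)) < e / 2"
      and a: "a \<in> {0..1::real}"
    define i where "i = nat \<lfloor>a * N\<rfloor>"
    define j where "j = min (Suc i) N"
    have "real i \<le> a * N" "a * N < real i + 1"
      using a by (auto simp: i_def)
    moreover have "a * N \<le> N" using a by (intro mult_left_le_one_le) auto
    moreover from calculation have "i \<le> N" by linarith
    ultimately have i: "i / N \<le> a" "a \<le> j / N" "i \<le> N" "j \<le> N" "real j \<le> real i + 1"
      using N0 by (auto simp: j_def field_simps min_def)
    have one: "i / N \<le> 1" "j / N \<le> 1" using i N0 by auto
    have "graph_time t (xs n) (i / N) \<le> graph_time t (xs n) a"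
         "graph_time t (xs n) a \<le> graph_time t (xs n) (j / N)"
      using graph_time_mono[OF xs t(1)] i one a by auto
    moreover have "\<bar>graph_time t (xs n) (i / N) - graph_time t x (i / N)\<bar> < e / 2"
         "\<bar>graph_time t (xs n) (j / N) - graph_time t x (j / N)\<bar> < e / 2"
      using near i by (auto simp: dist_real_def)
    moreover have "graph_time t x a \<le> graph_time t x (i / N) + (a - i / N) * ?l"
         "graph_time t x (j / N) \<le> graph_time t x a + (j / N - a) * ?l"
      using graph_time_Lipschitz[OF x t(1)] i one a by auto
    moreover have "(a - i / N) * ?l \<le> 1 / N * ?l" "(j / N - a) * ?l \<le> 1 / N * ?l"
    proof -
      have "j / N \<le> i / N + 1 / N" using i N0 by (simp add: field_simps)
      then show "(a - i / N) * ?l \<le> 1 / N * ?l" "(j / N - a) * ?l \<le> 1 / N * ?l"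
        using i l by (intro mult_right_mono; linarith)+
    qed
    ultimately show "\<bar>graph_time t (xs n) a - graph_time t x a\<bar> \<le> e" using lN
      unfolding abs_le_iff abs_less_iff by linarith
  qed
qed

text \<open>For nondecreasing paths no oscillation has to be excluded: convergence at the continuity points of
  the limit already gives uniformly close parametrizations of the completed graphs.\<close>

lemma m1_tendsto_monotone_paths:
  assumes x: "x \<in> monotone_paths" and xs: "\<And>n. xs n \<in> monotone_paths"
    and conv: "\<And>s. 0 < s \<Longrightarrow> isCont x s \<Longrightarrow> (\<lambda>n. xs n s) \<longlonglongrightarrow> x s"
  shows "m1_tendsto xs x"
  unfolding m1_tendsto_def
proof (intro allI impI)
  fix t :: real assume t: "0 < t" "isCont x t"
  show "(\<lambda>n. m1_dist t (xs n) x) \<longlonglongrightarrow> 0"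
  proof (rule LIMSEQ_I)
    fix e :: real assume e: "0 < e"
    have uniform: "\<forall>\<^sub>F n in sequentially. \<forall>a\<in>{0..1}. \<bar>graph_time t (xs n) a - graph_time t x a\<bar> \<le> e / 4"
      by (rule graph_time_uniform[OF x xs _ t]) (use conv e in auto)
    have "\<forall>\<^sub>F n in sequentially. dist (xs n t) (x t) < e / 4"
      using conv[OF t] e by (intro tendstoD) auto
    then have "\<forall>\<^sub>F n in sequentially. norm (m1_dist t (xs n) x - 0) < e"
      using uniform
    proof eventually_elim
      case (elim n)
      have h: "\<bar>graph_height t (xs n) a - graph_height t x a\<bar> \<le> e / 2" if a: "a \<in> {0..1}" for a
      proof -
        have "\<bar>a * (xs n t - x t)\<bar> \<le> 1 * \<bar>xs n t - x t\<bar>"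
          using a unfolding abs_mult by (intro mult_right_mono) auto
        then have "\<bar>a * (xs n t - x t)\<bar> \<le> e / 4"
          by (rule order_trans) (use elim(1) in \<open>auto simp: dist_real_def\<close>)
        have "graph_height t (xs n) a - graph_height t x a =
          a * (xs n t - x t) - (graph_time t (xs n) a - graph_time t x a)"
          by (simp add: graph_height_def algebra_simps)
        then have "\<bar>graph_height t (xs n) a - graph_height t x a\<bar> \<le>
          \<bar>a * (xs n t - x t)\<bar> + \<bar>graph_time t (xs n) a - graph_time t x a\<bar>"
          by (metis abs_triangle_ineq4)
        also have "\<dots> \<le> e / 4 + e / 4"
          by (intro add_mono) (use elim(2)[rule_format, OF a] \<open>\<bar>a * (xs n t - x t)\<bar> \<le> e / 4\<close> in auto)
        finally show ?thesis by simp
      qed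
      have g: "\<bar>graph_time t (xs n) a - graph_time t x a\<bar> \<le> e / 2" if "a \<in> {0..1}" for a
        using elim(2)[rule_format, OF that] e by auto
      show ?case
        using m1_dist_nonneg_le[OF graph_parametric[OF xs t(1)] graph_parametric[OF x t(1)] h g] e
        by auto
    qed
    then show "\<exists>no. \<forall>n\<ge>no. norm (m1_dist t (xs n) x - 0) < e"
      by (simp add: eventually_sequentially)
  qed
qed

section \<open>Finite descriptions of open sets of monotone paths\<close>

text \<open>The condition \<open>(q, r, b)\<close> says \<open>x q < r\<close> or \<open>x q > r\<close>, according to \<open>b\<close>.  It holds iff \<open>gap\<close> is
  positive, and \<open>gap\<close> depends continuously on a single coordinate of the path.\<close>

type_synonym cond = "rat \<times> rat \<times> bool"

definition gap :: "(real \<Rightarrow> real) \<Rightarrow> cond \<Rightarrow> real" where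
  "gap x c = (case c of (q, r, b) \<Rightarrow> if b then of_rat r - x (of_rat q) else x (of_rat q) - of_rat r)"

text \<open>Suppose that no finite set works, and choose \<open>y n\<close> outside \<open>U\<close> satisfying the first \<open>n\<close> of all
  rational conditions that hold for \<open>x\<close>.  By monotonicity, bounds at rational times near a continuity
  point \<open>s\<close> of \<open>x\<close> are bounds at \<open>s\<close>.  Hence \<open>y n\<close> converges to \<open>x\<close> at the continuity points, thus in
  \<open>M\<^sub>1\<close>, although \<open>U\<close> is open and contains \<open>x\<close>.\<close>

lemma m1_open_finite_conditions:
  assumes U: "m1_open U" and x: "x \<in> U" "x \<in> monotone_paths"
  shows "\<exists>F :: cond set. finite F \<and> (\<forall>c\<in>F. 0 \<le> fst c \<and> 0 < gap x c) \<and>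
    (\<forall>y\<in>monotone_paths. (\<forall>c\<in>F. 0 < gap y c) \<longrightarrow> y \<in> U)"
proof (rule ccontr)
  assume neg: "\<not> ?thesis"
  define C where "C = {c :: cond. 0 \<le> fst c \<and> 0 < gap x c}"
  have "(0, 1, True) \<in> C" using monotone_pathsD(1)[OF x(2)] by (auto simp: C_def gap_def)
  then have C: "from_nat_into C n \<in> C" for n by (intro from_nat_into) auto
  have "\<exists>y\<in>monotone_paths. (\<forall>c\<in>from_nat_into C ` {..n}. 0 < gap y c) \<and> y \<notin> U" for n
  proof (rule ccontr)
    assume "\<not> ?thesis"
    moreover have "\<forall>c\<in>from_nat_into C ` {..n}. 0 \<le> fst c \<and> 0 < gap x c"
      using C by (auto simp: C_def)
    ultimately show False
      by - (rule notE[OF neg], rule exI[of _ "from_nat_into C ` {..n}"], blast)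
  qed
  then have "\<forall>n. \<exists>y. y \<in> monotone_paths \<and> y \<notin> U \<and> (\<forall>c\<in>from_nat_into C ` {..n}. 0 < gap y c)" by blast
  from choice[OF this] obtain y where y: "\<And>n. y n \<in> monotone_paths" "\<And>n. y n \<notin> U"
    and sat: "\<And>n c. c \<in> from_nat_into C ` {..n} \<Longrightarrow> 0 < gap (y n) c" by blast
  \<comment> \<open>every condition satisfied by the limit holds for all but finitely many of the paths\<close>
  have event: "\<forall>\<^sub>F n in sequentially. 0 < gap (y n) c" if c: "c \<in> C" for c
  proof -
    obtain k where "from_nat_into C k = c"
      using from_nat_into_surj[OF countableI_type c] by auto
    then show ?thesis
      by (intro eventually_sequentiallyI[of k] sat) auto
  qed
  have "m1_tendsto y x"
  proof (rule m1_tendsto_monotone_paths[OF x(2) y(1)])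
    fix s assume s: "0 < s" "isCont x s"
    show "(\<lambda>n. y n s) \<longlonglongrightarrow> x s"
    proof (rule order_tendstoI)
      fix a assume "a < x s"
      moreover have "(x \<longlongrightarrow> x s) (at s)" using s(2) by (simp add: isCont_def)
      ultimately have "\<forall>\<^sub>F r in at s. a < x r" by (intro order_tendstoD)
      then obtain d where d: "0 < d" "\<And>r. r \<noteq> s \<Longrightarrow> dist r s < d \<Longrightarrow> a < x r"
        unfolding eventually_at by auto
      obtain q where q: "max 0 (s - d) < of_rat q" "of_rat q < s"
        using of_rat_dense[of "max 0 (s - d)" s] s d by auto
      then have "a < x (of_rat q)" by (intro d(2)) (auto simp: dist_real_def)
      then obtain r where r: "a < of_rat r" "of_rat r < x (of_rat q)" using of_rat_dense by blast
      have "(q, r, False) \<in> C" using q r by (auto simp: C_def gap_def)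
      from event[OF this] show "\<forall>\<^sub>F n in sequentially. a < y n s"
      proof eventually_elim
        case (elim n)
        have "y n (of_rat q) \<le> y n s" using monotone_pathsD(2)[OF y(1)] q by auto
        then show ?case using elim r by (auto simp: gap_def)
      qed
    next
      fix a assume "x s < a"
      moreover have "(x \<longlongrightarrow> x s) (at s)" using s(2) by (simp add: isCont_def)
      ultimately have "\<forall>\<^sub>F r in at s. x r < a" by (intro order_tendstoD)
      then obtain d where d: "0 < d" "\<And>r. r \<noteq> s \<Longrightarrow> dist r s < d \<Longrightarrow> x r < a"
        unfolding eventually_at by auto
      obtain q where q: "s < of_rat q" "of_rat q < s + d"
        using of_rat_dense[of s "s + d"] s d by auto
      then have "x (of_rat q) < a" by (intro d(2)) (auto simp: dist_real_def)
      then obtain r where r: "x (of_rat q) < of_rat r" "of_rat r < a" using of_rat_dense by blast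
      have "0 < (of_rat q :: real)" using q s by linarith
      then have "(q, r, True) \<in> C" using r by (auto simp: C_def gap_def)
      from event[OF this] show "\<forall>\<^sub>F n in sequentially. y n s < a"
      proof eventually_elim
        case (elim n)
        have "y n s \<le> y n (of_rat q)" using monotone_pathsD(2)[OF y(1)] q s by auto
        then show ?case using elim r by (auto simp: gap_def)
      qed
    qed
  qed
  moreover have "range y \<subseteq> skorokhod_space" using y(1) by (auto simp: monotone_paths_def)
  ultimately have "\<forall>\<^sub>F n in sequentially. y n \<in> U"
    using U x(1) unfolding m1_open_def by blast
  then show False using y(2) by auto
qed

text \<open>Up to paths that are not monotone, every open set is thus a countable union of events that
  involve finitely many coordinates each.\<close>

lemma m1_open_monotone_paths:
  assumes U: "m1_open U"
  obtains \<F> :: "cond set set" where "countable \<F>" "\<And>F. F \<in> \<F> \<Longrightarrow> finite F"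
    "\<And>F c. F \<in> \<F> \<Longrightarrow> c \<in> F \<Longrightarrow> 0 \<le> fst c"
    "\<And>y. y \<in> monotone_paths \<Longrightarrow> y \<in> U \<longleftrightarrow> (\<exists>F\<in>\<F>. \<forall>c\<in>F. 0 < gap y c)"
proof
  let ?F = "{F :: cond set. finite F \<and> (\<forall>c\<in>F. 0 \<le> fst c) \<and>
    (\<forall>y\<in>monotone_paths. (\<forall>c\<in>F. 0 < gap y c) \<longrightarrow> y \<in> U)}"
  show "countable ?F"
    by (rule countable_subset[OF _ countable_Collect_finite]) auto
  show "y \<in> U \<longleftrightarrow> (\<exists>F\<in>?F. \<forall>c\<in>F. 0 < gap y c)" if "y \<in> monotone_paths" for y
    using m1_open_finite_conditions[OF U _ that] that by blast
qed auto

section \<open>Convergence in law from open sets\<close>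


lemma borel_measurable_borel_of:
  assumes "continuous_map X euclideanreal f" shows "f \<in> borel_measurable (borel_of X)"
proof (rule borel_measurableI)
  fix S :: "real set" assume "open S"
  then have "openin X {x \<in> topspace X. f x \<in> S}"
    using assms by (auto simp: continuous_map_def)
  moreover have "f -` S \<inter> space (borel_of X) = {x \<in> topspace X. f x \<in> S}"
    by (auto simp: borel_of_def space_measure_of_conv)
  moreover have "{U. openin X U} \<subseteq> Pow (topspace X)" by (auto dest: openin_subset)
  ultimately show "f -` S \<inter> space (borel_of X) \<in> sets (borel_of X)"
    by (auto simp: borel_of_def)
qed

lemma measurable_borel_ofI:
  assumes "f \<in> space M \<rightarrow> topspace X" "\<And>U. openin X U \<Longrightarrow> f -` U \<inter> space M \<in> sets M"
  shows "f \<in> measurable M (borel_of X)"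
  unfolding borel_of_def by (rule measurable_measure_of) (use assms in \<open>auto dest: openin_subset\<close>)

lemma sum_of_bool_less_bounds:
  fixes y :: real assumes "0 \<le> y" "y \<le> real k"
  shows "y \<le> (\<Sum>j<k. of_bool (real j < y))" "(\<Sum>j<k. of_bool (real j < y)) \<le> y + 1"
proof -
  have "{j \<in> {..<k}. real j < y} = {..<nat \<lceil>y\<rceil>}"
    using assms by (auto simp: less_ceiling_iff zless_nat_eq_int_zless)
  moreover have "(\<Sum>j<k. of_bool (real j < y) :: real) = real (card {j \<in> {..<k}. real j < y})"
    by (simp add: of_bool_def sum.If_cases Int_def)
  ultimately have "(\<Sum>j<k. of_bool (real j < y) :: real) = real (nat \<lceil>y\<rceil>)" by simp
  then show "y \<le> (\<Sum>j<k. of_bool (real j < y))" "(\<Sum>j<k. of_bool (real j < y)) \<le> y + 1"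
    using assms by linarith+
qed

text \<open>Counting the levels \<open>j / k\<close> below \<open>h \<omega>\<close> recovers \<open>h \<omega>\<close> up to \<open>1 / k\<close>.\<close>

lemma (in prob_space) layer_cake_bounds:
  fixes h :: "'a \<Rightarrow> real"
  assumes h: "h \<in> borel_measurable M" "\<And>\<omega>. \<omega> \<in> space M \<Longrightarrow> 0 \<le> h \<omega> \<and> h \<omega> \<le> 1" and k: "0 < k"
  shows "expectation h \<le> (\<Sum>j<k. prob {\<omega>\<in>space M. real j / real k < h \<omega>}) / real k"
    and "(\<Sum>j<k. prob {\<omega>\<in>space M. real j / real k < h \<omega>}) / real k \<le> expectation h + 1 / real k"
proof -
  let ?S = "\<lambda>\<omega>. (\<Sum>j<k. indicator {\<omega>\<in>space M. real j / real k < h \<omega>} \<omega> :: real)"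
  have [measurable]: "h \<in> borel_measurable M" by fact
  have int: "integrable M (\<lambda>\<omega>. ?S \<omega> / real k)" "expectation (\<lambda>\<omega>. ?S \<omega> / real k) =
      (\<Sum>j<k. prob {\<omega>\<in>space M. real j / real k < h \<omega>}) / real k"
    by (auto simp: Bochner_Integration.integral_sum less_top[symmetric])
  have inth: "integrable M h"
    by (rule integrable_const_bound[of _ 1]) (use h in auto)
  have "h \<omega> \<le> ?S \<omega> / real k \<and> ?S \<omega> / real k \<le> h \<omega> + 1 / real k" if w: "\<omega> \<in> space M" for \<omega>
  proof -
    have "?S \<omega> = (\<Sum>j<k. of_bool (real j < h \<omega> * real k))"
      using w k by (intro sum.cong) (auto simp: indicator_def field_simps)
    moreover have "h \<omega> * real k \<le> 1 * real k" using h(2)[OF w] by (intro mult_right_mono) auto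
    ultimately show ?thesis
      using sum_of_bool_less_bounds[of "h \<omega> * real k" k] h(2)[OF w] k
      by (auto simp: field_simps)
  qed
  note * = this
  have "expectation h \<le> expectation (\<lambda>\<omega>. ?S \<omega> / real k)"
    by (intro integral_mono inth int(1)) (use * in auto)
  then show "expectation h \<le> (\<Sum>j<k. prob {\<omega>\<in>space M. real j / real k < h \<omega>}) / real k"
    unfolding int(2) .
  have "expectation (\<lambda>\<omega>. ?S \<omega> / real k) \<le> expectation (\<lambda>\<omega>. h \<omega> + 1 / real k)"
    by (intro integral_mono int(1)) (use * inth in auto)
  then show "(\<Sum>j<k. prob {\<omega>\<in>space M. real j / real k < h \<omega>}) / real k \<le> expectation h + 1 / real k"
    unfolding int(2) using inth by (simp add: prob_space)
qed

text \<open>Lower bounds for open sets pass to \<open>[0,1]\<close>-valued continuous functions \<open>h\<close> by integrating over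
  the levels of \<open>h\<close>; the upper bound comes from \<open>1 - h\<close>.\<close>

lemma converges_in_law_open_sets:
  assumes "prob_space M" "prob_space M'"
    and Z: "\<forall>\<^sub>F i in F. Z i \<in> measurable M (borel_of X)" and Z': "Z' \<in> measurable M' (borel_of X)"
    and op: "\<And>U e. openin X U \<Longrightarrow> 0 < e \<Longrightarrow>
      \<forall>\<^sub>F i in F. measure M' (Z' -` U \<inter> space M') - e < measure M (Z i -` U \<inter> space M)"
  shows "converges_in_law X F M Z M' Z'"
  unfolding converges_in_law_def
proof (intro conjI Z Z' allI impI)
  interpret M: prob_space M by fact
  interpret M': prob_space M' by fact
  have lower: "\<forall>\<^sub>F i in F. (\<integral>\<omega>. h (Z' \<omega>) \<partial>M') - e < (\<integral>\<omega>. h (Z i \<omega>) \<partial>M)"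
    if h: "continuous_map X euclideanreal h" "\<And>x. x \<in> topspace X \<Longrightarrow> 0 \<le> h x \<and> h x \<le> 1" and e: "0 < e" for h e
  proof -
    obtain k :: nat where k: "2 / e < k" using reals_Archimedean2 by blast
    then have k0: "0 < real k" using e by (smt (verit) divide_pos_pos)
    then have ke: "1 / k < e / 2" using k e by (simp add: field_simps)
    have hm: "h \<in> borel_measurable (borel_of X)" by (rule borel_measurable_borel_of[OF h(1)])
    have "openin X {x \<in> topspace X. real j / k < h x}" for j
      using h(1) unfolding continuous_map_def
      by (elim conjE allE[of _ "{real j / k <..}"]) auto
    then have "\<forall>\<^sub>F i in F. \<forall>j\<in>{..<k}. measure M' (Z' -` {x \<in> topspace X. real j / k < h x} \<inter> space M') - e / 2
        < measure M (Z i -` {x \<in> topspace X. real j / k < h x} \<inter> space M)"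
      using e by (intro eventually_ball_finite ballI op) auto
    with Z show ?thesis
    proof eventually_elim
      case (elim i)
      have sp: "Z i \<omega> \<in> topspace X" if "\<omega> \<in> space M" for \<omega>
        using measurable_space[OF elim(1) that] by (simp add: borel_of_def space_measure_of_conv)
      have sp': "Z' \<omega> \<in> topspace X" if "\<omega> \<in> space M'" for \<omega>
        using measurable_space[OF Z' that] by (simp add: borel_of_def space_measure_of_conv)
      have eq: "Z i -` {x \<in> topspace X. real j / k < h x} \<inter> space M = {\<omega>\<in>space M. real j / real k < h (Z i \<omega>)}"
        "Z' -` {x \<in> topspace X. real j / k < h x} \<inter> space M' = {\<omega>\<in>space M'. real j / real k < h (Z' \<omega>)}" for j
        using sp sp' by auto
      let ?P = "\<lambda>j. measure M {\<omega>\<in>space M. real j / real k < h (Z i \<omega>)}"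
      let ?P' = "\<lambda>j. measure M' {\<omega>\<in>space M'. real j / real k < h (Z' \<omega>)}"
      have "(\<Sum>j<k. ?P' j) \<le> (\<Sum>j<k. ?P j + e / 2)"
        using elim(2) unfolding eq by (intro sum_mono) force
      then have "(\<Sum>j<k. ?P' j) \<le> (\<Sum>j<k. ?P j) + k * (e / 2)"
        by (simp only: sum.distrib sum_constant card_lessThan)
      then have "(\<Sum>j<k. ?P' j) / k \<le> ((\<Sum>j<k. ?P j) + k * (e / 2)) / k"
        using k0 by (intro divide_right_mono) auto
      then have "(\<Sum>j<k. ?P' j) / k \<le> (\<Sum>j<k. ?P j) / k + e / 2"
        using k0 by (simp add: add_divide_distrib)
      moreover have "(\<integral>\<omega>. h (Z' \<omega>) \<partial>M') \<le> (\<Sum>j<k. ?P' j) / k"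
        using k0 measurable_compose[OF Z' hm] h(2) sp' by (intro M'.layer_cake_bounds) auto
      moreover have "(\<Sum>j<k. ?P j) / k \<le> (\<integral>\<omega>. h (Z i \<omega>) \<partial>M) + 1 / k"
        using k0 measurable_compose[OF elim(1) hm] h(2) sp by (intro M.layer_cake_bounds) auto
      ultimately show ?case using ke by linarith
    qed
  qed
  fix f assume f: "continuous_map X euclideanreal f \<and> bounded (f ` topspace X)"
  then obtain B where B: "0 < B" "\<And>x. x \<in> topspace X \<Longrightarrow> \<bar>f x\<bar> \<le> B"
    unfolding bounded_pos by auto
  define h where "h x = (f x + B) / (2 * B)" for x
  have h: "continuous_map X euclideanreal h"
    unfolding h_def using f B(1)
    by (auto intro!: continuous_map_real_divide continuous_map_add)
  have h01: "0 \<le> h x \<and> h x \<le> 1" if "x \<in> topspace X" for x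
    using B(2)[OF that] B(1) by (auto simp: h_def field_simps abs_le_iff)
  have h': "continuous_map X euclideanreal (\<lambda>x. 1 - h x)"
    by (intro continuous_map_diff h) auto
  show "((\<lambda>i. \<integral>\<omega>. f (Z i \<omega>) \<partial>M) \<longlongrightarrow> (\<integral>\<omega>. f (Z' \<omega>) \<partial>M')) F"
  proof (rule tendstoI)
    fix e :: real assume e: "0 < e"
    define d where "d = e / (2 * B)"
    have d: "0 < d" using e B by (simp add: d_def)
    have h1: "0 \<le> 1 - h x \<and> 1 - h x \<le> 1" if "x \<in> topspace X" for x using h01[OF that] by auto
    have low: "\<forall>\<^sub>F i in F. (\<integral>\<omega>. h (Z' \<omega>) \<partial>M') - d < (\<integral>\<omega>. h (Z i \<omega>) \<partial>M)"
      by (rule lower[OF h _ d]) (use h01 in auto)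
    have up: "\<forall>\<^sub>F i in F. (\<integral>\<omega>. 1 - h (Z' \<omega>) \<partial>M') - d < (\<integral>\<omega>. 1 - h (Z i \<omega>) \<partial>M)"
      by (rule lower[OF h' _ d]) (use h1 in auto)
    show "\<forall>\<^sub>F i in F. dist (\<integral>\<omega>. f (Z i \<omega>) \<partial>M) (\<integral>\<omega>. f (Z' \<omega>) \<partial>M') < e"
      using Z low up
    proof eventually_elim
      case (elim i)
      have int: "integrable M (\<lambda>\<omega>. h (Z i \<omega>))"
        using measurable_compose[OF elim(1) borel_measurable_borel_of[OF h]] h01
          measurable_space[OF elim(1)]
        by (intro M.integrable_const_bound[of _ 1])
          (auto intro!: AE_I2 simp: abs_le_iff borel_of_def space_measure_of_conv)
      have int': "integrable M' (\<lambda>\<omega>. h (Z' \<omega>))"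
        using measurable_compose[OF Z' borel_measurable_borel_of[OF h]] h01
          measurable_space[OF Z']
        by (intro M'.integrable_const_bound[of _ 1])
          (auto intro!: AE_I2 simp: abs_le_iff borel_of_def space_measure_of_conv)
      have fh: "f x = 2 * B * h x - B" for x using B(1) by (simp add: h_def)
      have "\<bar>(\<integral>\<omega>. h (Z i \<omega>) \<partial>M) - (\<integral>\<omega>. h (Z' \<omega>) \<partial>M')\<bar> < d"
        using elim(2,3) int int' by (simp add: M.prob_space M'.prob_space abs_less_iff)
      then have "2 * B * \<bar>(\<integral>\<omega>. h (Z i \<omega>) \<partial>M) - (\<integral>\<omega>. h (Z' \<omega>) \<partial>M')\<bar> < e"
        using B(1) by (simp add: d_def field_simps)
      moreover have "(\<integral>\<omega>. f (Z i \<omega>) \<partial>M) - (\<integral>\<omega>. f (Z' \<omega>) \<partial>M') =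
          2 * B * ((\<integral>\<omega>. h (Z i \<omega>) \<partial>M) - (\<integral>\<omega>. h (Z' \<omega>) \<partial>M'))"
        unfolding fh using int int' by (simp add: M.prob_space M'.prob_space algebra_simps)
      ultimately show ?case using B(1) by (simp add: dist_real_def abs_mult)
    qed
  qed
qed

section \<open>From finite-dimensional distributions to the \<open>M\<^sub>1\<close> topology\<close>


text \<open>The indicator of \<open>0 < h\<close> is the increasing limit of the continuous functions \<open>min 1 (m * h)\<close>.\<close>

lemma converges_fdd_positive:
  assumes "prob_space M" "prob_space M'" and conv: "converges_fdd F M Y M' Y'"
    and J: "finite J" "J \<subseteq> {0..}"
    and h: "continuous_map (product_topology (\<lambda>_. euclideanreal) J) euclideanreal h"
    and nonneg: "\<And>y. 0 \<le> h y" and e: "0 < e"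
  shows "\<forall>\<^sub>F i in F. measure M' {\<omega>\<in>space M'. 0 < h (\<lambda>t\<in>J. Y' t \<omega>)} - e
    < measure M {\<omega>\<in>space M. 0 < h (\<lambda>t\<in>J. Y i t \<omega>)}"
proof -
  interpret M: prob_space M by fact
  interpret M': prob_space M' by fact
  let ?X = "product_topology (\<lambda>_. euclideanreal) J"
  let ?Z = "\<lambda>i \<omega>. \<lambda>t\<in>J. Y i t \<omega>" and ?Z' = "\<lambda>\<omega>. \<lambda>t\<in>J. Y' t \<omega>"
  have law: "converges_in_law ?X F M ?Z M' ?Z'"
    using conv J by (auto simp: converges_fdd_def)
  have hm: "h \<in> borel_measurable (borel_of ?X)" by (rule borel_measurable_borel_of[OF h])
  have Z'm: "?Z' \<in> measurable M' (borel_of ?X)" using law by (simp add: converges_in_law_def)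
  have hZ'[measurable]: "(\<lambda>\<omega>. h (?Z' \<omega>)) \<in> borel_measurable M'"
    by (rule measurable_compose[OF Z'm hm])
  define f where "f m y = min 1 (real m * h y)" for m y
  have f01: "0 \<le> f m y" "f m y \<le> 1" for m y using nonneg by (auto simp: f_def)
  have fc: "continuous_map ?X euclideanreal (f m)" for m
    unfolding f_def by (intro continuous_map_real_min continuous_map_real_mult h) auto
  have "(\<lambda>m. \<integral>\<omega>. f m (?Z' \<omega>) \<partial>M') \<longlonglongrightarrow> (\<integral>\<omega>. indicator {\<omega>\<in>space M'. 0 < h (?Z' \<omega>)} \<omega> \<partial>M')"
  proof (rule integral_dominated_convergence[where w="\<lambda>_. 1"])
    show "AE \<omega> in M'. (\<lambda>m. f m (?Z' \<omega>)) \<longlonglongrightarrow> indicator {\<omega>\<in>space M'. 0 < h (?Z' \<omega>)} \<omega>"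
    proof (rule AE_I2)
      fix \<omega> assume w: "\<omega> \<in> space M'"
      show "(\<lambda>m. f m (?Z' \<omega>)) \<longlonglongrightarrow> indicator {\<omega>\<in>space M'. 0 < h (?Z' \<omega>)} \<omega>"
      proof (cases "0 < h (?Z' \<omega>)")
        case True
        obtain N :: nat where "1 / h (?Z' \<omega>) < N" using reals_Archimedean2 by blast
        then have "f m (?Z' \<omega>) = 1" if "N \<le> m" for m
        proof -
          have "1 / h (?Z' \<omega>) < real m" using \<open>_ < real N\<close> that by linarith
          then show ?thesis using True by (simp add: f_def field_simps)
        qed
        then have "\<forall>\<^sub>F m in sequentially. f m (?Z' \<omega>) = 1" by (rule eventually_sequentiallyI)
        then show ?thesis using True w by (simp add: tendsto_eventually)
      next
        case False
        then have "h (?Z' \<omega>) = 0" using nonneg[of "?Z' \<omega>"] by auto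
        then show ?thesis by (simp add: f_def)
      qed
    qed
  qed (use f01 in \<open>auto simp: f_def\<close>)
  then have "(\<lambda>m. \<integral>\<omega>. f m (?Z' \<omega>) \<partial>M') \<longlonglongrightarrow> measure M' {\<omega>\<in>space M'. 0 < h (?Z' \<omega>)}"
    by simp
  then have "\<forall>\<^sub>F m in sequentially. measure M' {\<omega>\<in>space M'. 0 < h (?Z' \<omega>)} - e / 2 < (\<integral>\<omega>. f m (?Z' \<omega>) \<partial>M')"
    using e by (intro order_tendstoD) auto
  then obtain m where m: "measure M' {\<omega>\<in>space M'. 0 < h (?Z' \<omega>)} - e / 2 < (\<integral>\<omega>. f m (?Z' \<omega>) \<partial>M')"
    by (auto simp: eventually_sequentially)
  have "bounded (f m ` topspace ?X)"
    using f01 by (intro boundedI[of _ 1]) (auto simp: abs_le_iff intro: order_trans[of _ 0])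
  then have lim: "((\<lambda>i. \<integral>\<omega>. f m (?Z i \<omega>) \<partial>M) \<longlongrightarrow> (\<integral>\<omega>. f m (?Z' \<omega>) \<partial>M')) F"
    using law fc unfolding converges_in_law_def by blast
  have "\<forall>\<^sub>F i in F. (\<integral>\<omega>. f m (?Z' \<omega>) \<partial>M') - e / 2 < (\<integral>\<omega>. f m (?Z i \<omega>) \<partial>M)"
    by (rule order_tendstoD(1)[OF lim]) (use e in auto)
  moreover have "\<forall>\<^sub>F i in F. ?Z i \<in> measurable M (borel_of ?X)" using law by (simp add: converges_in_law_def)
  ultimately show ?thesis
  proof (eventually_elim)
    case (elim i)
    have [measurable]: "(\<lambda>\<omega>. h (?Z i \<omega>)) \<in> borel_measurable M"
      by (rule measurable_compose[OF elim(2) hm])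
    have "(\<integral>\<omega>. f m (?Z i \<omega>) \<partial>M) \<le> (\<integral>\<omega>. indicator {\<omega>\<in>space M. 0 < h (?Z i \<omega>)} \<omega> \<partial>M)"
    proof (rule integral_mono)
      show "integrable M (\<lambda>\<omega>. f m (?Z i \<omega>))"
        by (rule M.integrable_const_bound[of _ 1]) (use f01 in \<open>auto simp: f_def\<close>)
      show "f m (?Z i \<omega>) \<le> indicator {\<omega>\<in>space M. 0 < h (?Z i \<omega>)} \<omega>" if "\<omega> \<in> space M" for \<omega>
        using that f01[of m "?Z i \<omega>"] nonneg[of "?Z i \<omega>"]
        by (cases "0 < h (?Z i \<omega>)") (auto simp: f_def)
    qed (auto simp: less_top[symmetric])
    then show ?case using elim(1) m e by simp
  qed
qed

definition cond_event :: "'a measure \<Rightarrow> (real \<Rightarrow> 'a \<Rightarrow> real) \<Rightarrow> cond set set \<Rightarrow> 'a set" where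
  "cond_event M Y \<F> = {\<omega> \<in> space M. \<exists>F\<in>\<F>. \<forall>c\<in>F. 0 < gap (\<lambda>t. Y t \<omega>) c}"

lemma cond_event_sets:
  assumes "countable \<F>" "\<And>F. F \<in> \<F> \<Longrightarrow> finite F" "\<And>F c. F \<in> \<F> \<Longrightarrow> c \<in> F \<Longrightarrow> 0 \<le> fst c"
    and Y: "\<And>t. 0 \<le> t \<Longrightarrow> Y t \<in> borel_measurable M"
  shows "cond_event M Y \<F> \<in> sets M"
proof -
  have g: "(\<lambda>\<omega>. gap (\<lambda>t. Y t \<omega>) c) \<in> borel_measurable M" if "0 \<le> fst c" for c
    using that Y[of "of_rat (fst c)"] by (cases c) (auto simp: gap_def)
  have "cond_event M Y \<F> = (\<Union>F\<in>\<F>. {\<omega>\<in>space M. \<forall>c\<in>F. 0 < gap (\<lambda>t. Y t \<omega>) c})"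
    by (auto simp: cond_event_def)
  also have "\<dots> \<in> sets M"
  proof (intro sets.countable_UN'' assms(1))
    fix F assume F: "F \<in> \<F>"
    have "{\<omega>\<in>space M. 0 < gap (\<lambda>t. Y t \<omega>) c} \<in> sets M" if "c \<in> F" for c
    proof -
      have [measurable]: "(\<lambda>\<omega>. gap (\<lambda>t. Y t \<omega>) c) \<in> borel_measurable M" using assms(3) F g that by blast
      show ?thesis by measurable
    qed
    then show "{\<omega>\<in>space M. \<forall>c\<in>F. 0 < gap (\<lambda>t. Y t \<omega>) c} \<in> sets M"
      using assms(2)[OF F] by (intro sets.sets_Collect_finite_All)
  qed
  finally show ?thesis .
qed

text \<open>The preimage of \<open>U\<close> under the path map and \<open>cond_event\<close> agree at almost every \<open>\<omega>\<close>.  The preimage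
  itself need only be measurable for the completed measure, as nothing is known about it on the
  exceptional null set.\<close>

lemma cadlag_path_cond_event:
  assumes "prob_space M"
    and U: "\<And>y. y \<in> monotone_paths \<Longrightarrow> y \<in> U \<longleftrightarrow> (\<exists>F\<in>\<F>. \<forall>c\<in>F. 0 < gap y c)"
    and \<F>: "countable \<F>" "\<And>F. F \<in> \<F> \<Longrightarrow> finite F" "\<And>F c. F \<in> \<F> \<Longrightarrow> c \<in> F \<Longrightarrow> 0 \<le> fst c"
    and Y: "\<And>t. 0 \<le> t \<Longrightarrow> Y t \<in> borel_measurable M"
    and mono: "AE \<omega> in M. sample_path Y \<omega> \<in> monotone_paths"
  shows "cadlag_path Y -` U \<inter> space M \<in> sets (completion M)"
    and "measure (completion M) (cadlag_path Y -` U \<inter> space M) = measure M (cond_event M Y \<F>)"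
proof -
  let ?E = "cond_event M Y \<F>" and ?P = "cadlag_path Y -` U \<inter> space M"
  have E: "?E \<in> sets M" by (rule cond_event_sets[OF \<F> Y])
  have same: "\<omega> \<in> ?P \<longleftrightarrow> \<omega> \<in> ?E" if "\<omega> \<in> space M" "sample_path Y \<omega> \<in> monotone_paths" for \<omega>
  proof -
    have "gap (sample_path Y \<omega>) c = gap (\<lambda>t. Y t \<omega>) c" if "F \<in> \<F>" "c \<in> F" for F c
      using \<F>(3)[OF that] by (cases c) (auto simp: gap_def sample_path_def)
    moreover have "cadlag_path Y \<omega> = sample_path Y \<omega>"
      using that by (auto simp: cadlag_path_def monotone_paths_def)
    ultimately show ?thesis
      using U[OF that(2)] that(1) by (auto simp: cond_event_def)
  qed
  obtain N where N: "N \<in> null_sets M" "{\<omega>\<in>space M. sample_path Y \<omega> \<notin> monotone_paths} \<subseteq> N"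
    using mono by (auto simp: eventually_ae_filter)
  have "?P = (?E - N) \<union> (?P \<inter> N)" using same N(2) by (auto simp: cond_event_def)
  moreover have "?E - N \<in> sets (completion M)" using E N(1) by (intro sets_completionI_sets) auto
  moreover have "?P \<inter> N \<in> sets (completion M)" using N(1) by (intro sets_completionI_sub[of N]) auto
  ultimately show P: "?P \<in> sets (completion M)" by (metis sets.Un)
  have "measure (completion M) ?P = measure (completion M) ?E"
  proof (rule measure_eq_AE)
    show "AE \<omega> in completion M. (\<omega> \<in> ?P) = (\<omega> \<in> ?E)"
      using AE_completion[OF mono] AE_space by eventually_elim (use same in auto)
  qed (use P E in auto)
  then show "measure (completion M) ?P = measure M ?E" using E by simp
qed

lemma cadlag_path_in_space: "cadlag_path Y \<omega> \<in> skorokhod_space"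
proof -
  have zero: "(\<lambda>t\<in>{0..}. 0 :: real) \<in> skorokhod_space"
  proof -
    have "((\<lambda>t\<in>{0..}. 0 :: real) \<longlongrightarrow> 0) (at_right t)" if "0 \<le> t" for t :: real
      using that by (intro tendsto_eventually) (auto simp: eventually_at_filter)
    moreover have "((\<lambda>t\<in>{0..}. 0 :: real) \<longlongrightarrow> 0) (at_left t)" if "0 < t" for t :: real
      using eventually_at_leftI[of 0 t "\<lambda>s. (\<lambda>t\<in>{0..}. 0 :: real) s = 0"] that by (intro tendsto_eventually) auto
    ultimately show ?thesis by (auto simp: skorokhod_space_def)
  qed
  then show ?thesis by (auto simp: cadlag_path_def)
qed

lemma cadlag_path_measurable:
  assumes "prob_space M" "\<And>t. 0 \<le> t \<Longrightarrow> Y t \<in> borel_measurable M" "AE \<omega> in M. sample_path Y \<omega> \<in> monotone_paths"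
  shows "cadlag_path Y \<in> measurable (completion M) (borel_of m1_topology)"
proof (rule measurable_borel_ofI)
    fix U assume "openin m1_topology U"
    then have "m1_open U" by (simp add: openin_m1_topology)
    then obtain \<F> where *: "countable \<F>" "\<And>F. F \<in> \<F> \<Longrightarrow> finite F"
      "\<And>F c. F \<in> \<F> \<Longrightarrow> c \<in> F \<Longrightarrow> 0 \<le> fst c"
      "\<And>y. y \<in> monotone_paths \<Longrightarrow> y \<in> U \<longleftrightarrow> (\<exists>F\<in>\<F>. \<forall>c\<in>F. 0 < gap y c)"
      using m1_open_monotone_paths[of U] by metis
    show "cadlag_path Y -` U \<inter> space (completion M) \<in> sets (completion M)"
      using cadlag_path_cond_event(1)[OF assms(1) *(4) *(1,2,3) assms(2,3)] by simp
  qed (use cadlag_path_in_space in \<open>auto simp: topspace_m1_topology\<close>)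

text \<open>On monotone paths the \<open>M\<^sub>1\<close>-open sets are countable unions of finite-dimensional open sets, so
  that the open-set criterion for convergence in law reduces to finite-dimensional distributions.\<close>

lemma converges_in_law_M1_of_fdd:
  assumes pM: "prob_space M" and pM': "prob_space M'"
    and Y: "\<forall>\<^sub>F i in F. (\<forall>t\<ge>0. Y i t \<in> borel_measurable M) \<and> (AE \<omega> in M. sample_path (Y i) \<omega> \<in> monotone_paths)"
    and Y': "\<And>t. 0 \<le> t \<Longrightarrow> Y' t \<in> borel_measurable M'" "AE \<omega> in M'. sample_path Y' \<omega> \<in> monotone_paths"
    and fdd: "converges_fdd F M Y M' Y'"
  shows "converges_in_law_M1 F M Y M' Y'"
  unfolding converges_in_law_M1_def
proof (intro conjI)
  interpret M: prob_space M by fact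
  interpret M': prob_space M' by fact
  show "\<forall>\<^sub>F i in F. AE \<omega> in M. sample_path (Y i) \<omega> \<in> skorokhod_space"
    using Y by eventually_elim (auto simp: monotone_paths_def elim: eventually_mono)
  show "AE \<omega> in M'. sample_path Y' \<omega> \<in> skorokhod_space"
    using Y'(2) by (auto simp: monotone_paths_def elim: eventually_mono)
  show "converges_in_law m1_topology F (completion M) (\<lambda>i. cadlag_path (Y i)) (completion M') (cadlag_path Y')"
  proof (rule converges_in_law_open_sets)
    show "prob_space (completion M)" "prob_space (completion M')"
      using pM pM' by (auto intro: prob_space.prob_space_completion)
    show "\<forall>\<^sub>F i in F. cadlag_path (Y i) \<in> measurable (completion M) (borel_of m1_topology)"
      using Y by eventually_elim (use cadlag_path_measurable[OF pM] in auto)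
    show "cadlag_path Y' \<in> measurable (completion M') (borel_of m1_topology)"
      using Y' by (intro cadlag_path_measurable[OF pM'])
    fix U e assume "openin m1_topology U" and e: "0 < (e::real)"
    then have "m1_open U" by (simp add: openin_m1_topology)
    then obtain \<F> where *: "countable \<F>" "\<And>F. F \<in> \<F> \<Longrightarrow> finite F"
      "\<And>F c. F \<in> \<F> \<Longrightarrow> c \<in> F \<Longrightarrow> 0 \<le> fst c"
      "\<And>y. y \<in> monotone_paths \<Longrightarrow> y \<in> U \<longleftrightarrow> (\<exists>F\<in>\<F>. \<forall>c\<in>F. 0 < gap y c)"
      using m1_open_monotone_paths[of U] by metis
    show "\<forall>\<^sub>F i in F. measure (completion M') (cadlag_path Y' -` U \<inter> space (completion M')) - e
      < measure (completion M) (cadlag_path (Y i) -` U \<inter> space (completion M))"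
    proof -
      have fin: "measure M' (cond_event M' Y' \<F>) - e / 2 < measure M' (cond_event M' Y' \<G>)"
        if "\<G> = \<F>" for \<G> using that e by simp
      \<comment> \<open>finitely many of the sets of conditions exhaust the limit event up to \<open>e / 2\<close>\<close>
      have "\<exists>\<G>. finite \<G> \<and> \<G> \<subseteq> \<F> \<and> measure M' (cond_event M' Y' \<F>) - e / 2 < measure M' (cond_event M' Y' \<G>)"
      proof (cases "finite \<F>")
        case True then show ?thesis using fin by blast
      next
        case False
        define A where "A n = from_nat_into \<F> ` {..n}" for n
        have A: "finite (A n)" "A n \<subseteq> \<F>" for n
          using False by (auto simp: A_def intro!: from_nat_into)
        have sets: "cond_event M' Y' (A n) \<in> sets M'" for n
          by (rule cond_event_sets) (use A[of n] *(2,3) Y'(1) in \<open>auto intro: countable_finite\<close>)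
        have "incseq (\<lambda>n. cond_event M' Y' (A n))"
          by (rule incseq_SucI) (auto simp: cond_event_def A_def)
        moreover have "(\<Union>n. cond_event M' Y' (A n)) = cond_event M' Y' \<F>"
        proof -
          have "F \<in> \<F> \<longleftrightarrow> (\<exists>n. F \<in> A n)" for F
            using A(2) from_nat_into_surj[OF *(1), of F] by (fastforce simp: A_def)
          then show ?thesis unfolding cond_event_def by blast
        qed
        ultimately have "(\<lambda>n. measure M' (cond_event M' Y' (A n))) \<longlonglongrightarrow> measure M' (cond_event M' Y' \<F>)"
          using M'.finite_Lim_measure_incseq[of "\<lambda>n. cond_event M' Y' (A n)"] sets by auto
        then have "\<forall>\<^sub>F n in sequentially. measure M' (cond_event M' Y' \<F>) - e / 2 < measure M' (cond_event M' Y' (A n))"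
          using e by (intro order_tendstoD) auto
        then show ?thesis using A unfolding eventually_sequentially by blast
      qed
      then obtain \<G> where \<G>: "finite \<G>" "\<G> \<subseteq> \<F>"
        "measure M' (cond_event M' Y' \<F>) - e / 2 < measure M' (cond_event M' Y' \<G>)" by blast
      \<comment> \<open>the finitely many times, and a function that is positive iff one of the conditions is met\<close>
      define J where "J = (\<Union>F\<in>\<G>. (\<lambda>c. of_rat (fst c) :: real) ` F)"
      have J: "finite J" "J \<subseteq> {0..}" using \<G> *(2,3) by (auto simp: J_def)
      define h where "h y = (\<Sum>F\<in>\<G>. \<Prod>c\<in>F. max 0 (gap y c))" for y
      have h0: "0 \<le> h y" for y by (auto simp: h_def intro!: sum_nonneg prod_nonneg)
      have hpos: "0 < h y \<longleftrightarrow> (\<exists>F\<in>\<G>. \<forall>c\<in>F. 0 < gap y c)" for y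
      proof -
        have "h y = 0 \<longleftrightarrow> (\<forall>F\<in>\<G>. (\<Prod>c\<in>F. max 0 (gap y c)) = 0)"
          unfolding h_def using \<G>(1) by (intro sum_nonneg_eq_0_iff) (auto intro!: prod_nonneg)
        also have "\<dots> \<longleftrightarrow> (\<forall>F\<in>\<G>. \<exists>c\<in>F. gap y c \<le> 0)"
        proof (intro ball_cong refl)
          fix F assume "F \<in> \<G>"
          then have "finite F" using \<G>(2) *(2) by auto
          moreover have "max 0 (gap y c) = 0 \<longleftrightarrow> gap y c \<le> 0" for c by linarith
          ultimately show "((\<Prod>c\<in>F. max 0 (gap y c)) = 0) = (\<exists>c\<in>F. gap y c \<le> 0)" by simp
        qed
        finally show ?thesis using h0[of y] by (auto simp: less_le not_le)
      qed
      have gapJ: "gap (\<lambda>t\<in>J. z t) c = gap z c" if "F \<in> \<G>" "c \<in> F" for F c z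
      proof -
        have "of_rat (fst c) \<in> J" using that by (auto simp: J_def)
        then show ?thesis by (cases c) (auto simp: gap_def)
      qed
      have ev: "{\<omega>\<in>space M. 0 < h (\<lambda>t\<in>J. Y i t \<omega>)} = cond_event M (Y i) \<G>"
        "{\<omega>\<in>space M'. 0 < h (\<lambda>t\<in>J. Y' t \<omega>)} = cond_event M' Y' \<G>" for i
        unfolding hpos cond_event_def using gapJ by auto
      have "continuous_map (product_topology (\<lambda>_. euclideanreal) J) euclideanreal (\<lambda>y. gap y c)"
        if "F \<in> \<G>" "c \<in> F" for F c
      proof -
        have "of_rat (fst c) \<in> J" using that by (auto simp: J_def)
        then show ?thesis
          unfolding gap_def by (cases c) (auto intro!: continuous_map_diff continuous_map_product_projection)
      qed
      then have hc: "continuous_map (product_topology (\<lambda>_. euclideanreal) J) euclideanreal h"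
        unfolding h_def using \<G> *(2)
        by (intro continuous_map_sum continuous_map_prod continuous_map_real_max) auto
      have "0 < e / 2" using e by simp
      from converges_fdd_positive[OF pM pM' fdd J hc h0 this] Y
      show ?thesis
      proof eventually_elim
        case (elim i)
        have "measure M (cond_event M (Y i) \<G>) \<le> measure M (cond_event M (Y i) \<F>)"
          using elim(2) * \<G>(2) by (intro M.finite_measure_mono cond_event_sets) (auto simp: cond_event_def)
        then show ?case
          using cadlag_path_cond_event(2)[OF pM *(4) *(1,2,3), where Y = "Y i"] elim
            cadlag_path_cond_event(2)[OF pM' *(4) *(1,2,3), where Y = Y'] Y' \<G>(3)
          unfolding ev by simp
      qed
    qed
  qed
qed

section \<open>Convergence of Laplace transforms\<close>


text \<open>Boxes with rational corners form a countable base of the product topology over a finite set.\<close>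

lemma restrict_measurable_borel_of:
  assumes J: "finite J" and Y: "\<And>t. t \<in> J \<Longrightarrow> Y t \<in> borel_measurable M"
  shows "(\<lambda>\<omega>. \<lambda>t\<in>J. Y t \<omega> :: real) \<in> measurable M (borel_of (product_topology (\<lambda>_. euclideanreal) J))"
proof (rule measurable_borel_ofI)
  fix U assume U: "openin (product_topology (\<lambda>_. euclideanreal) J) U"
  define box :: "('a \<Rightarrow> rat \<times> rat) \<Rightarrow> ('a \<Rightarrow> real) set"
    where "box f = (\<Pi>\<^sub>E t\<in>J. {of_rat (fst (f t)) <..< of_rat (snd (f t))})" for f
  define B where "B = {f \<in> J \<rightarrow>\<^sub>E UNIV. box f \<subseteq> U}"
  have cB: "countable B"
    unfolding B_def by (rule countable_subset[OF _ countable_PiE[OF J]]) auto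
  have "\<exists>f\<in>B. x \<in> box f" if "x \<in> U" for x
  proof -
    have "\<exists>V. finite {i \<in> J. V i \<noteq> topspace euclideanreal} \<and>
        (\<forall>i\<in>J. openin euclideanreal (V i)) \<and> x \<in> Pi\<^sub>E J V \<and> Pi\<^sub>E J V \<subseteq> U"
      using U that unfolding openin_product_topology_alt by (rule bspec)
    then obtain V where *: "finite {i \<in> J. V i \<noteq> topspace euclideanreal} \<and>
        (\<forall>i\<in>J. openin euclideanreal (V i)) \<and> x \<in> Pi\<^sub>E J V \<and> Pi\<^sub>E J V \<subseteq> U" ..
    then have V': "\<forall>i\<in>J. openin euclideanreal (V i)" and V: "x \<in> Pi\<^sub>E J V" "Pi\<^sub>E J V \<subseteq> U" by simp_all
    have "\<exists>q. of_rat (fst q) < x t \<and> x t < of_rat (snd q) \<and> {of_rat (fst q) <..< of_rat (snd q)} \<subseteq> V t"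
      if t: "t \<in> J" for t
    proof -
      have "x t \<in> V t" using V(1) t by auto
      then obtain d where d: "0 < d" "\<And>y. dist y (x t) < d \<Longrightarrow> y \<in> V t"
        using V' t unfolding open_openin[symmetric] open_dist by blast
      obtain a where a: "x t - d < of_rat a" "of_rat a < x t" using of_rat_dense[of "x t - d" "x t"] d by auto
      obtain b where b: "x t < of_rat b" "of_rat b < x t + d" using of_rat_dense[of "x t" "x t + d"] d by auto
      show ?thesis
        by (rule exI[of _ "(a, b)"]) (use a b d(2) in \<open>auto simp: dist_real_def abs_less_iff\<close>)
    qed
    then obtain q where q: "\<And>t. t \<in> J \<Longrightarrow> of_rat (fst (q t)) < x t \<and> x t < of_rat (snd (q t)) \<and>
        {of_rat (fst (q t)) <..< of_rat (snd (q t))} \<subseteq> V t" by metis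
    have "box (restrict q J) \<subseteq> Pi\<^sub>E J V"
      unfolding box_def by (intro PiE_mono) (use q in auto)
    then have "restrict q J \<in> B" using V(2) by (auto simp: B_def)
    moreover have "x \<in> box (restrict q J)" using q V(1) by (auto simp: box_def PiE_iff)
    ultimately show ?thesis by blast
  qed
  then have U_eq: "U = (\<Union>f\<in>B. box f)" by (fastforce simp: B_def)
  have "(\<lambda>t\<in>J. Y t \<omega>) \<in> U \<longleftrightarrow> (\<exists>f\<in>B. \<forall>t\<in>J. of_rat (fst (f t)) < Y t \<omega> \<and> Y t \<omega> < of_rat (snd (f t)))" for \<omega>
    by (subst U_eq) (simp add: box_def PiE_iff)
  then have "(\<lambda>\<omega>. \<lambda>t\<in>J. Y t \<omega>) -` U \<inter> space M =
      (\<Union>f\<in>B. {\<omega>\<in>space M. \<forall>t\<in>J. of_rat (fst (f t)) < Y t \<omega> \<and> Y t \<omega> < of_rat (snd (f t))})"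
    by blast
  also have "\<dots> \<in> sets M"
  proof (intro sets.countable_UN'' cB)
    fix f
    have "{\<omega>\<in>space M. of_rat (fst (f t)) < Y t \<omega> \<and> Y t \<omega> < of_rat (snd (f t))} \<in> sets M" if "t \<in> J" for t
    proof -
      have [measurable]: "Y t \<in> borel_measurable M" by (rule Y[OF that])
      show ?thesis by measurable
    qed
    then show "{\<omega>\<in>space M. \<forall>t\<in>J. of_rat (fst (f t)) < Y t \<omega> \<and> Y t \<omega> < of_rat (snd (f t))} \<in> sets M"
      using J by (intro sets.sets_Collect_finite_All)
  qed
  finally show "(\<lambda>\<omega>. \<lambda>t\<in>J. Y t \<omega>) -` U \<inter> space M \<in> sets M" .
qed (auto simp: topspace_product_topology)

lemma (in prob_space) expectation_diff_bound:
  fixes f g :: "'a \<Rightarrow> real"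
  assumes "integrable M f" "integrable M g" "\<And>\<omega>. \<omega> \<in> space M \<Longrightarrow> \<bar>f \<omega> - g \<omega>\<bar> \<le> e"
  shows "\<bar>expectation f - expectation g\<bar> \<le> e"
proof -
  have "\<bar>expectation (\<lambda>\<omega>. f \<omega> - g \<omega>)\<bar> \<le> expectation (\<lambda>\<omega>. \<bar>f \<omega> - g \<omega>\<bar>)"
    using integral_norm_bound[of M "\<lambda>\<omega>. f \<omega> - g \<omega>"] by simp
  also have "\<dots> \<le> expectation (\<lambda>\<omega>. e)"
    using assms by (intro integral_mono) auto
  finally show ?thesis using assms by (simp add: prob_space)
qed

text \<open>The moments \<open>\<Prod>t\<in>J. U t ^ k t\<close> determine convergence on the cube: the functions \<open>g\<close> whose
  product with any convergent test function is again convergent form a ring that separates points,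
  and Stone--Weierstrass applies.  Countability of the index type makes the surrounding function space
  metrizable.\<close>

lemma moments_convergence:
  fixes U :: "'i \<Rightarrow> 'j :: countable \<Rightarrow> 'a \<Rightarrow> real"
  assumes pM: "prob_space M" and pM': "prob_space M'" and J: "finite J"
    and U: "\<forall>\<^sub>F i in F. \<forall>t\<in>J. U i t \<in> borel_measurable M" "\<And>i t \<omega>. 0 \<le> U i t \<omega> \<and> U i t \<omega> \<le> 1"
    and U': "\<And>t. t \<in> J \<Longrightarrow> U' t \<in> borel_measurable M'" "\<And>t \<omega>. 0 \<le> U' t \<omega> \<and> U' t \<omega> \<le> 1"
    and moments: "\<And>k. ((\<lambda>i. \<integral>\<omega>. (\<Prod>t\<in>J. U i t \<omega> ^ k t) \<partial>M) \<longlongrightarrow> (\<integral>\<omega>. (\<Prod>t\<in>J. U' t \<omega> ^ k t) \<partial>M')) F"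
    and h: "continuous_map (product_topology (\<lambda>_. euclideanreal) J) euclideanreal h"
  shows "((\<lambda>i. \<integral>\<omega>. h (\<lambda>t\<in>J. U i t \<omega>) \<partial>M) \<longlongrightarrow> (\<integral>\<omega>. h (\<lambda>t\<in>J. U' t \<omega>) \<partial>M')) F"
proof -
  interpret M: prob_space M by fact
  interpret M': prob_space M' by fact
  define S where "S = (\<Pi>\<^sub>E t\<in>J. {0..1::real})"
  have US: "(\<lambda>t\<in>J. U i t \<omega>) \<in> S" "(\<lambda>t\<in>J. U' t \<omega>') \<in> S" for i \<omega> \<omega>'
    using U(2) U'(2) by (auto simp: S_def)
  have comp: "compact S"
  proof -
    have "S = (\<Pi>\<^sub>E t\<in>UNIV. if t \<in> J then {0..1} else {undefined})"
      by (auto simp: S_def PiE_iff extensional_def split: if_splits)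
    then have "compactin (product_topology (\<lambda>_::'j. euclideanreal) UNIV) S"
      by (auto simp: compactin_PiE)
    then show ?thesis by (simp add: euclidean_product_topology)
  qed
  have contS: "continuous_on S (\<lambda>y. g y)"
    if g: "continuous_map (product_topology (\<lambda>_. euclideanreal) J) euclideanreal g" for g
  proof -
    have "continuous_map (top_of_set S) (product_topology (\<lambda>_. euclideanreal) J) (\<lambda>y. y)"
      unfolding continuous_map_componentwise
      by (auto simp: S_def PiE_iff intro: continuous_on_product_coordinates continuous_on_subset)
    from continuous_map_compose[OF this g] show ?thesis by (simp add: o_def)
  qed
  define test where "test g \<longleftrightarrow> (\<forall>k.
    (\<forall>\<^sub>F i in F. integrable M (\<lambda>\<omega>. g (\<lambda>t\<in>J. U i t \<omega>) * (\<Prod>t\<in>J. U i t \<omega> ^ k t))) \<and>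
    integrable M' (\<lambda>\<omega>. g (\<lambda>t\<in>J. U' t \<omega>) * (\<Prod>t\<in>J. U' t \<omega> ^ k t)) \<and>
    ((\<lambda>i. \<integral>\<omega>. g (\<lambda>t\<in>J. U i t \<omega>) * (\<Prod>t\<in>J. U i t \<omega> ^ k t) \<partial>M) \<longlongrightarrow>
      (\<integral>\<omega>. g (\<lambda>t\<in>J. U' t \<omega>) * (\<Prod>t\<in>J. U' t \<omega> ^ k t) \<partial>M')) F)" for g
  have testD: "\<forall>\<^sub>F i in F. integrable M (\<lambda>\<omega>. p (\<lambda>t\<in>J. U i t \<omega>) * (\<Prod>t\<in>J. U i t \<omega> ^ l t))"
    "integrable M' (\<lambda>\<omega>. p (\<lambda>t\<in>J. U' t \<omega>) * (\<Prod>t\<in>J. U' t \<omega> ^ l t))"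
    "((\<lambda>i. \<integral>\<omega>. p (\<lambda>t\<in>J. U i t \<omega>) * (\<Prod>t\<in>J. U i t \<omega> ^ l t) \<partial>M) \<longlongrightarrow>
      (\<integral>\<omega>. p (\<lambda>t\<in>J. U' t \<omega>) * (\<Prod>t\<in>J. U' t \<omega> ^ l t) \<partial>M')) F" if "test p" for p l
    using that unfolding test_def by blast+
  have test_one: "test (\<lambda>_. 1)"
    unfolding test_def
  proof (intro allI conjI)
    fix k
    have bd: "\<bar>\<Prod>t\<in>J. U i t \<omega> ^ k t\<bar> \<le> 1" "\<bar>\<Prod>t\<in>J. U' t \<omega>' ^ k t\<bar> \<le> 1" for i \<omega> \<omega>'
      using U(2) U'(2) by (auto simp: abs_prod intro!: prod_le_1 power_le_one)
    show "\<forall>\<^sub>F i in F. integrable M (\<lambda>\<omega>. 1 * (\<Prod>t\<in>J. U i t \<omega> ^ k t))"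
      using U(1) by eventually_elim (use bd in \<open>auto intro!: M.integrable_const_bound[of _ 1] borel_measurable_prod borel_measurable_power\<close>)
    show "integrable M' (\<lambda>\<omega>. 1 * (\<Prod>t\<in>J. U' t \<omega> ^ k t))"
      using U'(1) bd by (auto intro!: M'.integrable_const_bound[of _ 1] borel_measurable_prod borel_measurable_power)
  qed (use moments in simp)
  have test_add: "test (\<lambda>y. f y + g y)" if f: "test f" and g: "test g" for f g
    unfolding test_def
  proof (intro allI conjI)
    fix k
    show *: "\<forall>\<^sub>F i in F. integrable M (\<lambda>\<omega>. (f (\<lambda>t\<in>J. U i t \<omega>) + g (\<lambda>t\<in>J. U i t \<omega>)) * (\<Prod>t\<in>J. U i t \<omega> ^ k t))"
      using testD(1)[OF f] testD(1)[OF g] by eventually_elim (auto simp: distrib_right)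
    show "integrable M' (\<lambda>\<omega>. (f (\<lambda>t\<in>J. U' t \<omega>) + g (\<lambda>t\<in>J. U' t \<omega>)) * (\<Prod>t\<in>J. U' t \<omega> ^ k t))"
      using testD(2)[OF f] testD(2)[OF g] by (auto simp: distrib_right)
    have "\<forall>\<^sub>F i in F. (\<integral>\<omega>. f (\<lambda>t\<in>J. U i t \<omega>) * (\<Prod>t\<in>J. U i t \<omega> ^ k t) \<partial>M) +
          (\<integral>\<omega>. g (\<lambda>t\<in>J. U i t \<omega>) * (\<Prod>t\<in>J. U i t \<omega> ^ k t) \<partial>M) =
        (\<integral>\<omega>. (f (\<lambda>t\<in>J. U i t \<omega>) + g (\<lambda>t\<in>J. U i t \<omega>)) * (\<Prod>t\<in>J. U i t \<omega> ^ k t) \<partial>M)"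
      using testD(1)[where ?l1 = k, OF f] testD(1)[where ?l1 = k, OF g] by eventually_elim (auto simp: distrib_right)
    from Lim_transform_eventually[OF tendsto_add[OF testD(3)[where ?l1 = k, OF f] testD(3)[where ?l1 = k, OF g]] this]
    show "((\<lambda>i. \<integral>\<omega>. (f (\<lambda>t\<in>J. U i t \<omega>) + g (\<lambda>t\<in>J. U i t \<omega>)) * (\<Prod>t\<in>J. U i t \<omega> ^ k t) \<partial>M) \<longlongrightarrow>
      (\<integral>\<omega>. (f (\<lambda>t\<in>J. U' t \<omega>) + g (\<lambda>t\<in>J. U' t \<omega>)) * (\<Prod>t\<in>J. U' t \<omega> ^ k t) \<partial>M')) F"
      using testD(2)[where ?l1 = k, OF f] testD(2)[where ?l1 = k, OF g] by (auto simp: distrib_right)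
  qed
  have test_const: "test (\<lambda>y. c * g y)" if g: "test g" for c g
    unfolding test_def
  proof (intro allI conjI)
    fix k
    show "\<forall>\<^sub>F i in F. integrable M (\<lambda>\<omega>. (c * g (\<lambda>t\<in>J. U i t \<omega>)) * (\<Prod>t\<in>J. U i t \<omega> ^ k t))"
      using testD(1)[OF g] by eventually_elim (auto simp: mult.assoc)
  qed (use testD(2,3)[OF g] in \<open>auto simp: mult.assoc intro!: tendsto_intros\<close>)
  have test_coord: "test (\<lambda>y. y s * g y)" if g: "test g" and s: "s \<in> J" for g s
  proof -
    have "(\<Prod>t\<in>J. V t ^ (k(s := Suc (k s))) t) = V s * (\<Prod>t\<in>J. V t ^ k t)" for k and V :: "'j \<Rightarrow> real"
    proof -
      have "(\<Prod>t\<in>J. V t ^ (k(s := Suc (k s))) t) = (\<Prod>t\<in>J. V t ^ k t * (if t = s then V t else 1))"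
        by (intro prod.cong) auto
      also have "\<dots> = (\<Prod>t\<in>J. V t ^ k t) * V s" using s J by (simp add: prod.distrib)
      finally show ?thesis by simp
    qed
    then have eq: "g (\<lambda>t\<in>J. V t) * (\<Prod>t\<in>J. V t ^ (k(s := Suc (k s))) t) =
        (\<lambda>t\<in>J. V t) s * g (\<lambda>t\<in>J. V t) * (\<Prod>t\<in>J. V t ^ k t)" for k and V :: "'j \<Rightarrow> real"
      using s by simp
    show ?thesis
      unfolding test_def eq[symmetric] using testD[OF g] by blast
  qed
  define R where "R = {g. continuous_on S g \<and> (\<forall>g'. test g' \<longrightarrow> test (\<lambda>y. g y * g' y))}"
  interpret R: function_ring_on R S
  proof
    fix f g assume f: "f \<in> R" and g: "g \<in> R"
    show "(\<lambda>x. f x + g x) \<in> R"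
      using f g test_add unfolding R_def by (auto intro!: continuous_intros simp: distrib_right)
    show "(\<lambda>x. f x * g x) \<in> R"
      using f g unfolding R_def by (auto intro!: continuous_intros simp: mult.assoc)
  next
    show "(\<lambda>_. c) \<in> R" for c using test_const unfolding R_def by auto
    fix x y assume xy: "x \<in> S" "y \<in> S" "x \<noteq> y"
    then obtain s where s: "x s \<noteq> y s" by auto
    then have "s \<in> J" using xy by (auto simp: S_def PiE_iff extensional_def)
    then have "(\<lambda>y. y s) \<in> R" unfolding R_def using test_coord
      by (auto intro: continuous_on_product_coordinates continuous_on_subset)
    then show "\<exists>f\<in>R. f x \<noteq> f y" using s by - (rule bexI[of _ "\<lambda>y. y s"])
  qed (use comp in \<open>auto simp: R_def\<close>)
  have hm: "h \<in> borel_measurable (borel_of (product_topology (\<lambda>_. euclideanreal) J))"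
    by (rule borel_measurable_borel_of[OF h])
  have "bounded (h ` S)" by (intro compact_imp_bounded compact_continuous_image contS[OF h] comp)
  then obtain B where B: "\<And>y. y \<in> S \<Longrightarrow> \<bar>h y\<bar> \<le> B" by (auto simp: bounded_iff)
  have inth: "\<forall>\<^sub>F i in F. integrable M (\<lambda>\<omega>. h (\<lambda>t\<in>J. U i t \<omega>))"
    using U(1)
  proof eventually_elim
    case (elim i)
    then show ?case using measurable_compose[OF restrict_measurable_borel_of[OF J, of "U i"] hm] B US
      by (intro M.integrable_const_bound[of _ B]) auto
  qed
  have inth': "integrable M' (\<lambda>\<omega>. h (\<lambda>t\<in>J. U' t \<omega>))"
    using measurable_compose[OF restrict_measurable_borel_of[OF J, of U'] hm] B US U'(1)
    by (intro M'.integrable_const_bound[of _ B]) auto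
  show ?thesis
  proof (rule tendstoI)
    fix e :: real assume e: "0 < e"
    obtain g where g: "g \<in> R" "\<And>y. y \<in> S \<Longrightarrow> \<bar>h y - g y\<bar> < e / 4"
      using R.Stone_Weierstrass_basic[OF contS[OF h], of "e / 4"] e by auto
    have "test (\<lambda>y. g y * 1)" using g(1) test_one unfolding R_def by blast
    from testD[where ?l1 = "\<lambda>_. 0", OF this]
    have gi: "\<forall>\<^sub>F i in F. integrable M (\<lambda>\<omega>. g (\<lambda>t\<in>J. U i t \<omega>))"
      and gi': "integrable M' (\<lambda>\<omega>. g (\<lambda>t\<in>J. U' t \<omega>))"
      and glim: "((\<lambda>i. \<integral>\<omega>. g (\<lambda>t\<in>J. U i t \<omega>) \<partial>M) \<longlongrightarrow> (\<integral>\<omega>. g (\<lambda>t\<in>J. U' t \<omega>) \<partial>M')) F"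
      by simp_all
    have glim_near: "\<forall>\<^sub>F i in F. dist (\<integral>\<omega>. g (\<lambda>t\<in>J. U i t \<omega>) \<partial>M) (\<integral>\<omega>. g (\<lambda>t\<in>J. U' t \<omega>) \<partial>M') < e / 4"
      by (rule tendstoD[OF glim]) (use e in auto)
    show "\<forall>\<^sub>F i in F. dist (\<integral>\<omega>. h (\<lambda>t\<in>J. U i t \<omega>) \<partial>M) (\<integral>\<omega>. h (\<lambda>t\<in>J. U' t \<omega>) \<partial>M') < e"
      using gi inth glim_near
    proof eventually_elim
      case (elim i)
      have 1: "\<bar>(\<integral>\<omega>. h (\<lambda>t\<in>J. U i t \<omega>) \<partial>M) - (\<integral>\<omega>. g (\<lambda>t\<in>J. U i t \<omega>) \<partial>M)\<bar> \<le> e / 4"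
        using elim g(2)[OF US(1)] by (intro M.expectation_diff_bound) (auto intro: less_imp_le)
      have 2: "\<bar>(\<integral>\<omega>. h (\<lambda>t\<in>J. U' t \<omega>) \<partial>M') - (\<integral>\<omega>. g (\<lambda>t\<in>J. U' t \<omega>) \<partial>M')\<bar> \<le> e / 4"
        using inth' gi' g(2)[OF US(2)] by (intro M'.expectation_diff_bound) (auto intro: less_imp_le)
      show ?case using 1 2 elim(3) e unfolding dist_real_def abs_le_iff abs_less_iff by linarith
    qed
  qed
qed

lemma continuous_map_ln_max:
  assumes "continuous_map X euclideanreal g" "0 < d"
  shows "continuous_map X euclideanreal (\<lambda>x. - ln (max d (g x)))"
proof -
  have "continuous_on UNIV (\<lambda>z. - ln (max d z))"
    using assms(2) by (intro continuous_intros) (auto simp: max_def)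
  then have "continuous_map euclideanreal euclideanreal (\<lambda>z. - ln (max d z))"
    by (simp only: continuous_map_iff_continuous2)
  from continuous_map_compose[OF assms(1) this] show ?thesis by (simp add: o_def)
qed

text \<open>The substitution \<open>y = exp (- x)\<close> maps the orthant into the unit cube and Laplace transforms
  to moments.  A cutoff near the faces \<open>y t = 0\<close> is harmless, since the limit has no mass there.\<close>

lemma converges_fdd_of_laplace:
  fixes Y :: "'i \<Rightarrow> real \<Rightarrow> 'a \<Rightarrow> real"
  assumes pM: "prob_space M" and pM': "prob_space M'"
    and Y: "\<forall>\<^sub>F i in F. \<forall>t\<ge>0. Y i t \<in> borel_measurable M" "\<And>i t \<omega>. 0 \<le> Y i t \<omega>"
    and Y': "\<And>t. 0 \<le> t \<Longrightarrow> Y' t \<in> borel_measurable M'" "AE \<omega> in M'. \<forall>t\<ge>0. 0 \<le> Y' t \<omega>"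
    and laplace: "\<And>J \<theta>. finite J \<Longrightarrow> J \<subseteq> {0..} \<Longrightarrow> (\<And>t. 0 \<le> \<theta> t) \<Longrightarrow>
      ((\<lambda>i. \<integral>\<omega>. exp (- (\<Sum>t\<in>J. \<theta> t * Y i t \<omega>)) \<partial>M) \<longlongrightarrow> (\<integral>\<omega>. exp (- (\<Sum>t\<in>J. \<theta> t * Y' t \<omega>)) \<partial>M')) F"
  shows "converges_fdd F M Y M' Y'"
  unfolding converges_fdd_def converges_in_law_def
proof (intro allI impI conjI)
  interpret M: prob_space M by fact
  interpret M': prob_space M' by fact
  fix J :: "real set" assume J: "finite J \<and> J \<subseteq> {0..}"
  let ?X = "product_topology (\<lambda>_. euclideanreal) J"
  have Ym: "\<forall>\<^sub>F i in F. (\<lambda>\<omega>. \<lambda>t\<in>J. Y i t \<omega>) \<in> measurable M (borel_of ?X)"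
    using Y(1)
  proof eventually_elim
    case (elim i)
    then show ?case using J by (intro restrict_measurable_borel_of) auto
  qed
  then show "\<forall>\<^sub>F i in F. (\<lambda>\<omega>. \<lambda>t\<in>J. Y i t \<omega>) \<in> measurable M (borel_of ?X)" .
  have Ym': "(\<lambda>\<omega>. \<lambda>t\<in>J. Y' t \<omega>) \<in> measurable M' (borel_of ?X)"
    using J Y'(1) by (intro restrict_measurable_borel_of) auto
  then show "(\<lambda>\<omega>. \<lambda>t\<in>J. Y' t \<omega>) \<in> measurable M' (borel_of ?X)" .
  fix f assume f: "continuous_map ?X euclideanreal f \<and> bounded (f ` topspace ?X)"
  then obtain B where B: "0 < B" "\<And>x. x \<in> topspace ?X \<Longrightarrow> \<bar>f x\<bar> \<le> B"
    unfolding bounded_pos by auto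
  have fB: "\<bar>f (\<lambda>t\<in>J. z t)\<bar> \<le> B" for z by (rule B(2)) auto
  have fm: "f \<in> borel_measurable (borel_of ?X)" using f by (intro borel_measurable_borel_of) auto
  define N where "N = {..<card J}"
  \<comment> \<open>times are enumerated by natural numbers, to have a countable index type\<close>
  obtain b where b: "bij_betw b N J"
    using J ex_bij_betw_nat_finite[of J] by (auto simp: N_def atLeast0LessThan)
  have bJ: "b n \<in> J" "0 \<le> b n" if "n \<in> N" for n using b that J by (auto simp: bij_betw_def)
  define c where "c = inv_into N b"
  have c: "c t \<in> N" "b (c t) = t" if "t \<in> J" for t
    using b that by (auto simp: c_def bij_betw_def inv_into_into f_inv_into_f)
  have cb: "c (b n) = n" if "n \<in> N" for n
    using b that by (auto simp: c_def bij_betw_def)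
  define U where "U i n \<omega> = exp (- Y i (b n) \<omega>)" for i n \<omega>
  define U' where "U' n \<omega> = exp (- max 0 (Y' (b n) \<omega>))" for n \<omega>
  let ?XN = "product_topology (\<lambda>_. euclideanreal) N"
  have Um: "\<forall>\<^sub>F i in F. \<forall>n\<in>N. U i n \<in> borel_measurable M"
    using Y(1)
  proof eventually_elim
    case (elim i)
    then have [measurable]: "n \<in> N \<Longrightarrow> Y i (b n) \<in> borel_measurable M" for n using bJ by auto
    show ?case unfolding U_def by auto
  qed
  have Um': "U' n \<in> borel_measurable M'" if "n \<in> N" for n
  proof -
    have [measurable]: "Y' (b n) \<in> borel_measurable M'" using bJ[OF that] Y'(1) by auto
    show ?thesis unfolding U'_def by auto
  qed
  have conv: "((\<lambda>i. \<integral>\<omega>. h (\<lambda>n\<in>N. U i n \<omega>) \<partial>M) \<longlongrightarrow> (\<integral>\<omega>. h (\<lambda>n\<in>N. U' n \<omega>) \<partial>M')) F"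
    if "continuous_map ?XN euclideanreal h" for h
  proof (rule moments_convergence[OF pM pM' _ Um _ Um' _ _ that])
    show "((\<lambda>i. \<integral>\<omega>. (\<Prod>n\<in>N. U i n \<omega> ^ k n) \<partial>M) \<longlongrightarrow> (\<integral>\<omega>. (\<Prod>n\<in>N. U' n \<omega> ^ k n) \<partial>M')) F" for k
    proof -
      have sum: "(\<Sum>t\<in>J. real (k (c t)) * z t) = (\<Sum>n\<in>N. real (k n) * z (b n))" for z :: "real \<Rightarrow> real"
        using sum.reindex_bij_betw[OF b, of "\<lambda>t. real (k (c t)) * z t"] cb by simp
      have 1: "(\<Prod>n\<in>N. U i n \<omega> ^ k n) = exp (- (\<Sum>t\<in>J. real (k (c t)) * Y i t \<omega>))" for i \<omega>
        unfolding sum U_def by (simp add: exp_sum[symmetric] exp_of_nat_mult[symmetric] sum_negf[symmetric] N_def)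
      have 2: "(\<integral>\<omega>. (\<Prod>n\<in>N. U' n \<omega> ^ k n) \<partial>M') = (\<integral>\<omega>. exp (- (\<Sum>t\<in>J. real (k (c t)) * Y' t \<omega>)) \<partial>M')"
      proof (rule integral_cong_AE)
        show "AE \<omega> in M'. (\<Prod>n\<in>N. U' n \<omega> ^ k n) = exp (- (\<Sum>t\<in>J. real (k (c t)) * Y' t \<omega>))"
          using Y'(2)
        proof eventually_elim
          case (elim \<omega>)
          then have "U' n \<omega> = exp (- Y' (b n) \<omega>)" if "n \<in> N" for n
            using bJ[OF that] by (auto simp: U'_def max_def)
          then show ?case unfolding sum
            by (simp add: exp_sum[symmetric] exp_of_nat_mult[symmetric] sum_negf[symmetric] N_def)
        qed
        show "(\<lambda>\<omega>. exp (- (\<Sum>t\<in>J. real (k (c t)) * Y' t \<omega>))) \<in> borel_measurable M'"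
        proof -
          have [measurable]: "t \<in> J \<Longrightarrow> Y' t \<in> borel_measurable M'" for t using Y'(1) J by auto
          show ?thesis by measurable
        qed
      qed (use Um' in \<open>auto intro!: borel_measurable_prod borel_measurable_power\<close>)
      show ?thesis unfolding 1 2 using J by (intro laplace) auto
    qed
  qed (use Y(2) in \<open>auto simp: N_def U_def U'_def\<close>)
  \<comment> \<open>\<open>cut d\<close> vanishes as soon as one coordinate is at most \<open>d\<close>, and is \<open>1\<close> if all are at least \<open>2 * d\<close>\<close>
  define cut where "cut d y = (\<Prod>n\<in>N. min 1 (max 0 (y n / d - 1)))" for d :: real and y :: "nat \<Rightarrow> real"
  define G where "G d y = f (\<lambda>t\<in>J. - ln (max d (y (c t)))) * cut d y" for d :: real and y :: "nat \<Rightarrow> real"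
  have cut01: "0 \<le> cut d y" "cut d y \<le> 1" for d y
    by (auto simp: cut_def intro!: prod_nonneg prod_le_1)
  have proj: "continuous_map ?XN euclideanreal (\<lambda>y. y n)" if "n \<in> N" for n
    by (rule continuous_map_product_projection[OF that])
  have cut_cont: "continuous_map ?XN euclideanreal (cut d)" if "0 < d" for d
    unfolding cut_def using that
    by (auto simp: N_def[symmetric] intro!: continuous_map_prod continuous_map_real_min continuous_map_real_max
      continuous_map_diff continuous_map_real_divide proj) (simp add: N_def)
  have G_cont: "continuous_map ?XN euclideanreal (G d)" if d: "0 < d" for d
  proof -
    have "continuous_map ?XN ?X (\<lambda>y. \<lambda>t\<in>J. - ln (max d (y (c t))))"
      unfolding continuous_map_componentwise
    proof (intro conjI ballI)
      fix t assume t: "t \<in> J"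
      show "continuous_map ?XN euclideanreal (\<lambda>y. (\<lambda>t\<in>J. - ln (max d (y (c t)))) t)"
        using continuous_map_ln_max[OF proj[OF c(1)[OF t]] d] t by simp
    qed auto
    from continuous_map_compose[OF this conjunct1[OF f]]
    show ?thesis unfolding G_def by (intro continuous_map_real_mult cut_cont d) (simp add: o_def)
  qed
  have G_eq: "G d (\<lambda>n\<in>N. exp (- z (b n))) = f (\<lambda>t\<in>J. z t) * cut d (\<lambda>n\<in>N. exp (- z (b n)))" if d: "0 < d" for d z
  proof (cases "cut d (\<lambda>n\<in>N. exp (- z (b n))) = 0")
    case False
    then have pos: "min 1 (max 0 ((\<lambda>n\<in>N. exp (- z (b n))) n / d - 1)) \<noteq> 0" if "n \<in> N" for n
      using that unfolding cut_def by (auto simp: N_def)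
    have "d < exp (- z (b n))" if "n \<in> N" for n
      using pos[OF that] that d by (auto simp: min_def max_def field_simps split: if_splits)
    then have "max d (exp (- z t)) = exp (- z t)" if "t \<in> J" for t
      using c[OF that] by (metis less_imp_le max_absorb2)
    then have "(\<lambda>t\<in>J. - ln (max d ((\<lambda>n\<in>N. exp (- z (b n))) (c t)))) = (\<lambda>t\<in>J. z t)"
      using c by (auto simp: fun_eq_iff restrict_def)
    then show ?thesis by (simp add: G_def)
  qed (simp add: G_def)
  have bound: "\<bar>(\<integral>\<omega>. f (\<lambda>t\<in>J. z t \<omega>) \<partial>P) - (\<integral>\<omega>. G d (\<lambda>n\<in>N. exp (- z (b n) \<omega>)) \<partial>P)\<bar>
      \<le> B * (1 - (\<integral>\<omega>. cut d (\<lambda>n\<in>N. exp (- z (b n) \<omega>)) \<partial>P))"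
    if P: "prob_space P" and d: "0 < d" and z: "\<And>t. t \<in> J \<Longrightarrow> z t \<in> borel_measurable P"
    for P :: "'z measure" and d z
  proof -
    interpret P: prob_space P by fact
    let ?V = "\<lambda>\<omega>. \<lambda>n\<in>N. exp (- z (b n) \<omega>)"
    have Vm: "?V \<in> measurable P (borel_of ?XN)"
      using z bJ by (intro restrict_measurable_borel_of) (auto simp: N_def)
    have "integrable P (\<lambda>\<omega>. f (\<lambda>t\<in>J. z t \<omega>))"
      using measurable_compose[OF restrict_measurable_borel_of fm] J z fB
      by (intro P.integrable_const_bound[of _ B]) auto
    moreover have i2: "integrable P (\<lambda>\<omega>. cut d (?V \<omega>))"
      using measurable_compose[OF Vm borel_measurable_borel_of[OF cut_cont[OF d]]] cut01
      by (intro P.integrable_const_bound[of _ 1]) auto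
    moreover have Gm: "integrable P (\<lambda>\<omega>. G d (?V \<omega>))"
    proof (intro P.integrable_const_bound[of _ B])
      show "AE \<omega> in P. norm (G d (?V \<omega>)) \<le> B"
      proof (rule AE_I2)
        fix \<omega>
        have "\<bar>f (\<lambda>t\<in>J. - ln (max d (?V \<omega> (c t))))\<bar> * \<bar>cut d (?V \<omega>)\<bar> \<le> B * 1"
          using fB cut01 B(1) by (intro mult_mono) auto
        then show "norm (G d (?V \<omega>)) \<le> B" by (simp add: G_def abs_mult)
      qed
    qed (rule measurable_compose[OF Vm borel_measurable_borel_of[OF G_cont[OF d]]])
    moreover have "\<bar>f (\<lambda>t\<in>J. z t \<omega>) - G d (?V \<omega>)\<bar> \<le> B * (1 - cut d (?V \<omega>))" for \<omega>
    proof -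
      have "f (\<lambda>t\<in>J. z t \<omega>) - G d (?V \<omega>) = f (\<lambda>t\<in>J. z t \<omega>) * (1 - cut d (?V \<omega>))"
        using G_eq[OF d, of "\<lambda>t. z t \<omega>"] by (simp add: algebra_simps)
      then show ?thesis using fB[of "\<lambda>t. z t \<omega>"] cut01[of d "?V \<omega>"]
        by (simp add: abs_mult mult_right_mono)
    qed
    ultimately have "\<bar>\<integral>\<omega>. f (\<lambda>t\<in>J. z t \<omega>) - G d (?V \<omega>) \<partial>P\<bar> \<le> (\<integral>\<omega>. B * (1 - cut d (?V \<omega>)) \<partial>P)"
      by (intro order_trans[OF integral_abs_bound] integral_mono) auto
    then show ?thesis
      using \<open>integrable P (\<lambda>\<omega>. f _)\<close> i2 Gm by (simp add: P.prob_space)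
  qed
  have "(\<lambda>m. \<integral>\<omega>. cut (1 / real (Suc m)) (\<lambda>n\<in>N. U' n \<omega>) \<partial>M') \<longlonglongrightarrow> (\<integral>\<omega>. 1 \<partial>M')"
  proof (rule integral_dominated_convergence[where w = "\<lambda>_. 1"])
    show "AE \<omega> in M'. (\<lambda>m. cut (1 / real (Suc m)) (\<lambda>n\<in>N. U' n \<omega>)) \<longlonglongrightarrow> 1"
    proof (rule AE_I2)
      fix \<omega>
      have "(\<lambda>m. min 1 (max 0 ((\<lambda>n\<in>N. U' n \<omega>) n / (1 / real (Suc m)) - 1))) \<longlonglongrightarrow> 1" if n: "n \<in> N" for n
      proof (rule tendsto_eventually)
        have u: "0 < U' n \<omega>" by (simp add: U'_def)
        obtain k :: nat where k: "2 / U' n \<omega> < k" using reals_Archimedean2 by blast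
        show "\<forall>\<^sub>F m in sequentially. min 1 (max 0 ((\<lambda>n\<in>N. U' n \<omega>) n / (1 / real (Suc m)) - 1)) = 1"
        proof (rule eventually_sequentiallyI[of k])
          fix m assume "k \<le> m"
          then have "2 / U' n \<omega> < real (Suc m)" using k by linarith
          then have "2 < U' n \<omega> * real (Suc m)" using u by (simp add: field_simps)
          then show "min 1 (max 0 ((\<lambda>n\<in>N. U' n \<omega>) n / (1 / real (Suc m)) - 1)) = 1" using n by simp
        qed
      qed
      from tendsto_prod[of N, OF this]
      show "(\<lambda>m. cut (1 / real (Suc m)) (\<lambda>n\<in>N. U' n \<omega>)) \<longlonglongrightarrow> 1"
        unfolding cut_def by simp
    qed
    show "(\<lambda>\<omega>. cut (1 / real (Suc m)) (\<lambda>n\<in>N. U' n \<omega>)) \<in> borel_measurable M'" for m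
      by (rule measurable_compose[OF restrict_measurable_borel_of borel_measurable_borel_of[OF cut_cont]])
        (use Um' in \<open>auto simp: N_def\<close>)
  qed (use cut01 in auto)
  then have lim1: "(\<lambda>m. \<integral>\<omega>. cut (1 / real (Suc m)) (\<lambda>n\<in>N. U' n \<omega>) \<partial>M') \<longlonglongrightarrow> 1" by (simp add: M'.prob_space)
  show "((\<lambda>i. \<integral>\<omega>. f (\<lambda>t\<in>J. Y i t \<omega>) \<partial>M) \<longlongrightarrow> (\<integral>\<omega>. f (\<lambda>t\<in>J. Y' t \<omega>) \<partial>M')) F"
  proof (rule tendstoI)
    fix e :: real assume e: "0 < e"
    have eB: "0 < e / (4 * B)" using e B by simp
    then obtain m where m: "\<bar>(\<integral>\<omega>. cut (1 / real (Suc m)) (\<lambda>n\<in>N. U' n \<omega>) \<partial>M') - 1\<bar> < e / (4 * B)"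
      using LIMSEQ_D[OF lim1, of "e / (4 * B)"] by auto
    define d where "d = 1 / real (Suc m)"
    have d: "0 < d" by (simp add: d_def)
    define x' where "x' = (\<integral>\<omega>. cut d (\<lambda>n\<in>N. U' n \<omega>) \<partial>M')"
    define g' where "g' = (\<integral>\<omega>. G d (\<lambda>n\<in>N. U' n \<omega>) \<partial>M')"
    define f' where "f' = (\<integral>\<omega>. f (\<lambda>t\<in>J. Y' t \<omega>) \<partial>M')"
    have x': "B * (1 - x') \<le> e / 4"
      using m B(1) unfolding d_def[symmetric] x'_def[symmetric] by (simp add: field_simps abs_less_iff)
    have fe: "f' = (\<integral>\<omega>. f (\<lambda>t\<in>J. max 0 (Y' t \<omega>)) \<partial>M')"
      unfolding f'_def
    proof (rule integral_cong_AE)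
      show "AE \<omega> in M'. f (\<lambda>t\<in>J. Y' t \<omega>) = f (\<lambda>t\<in>J. max 0 (Y' t \<omega>))"
        using Y'(2)
      proof eventually_elim
        case (elim \<omega>)
        then have "(\<lambda>t\<in>J. Y' t \<omega>) = (\<lambda>t\<in>J. max 0 (Y' t \<omega>))" using J by (auto simp: fun_eq_iff restrict_def max_def)
        then show ?case by simp
      qed
      show "(\<lambda>\<omega>. f (\<lambda>t\<in>J. Y' t \<omega>)) \<in> borel_measurable M'" by (rule measurable_compose[OF Ym' fm])
      show "(\<lambda>\<omega>. f (\<lambda>t\<in>J. max 0 (Y' t \<omega>))) \<in> borel_measurable M'"
        using Y'(1) J by (intro measurable_compose[OF restrict_measurable_borel_of fm]) auto
    qed
    have "\<bar>f' - g'\<bar> \<le> B * (1 - x')"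
      unfolding fe g'_def x'_def U'_def using Y'(1) J by (intro bound[OF pM' d]) auto
    note b' = order_trans[OF this x']
    have ev1: "\<forall>\<^sub>F i in F. dist (\<integral>\<omega>. cut d (\<lambda>n\<in>N. U i n \<omega>) \<partial>M) x' < e / (4 * B)"
      unfolding x'_def by (rule tendstoD[OF conv[OF cut_cont[OF d]] eB])
    have ev2: "\<forall>\<^sub>F i in F. dist (\<integral>\<omega>. G d (\<lambda>n\<in>N. U i n \<omega>) \<partial>M) g' < e / 4"
      unfolding g'_def by (rule tendstoD[OF conv[OF G_cont[OF d]]]) (use e in auto)
    show "\<forall>\<^sub>F i in F. dist (\<integral>\<omega>. f (\<lambda>t\<in>J. Y i t \<omega>) \<partial>M) (\<integral>\<omega>. f (\<lambda>t\<in>J. Y' t \<omega>) \<partial>M') < e"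
      using Y(1) ev1 ev2 unfolding f'_def[symmetric]
    proof eventually_elim
      case (elim i)
      define x where "x = (\<integral>\<omega>. cut d (\<lambda>n\<in>N. U i n \<omega>) \<partial>M)"
      define g where "g = (\<integral>\<omega>. G d (\<lambda>n\<in>N. U i n \<omega>) \<partial>M)"
      define f0 where "f0 = (\<integral>\<omega>. f (\<lambda>t\<in>J. Y i t \<omega>) \<partial>M)"
      have b0: "\<bar>f0 - g\<bar> \<le> B * (1 - x)"
        unfolding f0_def g_def x_def U_def using elim(1) J by (intro bound[OF pM d]) auto
      have "\<bar>x - x'\<bar> < e / (4 * B)" using elim(2) by (simp add: x_def dist_real_def)
      then have "B * \<bar>x - x'\<bar> < e / 4" using B(1) by (simp add: field_simps)
      moreover have "B * (1 - x) \<le> B * (1 - x') + B * \<bar>x - x'\<bar>"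
        using B(1) unfolding distrib_left[symmetric] by (intro mult_left_mono) auto
      ultimately have "\<bar>f0 - g\<bar> < e / 2" using b0 x' by linarith
      moreover have "\<bar>g - g'\<bar> < e / 4" using elim(3) by (simp add: g_def dist_real_def)
      ultimately have "\<bar>f0 - f'\<bar> < e" using b' unfolding abs_less_iff abs_le_iff by linarith
      then show ?case by (simp add: f0_def dist_real_def)
    qed
  qed
qed

section \<open>Integrating out independent sources of randomness\<close>


context branching_particle_system
begin

definition src :: "source \<Rightarrow> 'a set set" where
  "src s = (case s of
     Immigration \<Rightarrow> sets (vimage_algebra (space M) (\<lambda>\<omega> i. S i \<omega>) (\<Pi>\<^sub>M i\<in>UNIV. borel))
   | Offspring v \<Rightarrow> sets (vimage_algebra (space M) (\<rho> v) (count_space UNIV))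
   | Displacement v j \<Rightarrow> sets (vimage_algebra (space M) (\<xi> v j) borel))"

definition srcs :: "source set \<Rightarrow> 'a measure" where
  "srcs J = sigma (space M) (\<Union>s\<in>J. src s)"

lemma indep_src: "indep_sets src UNIV"
  using independent unfolding src_def[abs_def] .

lemma src_subset: "src s \<subseteq> events"
  using indep_src by (auto simp: indep_sets_def)

lemma src_Pow: "(\<Union>s\<in>J. src s) \<subseteq> Pow (space M)"
  using src_subset sets.space_closed by blast

lemma space_srcs [simp]: "space (srcs J) = space M"
  by (simp add: srcs_def space_measure_of[OF src_Pow])

lemma sets_srcs: "sets (srcs J) = sigma_sets (space M) (\<Union>s\<in>J. src s)"
  by (simp add: srcs_def sets_measure_of[OF src_Pow])

lemma sets_srcs_events: "sets (srcs J) \<subseteq> events"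
  unfolding sets_srcs using src_subset by (intro sets.sigma_sets_subset) auto

lemma sets_srcs_mono: "J \<subseteq> J' \<Longrightarrow> sets (srcs J) \<subseteq> sets (srcs J')"
  unfolding sets_srcs by (intro sigma_sets_mono') auto

lemma measurable_srcs_mono:
  assumes "f \<in> measurable (srcs J) N" "J \<subseteq> J'" shows "f \<in> measurable (srcs J') N"
  using assms sets_srcs_mono[OF assms(2)] by (auto simp: measurable_def)

lemma measurable_srcs_events:
  assumes "f \<in> measurable (srcs J) N" shows "f \<in> measurable M N"
  using assms sets_srcs_events by (fastforce simp: measurable_def)

lemma indep_srcs:
  assumes "J \<inter> J' = {}" shows "indep_set (sets (srcs J)) (sets (srcs J'))"
proof -
  have "indep_sets (\<lambda>b. sigma_sets (space M) (\<Union>s\<in>(if b then J else J'). src s)) UNIV"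
  proof (rule indep_sets_collect_sigma)
    show "indep_sets src (\<Union>b\<in>UNIV. if b then J else J')"
      by (rule indep_sets_mono_index[OF _ indep_src]) auto
    show "Int_stable (src s)" for s
      by (cases s) (auto simp: src_def Int_stable_def)
    show "disjoint_family_on (\<lambda>b. if b then J else J') UNIV"
      using assms by (auto simp: disjoint_family_on_def)
  qed
  moreover have "(\<lambda>b. sigma_sets (space M) (\<Union>s\<in>(if b then J else J'). src s)) =
      case_bool (sets (srcs J)) (sets (srcs J'))"
    by (auto simp: fun_eq_iff sets_srcs split: bool.split)
  ultimately show ?thesis by (simp add: indep_set_def)
qed

text \<open>The joint law of the known sources and of a variable depending on other sources is a product
  measure.\<close>

lemma integrate_out:
  fixes g :: "'a \<Rightarrow> 'c \<Rightarrow> ennreal"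
  assumes J: "J \<inter> J' = {}" and R: "R \<in> measurable (srcs J') N"
    and g: "case_prod g \<in> borel_measurable (srcs J \<Otimes>\<^sub>M N)"
  shows "(\<integral>\<^sup>+\<omega>. g \<omega> (R \<omega>) \<partial>M) = (\<integral>\<^sup>+\<omega>. (\<integral>\<^sup>+r. g \<omega> r \<partial>distr M N R) \<partial>M)"
proof -
  have id: "(\<lambda>\<omega>. \<omega>) \<in> measurable M (srcs J)"
    by (rule measurable_srcs_events[of _ J]) simp
  have RM: "R \<in> measurable M N" by (rule measurable_srcs_events[OF R])
  have eq: "distr M (srcs J) (\<lambda>\<omega>. \<omega>) \<Otimes>\<^sub>M distr M N R = distr M (srcs J \<Otimes>\<^sub>M N) (\<lambda>\<omega>. (\<omega>, R \<omega>))"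
  proof (rule pair_measure_eqI)
    show "sigma_finite_measure (distr M (srcs J) (\<lambda>\<omega>. \<omega>))" "sigma_finite_measure (distr M N R)"
      using prob_space_distr[OF id] prob_space_distr[OF RM] by (auto intro: prob_space_imp_sigma_finite)
    fix A B assume A: "A \<in> sets (distr M (srcs J) (\<lambda>\<omega>. \<omega>))" and B: "B \<in> sets (distr M N R)"
    have A': "A \<in> sets (srcs J)" "A \<subseteq> space M" using A sets.sets_into_space[of A "srcs J"] by auto
    have B': "R -` B \<inter> space M \<in> sets (srcs J')" using measurable_sets[OF R, of B] B by simp
    have ev: "A \<in> events" "R -` B \<inter> space M \<in> events" using A' B' sets_srcs_events by auto
    have "prob (A \<inter> (R -` B \<inter> space M)) = prob A * prob (R -` B \<inter> space M)"
      by (rule indep_setD[OF indep_srcs[OF J] A'(1) B'])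
    moreover have "(\<lambda>\<omega>. (\<omega>, R \<omega>)) -` (A \<times> B) \<inter> space M = A \<inter> (R -` B \<inter> space M)" using A' by auto
    moreover have "(\<lambda>\<omega>. \<omega>) -` A \<inter> space M = A" using A' by auto
    ultimately show "emeasure (distr M (srcs J) (\<lambda>\<omega>. \<omega>)) A * emeasure (distr M N R) B =
        emeasure (distr M (srcs J \<Otimes>\<^sub>M N) (\<lambda>\<omega>. (\<omega>, R \<omega>))) (A \<times> B)"
      using A A' B ev id RM by (simp add: emeasure_distr emeasure_eq_measure ennreal_mult)
  qed simp
  interpret R: prob_space "distr M N R" by (rule prob_space_distr[OF RM])
  have g': "case_prod g \<in> borel_measurable (distr M (srcs J) (\<lambda>\<omega>. \<omega>) \<Otimes>\<^sub>M distr M N R)"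
    using g by simp
  have "(\<integral>\<^sup>+\<omega>. g \<omega> (R \<omega>) \<partial>M) = (\<integral>\<^sup>+z. case_prod g z \<partial>distr M (srcs J \<Otimes>\<^sub>M N) (\<lambda>\<omega>. (\<omega>, R \<omega>)))"
    by (subst nn_integral_distr) (use id RM g in auto)
  also have "\<dots> = (\<integral>\<^sup>+\<omega>. \<integral>\<^sup>+r. g \<omega> r \<partial>distr M N R \<partial>distr M (srcs J) (\<lambda>\<omega>. \<omega>))"
    unfolding eq[symmetric] using R.nn_integral_fst[OF g'] by simp
  also have "\<dots> = (\<integral>\<^sup>+\<omega>. (\<integral>\<^sup>+r. g \<omega> r \<partial>distr M N R) \<partial>M)"
    by (subst nn_integral_distr[OF id]) (use R.borel_measurable_nn_integral_fst[OF g'] in auto)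
  finally show ?thesis .
qed

lemma measurable_pair_srcs_mono:
  assumes "f \<in> measurable (srcs J \<Otimes>\<^sub>M N) N'" "J \<subseteq> J'"
  shows "f \<in> measurable (srcs J' \<Otimes>\<^sub>M N) N'"
proof -
  have "(\<lambda>\<omega>. \<omega>) \<in> measurable (srcs J') (srcs J)"
    using sets_srcs_mono[OF assms(2)] sets.sets_into_space[of _ "srcs J"]
    by (auto simp: measurable_def Int_absorb2)
  then have "(\<lambda>z. (fst z, snd z)) \<in> measurable (srcs J' \<Otimes>\<^sub>M N) (srcs J \<Otimes>\<^sub>M N)"
    by (intro measurable_Pair measurable_compose[OF measurable_fst]) auto
  from measurable_compose[OF this assms(1)] show ?thesis by simp
qed

text \<open>One variable at a time; the factors that still contain their variables count as known, which is
  legitimate because their sources are distinct from the one being integrated out.\<close>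

lemma integrate_out_prod:
  fixes g :: "'i \<Rightarrow> 'a \<Rightarrow> 'c \<Rightarrow> ennreal"
  assumes "finite I" "inj_on \<sigma> I" "\<sigma> ` I \<inter> J = {}"
    and "A \<in> borel_measurable (srcs J)"
    and "\<And>i. i \<in> I \<Longrightarrow> R i \<in> measurable (srcs {\<sigma> i}) N"
    and "\<And>i. i \<in> I \<Longrightarrow> case_prod (g i) \<in> borel_measurable (srcs J \<Otimes>\<^sub>M N)"
  shows "(\<integral>\<^sup>+\<omega>. A \<omega> * (\<Prod>i\<in>I. g i \<omega> (R i \<omega>)) \<partial>M) =
    (\<integral>\<^sup>+\<omega>. A \<omega> * (\<Prod>i\<in>I. \<integral>\<^sup>+r. g i \<omega> r \<partial>distr M N (R i)) \<partial>M)"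
  using assms
proof (induction I arbitrary: A rule: finite_induct)
  case (insert i I)
  let ?J = "J \<union> \<sigma> ` I"
  let ?h = "\<lambda>\<omega>. \<integral>\<^sup>+r. g i \<omega> r \<partial>distr M N (R i)"
  have RM: "R i \<in> measurable M N" by (rule measurable_srcs_events[of _ "{\<sigma> i}"]) (use insert in auto)
  interpret R: prob_space "distr M N (R i)" by (rule prob_space_distr[OF RM])
  have Rj: "R j \<in> measurable (srcs ?J) N" if "j \<in> I" for j
    by (rule measurable_srcs_mono[of _ "{\<sigma> j}"]) (use insert.prems that in auto)
  have gj: "(\<lambda>\<omega>. g j \<omega> (R j \<omega>)) \<in> borel_measurable (srcs ?J)" if j: "j \<in> I" for j
  proof -
    have "case_prod (g j) \<in> borel_measurable (srcs ?J \<Otimes>\<^sub>M N)"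
      by (rule measurable_pair_srcs_mono[of _ J]) (use insert.prems j in auto)
    from measurable_compose[OF measurable_Pair[OF measurable_ident_sets[OF refl] Rj[OF j]] this]
    show ?thesis by simp
  qed
  have AJ: "A \<in> borel_measurable (srcs ?J)"
    by (rule measurable_srcs_mono[OF insert.prems(3)]) auto
  have gi: "case_prod (g i) \<in> borel_measurable (srcs ?J \<Otimes>\<^sub>M N)"
    by (rule measurable_pair_srcs_mono[of _ J]) (use insert.prems in auto)
  have B: "(\<lambda>\<omega>. A \<omega> * (\<Prod>j\<in>I. g j \<omega> (R j \<omega>))) \<in> borel_measurable (srcs ?J)"
    using AJ gj by (intro borel_measurable_times_ennreal borel_measurable_prod_ennreal) auto
  have hm: "?h \<in> borel_measurable (srcs J)"
  proof -
    have "case_prod (g i) \<in> borel_measurable (srcs J \<Otimes>\<^sub>M distr M N (R i))" using insert.prems(5)[of i] by simp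
    from R.borel_measurable_nn_integral_fst[OF this] show ?thesis by simp
  qed
  have sec: "g i \<omega> \<in> borel_measurable N" if "\<omega> \<in> space M" for \<omega>
  proof -
    have "(\<lambda>r. case_prod (g i) (\<omega>, r)) \<in> borel_measurable N"
      using insert.prems(5)[of i] that by (intro measurable_compose[OF measurable_Pair1']) auto
    then show ?thesis by simp
  qed
  have "(\<integral>\<^sup>+\<omega>. A \<omega> * (\<Prod>j\<in>insert i I. g j \<omega> (R j \<omega>)) \<partial>M) =
      (\<integral>\<^sup>+\<omega>. (\<lambda>\<omega> r. (A \<omega> * (\<Prod>j\<in>I. g j \<omega> (R j \<omega>))) * g i \<omega> r) \<omega> (R i \<omega>) \<partial>M)"
    using insert.hyps by (intro nn_integral_cong) (simp add: mult_ac)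
  also have "\<dots> = (\<integral>\<^sup>+\<omega>. (\<integral>\<^sup>+r. (A \<omega> * (\<Prod>j\<in>I. g j \<omega> (R j \<omega>))) * g i \<omega> r \<partial>distr M N (R i)) \<partial>M)"
  proof (rule integrate_out)
    show "?J \<inter> {\<sigma> i} = {}" using insert.prems insert.hyps by (auto simp: inj_on_def)
    show "R i \<in> measurable (srcs {\<sigma> i}) N" using insert.prems by auto
    have "(\<lambda>z. (A (fst z) * (\<Prod>j\<in>I. g j (fst z) (R j (fst z)))) * case_prod (g i) z) \<in> borel_measurable (srcs ?J \<Otimes>\<^sub>M N)"
      by (intro borel_measurable_times_ennreal measurable_compose[OF measurable_fst B] gi)
    then show "(\<lambda>(\<omega>, r). (A \<omega> * (\<Prod>j\<in>I. g j \<omega> (R j \<omega>))) * g i \<omega> r) \<in> borel_measurable (srcs ?J \<Otimes>\<^sub>M N)"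
      by (simp add: case_prod_beta')
  qed
  also have "\<dots> = (\<integral>\<^sup>+\<omega>. (A \<omega> * ?h \<omega>) * (\<Prod>j\<in>I. g j \<omega> (R j \<omega>)) \<partial>M)"
  proof (intro nn_integral_cong)
    fix \<omega> assume w: "\<omega> \<in> space M"
    have "g i \<omega> \<in> borel_measurable (distr M N (R i))" using sec[OF w] by simp
    then show "(\<integral>\<^sup>+r. (A \<omega> * (\<Prod>j\<in>I. g j \<omega> (R j \<omega>))) * g i \<omega> r \<partial>distr M N (R i)) =
        (A \<omega> * ?h \<omega>) * (\<Prod>j\<in>I. g j \<omega> (R j \<omega>))"
      by (subst nn_integral_cmult) (auto simp: mult_ac)
  qed
  also have "\<dots> = (\<integral>\<^sup>+\<omega>. (A \<omega> * ?h \<omega>) * (\<Prod>j\<in>I. \<integral>\<^sup>+r. g j \<omega> r \<partial>distr M N (R j)) \<partial>M)"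
    using insert.prems hm by (intro insert.IH borel_measurable_times_ennreal) auto
  also have "\<dots> = (\<integral>\<^sup>+\<omega>. A \<omega> * (\<Prod>j\<in>insert i I. \<integral>\<^sup>+r. g j \<omega> r \<partial>distr M N (R j)) \<partial>M)"
    using insert.hyps by (intro nn_integral_cong) (simp add: mult_ac)
  finally show ?case .
qed simp

lemma immigrant_srcs: "S i \<in> borel_measurable (srcs {Immigration})"
proof -
  let ?V = "vimage_algebra (space M) (\<lambda>\<omega> i. S i \<omega>) (\<Pi>\<^sub>M i\<in>UNIV. borel)"
  have "(\<lambda>\<omega> i. S i \<omega>) \<in> measurable ?V (\<Pi>\<^sub>M i\<in>UNIV. borel)"
    by (rule measurable_vimage_algebra1) (auto simp: space_PiM)
  from measurable_compose[OF this measurable_component_singleton[of i UNIV]]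
  have "S i \<in> borel_measurable ?V" by simp
  moreover have "sets ?V \<subseteq> sets (srcs {Immigration})"
    unfolding sets_srcs by (auto simp: src_def)
  ultimately show ?thesis by (auto simp: measurable_def)
qed

lemma offspring_srcs: "\<rho> v \<in> measurable (srcs {Offspring v}) (count_space UNIV)"
proof -
  have "\<rho> v \<in> measurable (vimage_algebra (space M) (\<rho> v) (count_space UNIV)) (count_space UNIV)"
    by (rule measurable_vimage_algebra1) auto
  moreover have "sets (vimage_algebra (space M) (\<rho> v) (count_space UNIV)) \<subseteq> sets (srcs {Offspring v})"
    unfolding sets_srcs by (auto simp: src_def)
  ultimately show ?thesis by (auto simp: measurable_def)
qed

lemma displacement_srcs: "\<xi> v j \<in> borel_measurable (srcs {Displacement v j})"
proof -
  have "\<xi> v j \<in> borel_measurable (vimage_algebra (space M) (\<xi> v j) borel)"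
    by (rule measurable_vimage_algebra1) auto
  moreover have "sets (vimage_algebra (space M) (\<xi> v j) borel) \<subseteq> sets (srcs {Displacement v j})"
    unfolding sets_srcs by (auto simp: src_def)
  ultimately show ?thesis by (auto simp: measurable_def)
qed

text \<open>The sources that determine which labels of generation \<open>k\<close> are alive, and their positions.\<close>

definition hist :: "nat \<Rightarrow> source set" where
  "hist k = insert Immigration ({Offspring v | v. length (snd v) < k} \<union> {Displacement v j | v j. length (snd v) < k})"

lemma alive_hist:
  "length u \<le> k \<Longrightarrow> (\<lambda>\<omega>. alive \<rho> \<omega> (i, u)) \<in> measurable (srcs (hist k)) (count_space UNIV)"
proof (induction u)
  case (Cons j u)
  have [measurable]: "(\<lambda>\<omega>. alive \<rho> \<omega> (i, u)) \<in> measurable (srcs (hist k)) (count_space UNIV)"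
    using Cons by auto
  have [measurable]: "\<rho> (i, u) \<in> measurable (srcs (hist k)) (count_space UNIV)"
    by (rule measurable_srcs_mono[OF offspring_srcs]) (use Cons in \<open>auto simp: hist_def\<close>)
  show ?case by simp measurable
qed simp

lemma position_hist:
  "length u \<le> k \<Longrightarrow> (\<lambda>\<omega>. position S \<xi> \<omega> (i, u)) \<in> borel_measurable (srcs (hist k))"
proof (induction u)
  case Nil
  show ?case by simp (rule measurable_srcs_mono[OF immigrant_srcs], auto simp: hist_def)
next
  case (Cons j u)
  have [measurable]: "(\<lambda>\<omega>. position S \<xi> \<omega> (i, u)) \<in> borel_measurable (srcs (hist k))"
    using Cons by auto
  have [measurable]: "\<xi> (i, u) j \<in> borel_measurable (srcs (hist k))"
    by (rule measurable_srcs_mono[OF displacement_srcs]) (use Cons in \<open>auto simp: hist_def\<close>)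
  show ?case by simp
qed

end

section \<open>Integrating out the generations of the population\<close>


text \<open>The expectation of the product of \<open>w\<close> over the positions of the first \<open>m\<close> children of a particle at \<open>x\<close>.\<close>

definition offspring_mean :: "real measure \<Rightarrow> nat pmf \<Rightarrow> nat \<Rightarrow> (real \<Rightarrow> ennreal) \<Rightarrow> real \<Rightarrow> ennreal" where
  "offspring_mean D p m w x = (\<integral>\<^sup>+n. (\<integral>\<^sup>+y. w (x + y) \<partial>D) ^ min n m \<partial>measure_pmf p)"

text \<open>The cutoff \<open>m\<close> of all indices keeps products over a generation finite.\<close>

definition labels :: "nat \<Rightarrow> nat \<Rightarrow> label set" where
  "labels m k = {..<m} \<times> {u. set u \<subseteq> {..<m} \<and> length u = k}"

lemma finite_labels [simp]: "finite (labels m k)"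
  unfolding labels_def by (intro finite_cartesian_product finite_lists_length_eq) auto

lemma labels_Suc: "bij_betw (\<lambda>(v, j). (fst v, j # snd v)) (labels m k \<times> {..<m}) (labels m (Suc k))"
  unfolding bij_betw_def
proof
  show "(\<lambda>(v, j). (fst v, j # snd v)) ` (labels m k \<times> {..<m}) = labels m (Suc k)"
  proof (intro equalityI subsetI)
    fix v assume "v \<in> labels m (Suc k)"
    then obtain i j u where "v = (i, j # u)" "(i, u) \<in> labels m k" "j < m"
      by (auto simp: labels_def length_Suc_conv)
    then show "v \<in> (\<lambda>(v, j). (fst v, j # snd v)) ` (labels m k \<times> {..<m})"
      by (intro image_eqI[of _ _ "((i, u), j)"]) auto
  qed (auto simp: labels_def)
qed (auto simp: inj_on_def)

lemma measurable_shift_nn_integral: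
  assumes "sigma_finite_measure D" "sets D = sets borel" "w \<in> borel_measurable borel"
  shows "(\<lambda>x::real. \<integral>\<^sup>+y. (w (x + y) :: ennreal) \<partial>D) \<in> borel_measurable borel"
proof -
  interpret sigma_finite_measure D by fact
  have [measurable]: "w \<in> borel_measurable borel" by fact
  have "(\<lambda>z. w (fst z + snd z)) \<in> borel_measurable (borel \<Otimes>\<^sub>M D)"
    by (subst measurable_cong_sets[OF sets_pair_measure_cong[OF refl assms(2)] refl]) measurable
  from borel_measurable_nn_integral_fst[OF this] show ?thesis by simp
qed

lemma measurable_offspring_mean:
  assumes "sigma_finite_measure D" "sets D = sets borel" "w \<in> borel_measurable borel"
  shows "offspring_mean D p m w \<in> borel_measurable borel"
proof -
  have [measurable]: "(\<lambda>x::real. \<integral>\<^sup>+y. w (x + y) \<partial>D) \<in> borel_measurable borel"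
    by (rule measurable_shift_nn_integral[OF assms])
  let ?u = "\<lambda>x::real. \<integral>\<^sup>+y. w (x + y) \<partial>D"
  have "(\<lambda>z. (\<lambda>n z. ?u (fst z) ^ min n m) (snd z) z) \<in> borel_measurable (borel \<Otimes>\<^sub>M count_space UNIV)"
    by (rule measurable_compose_countable) measurable
  then have "(\<lambda>(x, n). ?u x ^ min n m) \<in> borel_measurable (borel \<Otimes>\<^sub>M measure_pmf p)"
    by (subst measurable_cong_sets[OF sets_pair_measure_cong[OF refl sets_measure_pmf_count_space] refl])
      (simp add: case_prod_beta')
  then have "(\<lambda>x. \<integral>\<^sup>+n. ?u x ^ min n m \<partial>measure_pmf p) \<in> borel_measurable borel"
    by (rule measure_pmf.borel_measurable_nn_integral)
  then show ?thesis by (simp add: offspring_mean_def[abs_def])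
qed

context branching_particle_system
begin

definition displacement_law :: "real measure" where
  "displacement_law = density lborel (\<lambda>x. ennreal (\<phi> x))"

lemma distr_displacement: "distr M borel (\<xi> v j) = displacement_law"
proof -
  have "distr M lborel (\<xi> v j) = displacement_law"
    using displacement_density[of v j] by (simp add: distributed_def displacement_law_def)
  then show ?thesis by (simp cong: distr_cong)
qed

lemma sets_displacement_law [simp]: "sets displacement_law = sets borel"
  and space_displacement_law [simp]: "space displacement_law = UNIV"
  by (simp_all add: displacement_law_def)

lemma displacement_measurable: "\<xi> v j \<in> borel_measurable M"
  by (rule measurable_srcs_events[OF displacement_srcs])

lemma prob_space_displacement_law: "prob_space displacement_law"
  unfolding distr_displacement[of undefined undefined, symmetric]
  by (rule prob_space_distr[OF displacement_measurable])

lemma alive_measurable: "(\<lambda>\<omega>. alive \<rho> \<omega> v) \<in> measurable M (count_space UNIV)"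
  using measurable_srcs_events[OF alive_hist[of "snd v" "length (snd v)" "fst v"]] by simp

lemma position_measurable: "(\<lambda>\<omega>. position S \<xi> \<omega> v) \<in> borel_measurable M"
  using measurable_srcs_events[OF position_hist[of "snd v" "length (snd v)" "fst v"]] by simp

text \<open>Given the first \<open>k\<close> generations, the displacements and then the numbers of the children of the
  particles of generation \<open>k\<close> are integrated out.\<close>

lemma integrate_out_generation:
  assumes A: "A \<in> borel_measurable (srcs (hist k))" and w: "w \<in> borel_measurable borel"
  shows "(\<integral>\<^sup>+\<omega>. A \<omega> * (\<Prod>v\<in>labels m (Suc k). if alive \<rho> \<omega> v then w (position S \<xi> \<omega> v) else 1) \<partial>M) =
    (\<integral>\<^sup>+\<omega>. A \<omega> * (\<Prod>v\<in>labels m k. if alive \<rho> \<omega> v then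
       offspring_mean displacement_law p m w (position S \<xi> \<omega> v) else 1) \<partial>M)"
proof -
  interpret D: prob_space displacement_law by (rule prob_space_displacement_law)
  have [measurable]: "w \<in> borel_measurable borel" by (rule w)
  let ?L = "labels m k" and ?a = "\<lambda>\<omega> v. alive \<rho> \<omega> v" and ?x = "\<lambda>\<omega> v. position S \<xi> \<omega> v"
  let ?u = "\<lambda>x. \<integral>\<^sup>+y. w (x + y) \<partial>displacement_law"
  have um[measurable]: "?u \<in> borel_measurable borel"
    by (rule measurable_shift_nn_integral) (auto simp: D.sigma_finite_measure_axioms)
  have am: "(\<lambda>\<omega>. ?a \<omega> v) \<in> measurable (srcs (hist k)) (count_space UNIV)"
    and xm: "(\<lambda>\<omega>. ?x \<omega> v) \<in> borel_measurable (srcs (hist k))" if "v \<in> ?L" for v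
    using that alive_hist[of "snd v" k "fst v"] position_hist[of "snd v" k "fst v"] by (auto simp: labels_def)
  define J1 where "J1 = hist k \<union> Offspring ` ?L"
  have J1: "hist k \<subseteq> J1" by (auto simp: J1_def)
  let ?g = "\<lambda>vj \<omega> r. if ?a \<omega> (fst vj) \<and> snd vj < \<rho> (fst vj) \<omega> then w (?x \<omega> (fst vj) + r) else 1"
  have "(\<integral>\<^sup>+\<omega>. A \<omega> * (\<Prod>v\<in>labels m (Suc k). if ?a \<omega> v then w (?x \<omega> v) else 1) \<partial>M) =
      (\<integral>\<^sup>+\<omega>. A \<omega> * (\<Prod>vj\<in>?L \<times> {..<m}. ?g vj \<omega> (\<xi> (fst vj) (snd vj) \<omega>)) \<partial>M)"
  proof (intro nn_integral_cong arg_cong2[where f="(*)"] refl)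
    fix \<omega>
    show "(\<Prod>v\<in>labels m (Suc k). if ?a \<omega> v then w (?x \<omega> v) else 1) =
        (\<Prod>vj\<in>?L \<times> {..<m}. ?g vj \<omega> (\<xi> (fst vj) (snd vj) \<omega>))"
      unfolding prod.reindex_bij_betw[OF labels_Suc, symmetric]
      by (intro prod.cong) auto
  qed
  also have "\<dots> = (\<integral>\<^sup>+\<omega>. A \<omega> * (\<Prod>vj\<in>?L \<times> {..<m}. \<integral>\<^sup>+r. ?g vj \<omega> r \<partial>distr M borel (\<xi> (fst vj) (snd vj))) \<partial>M)"
  proof (rule integrate_out_prod[where \<sigma> = "\<lambda>vj. Displacement (fst vj) (snd vj)" and J = J1])
    show "A \<in> borel_measurable (srcs J1)" by (rule measurable_srcs_mono[OF A J1])
    fix vj assume vj: "vj \<in> ?L \<times> {..<m}"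
    then have v: "fst vj \<in> ?L" by auto
    have [measurable]: "(\<lambda>\<omega>. ?a \<omega> (fst vj)) \<in> measurable (srcs J1) (count_space UNIV)"
      "(\<lambda>\<omega>. ?x \<omega> (fst vj)) \<in> borel_measurable (srcs J1)"
      "\<rho> (fst vj) \<in> measurable (srcs J1) (count_space UNIV)"
      using measurable_srcs_mono[OF am[OF v] J1] measurable_srcs_mono[OF xm[OF v] J1]
        measurable_srcs_mono[OF offspring_srcs, of "fst vj" J1] v by (auto simp: J1_def)
    show "case_prod (?g vj) \<in> borel_measurable (srcs J1 \<Otimes>\<^sub>M borel)" by measurable
  qed (auto simp: inj_on_def J1_def hist_def labels_def displacement_srcs finite_lists_length_eq)
  also have "\<dots> = (\<integral>\<^sup>+\<omega>. A \<omega> * (\<Prod>v\<in>?L. if ?a \<omega> v then ?u (?x \<omega> v) ^ min (\<rho> v \<omega>) m else 1) \<partial>M)"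
  proof (intro nn_integral_cong arg_cong2[where f="(*)"] refl)
    fix \<omega>
    have "(\<integral>\<^sup>+r. ?g vj \<omega> r \<partial>displacement_law) =
        (if ?a \<omega> (fst vj) \<and> snd vj < \<rho> (fst vj) \<omega> then ?u (?x \<omega> (fst vj)) else 1)" for vj
      using D.emeasure_space_1 by auto
    then have "(\<Prod>vj\<in>?L \<times> {..<m}. \<integral>\<^sup>+r. ?g vj \<omega> r \<partial>displacement_law) =
        (\<Prod>v\<in>?L. \<Prod>j<m. if ?a \<omega> v \<and> j < \<rho> v \<omega> then ?u (?x \<omega> v) else 1)"
      by (simp add: prod.cartesian_product case_prod_beta')
    also have "\<dots> = (\<Prod>v\<in>?L. if ?a \<omega> v then ?u (?x \<omega> v) ^ min (\<rho> v \<omega>) m else 1)"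
    proof (intro prod.cong refl)
      fix v
      have "{..<m} \<inter> {j. j < \<rho> v \<omega>} = {..<min (\<rho> v \<omega>) m}" by auto
      then show "(\<Prod>j<m. if ?a \<omega> v \<and> j < \<rho> v \<omega> then ?u (?x \<omega> v) else 1) =
          (if ?a \<omega> v then ?u (?x \<omega> v) ^ min (\<rho> v \<omega>) m else 1)"
        by (auto simp: prod.If_cases)
    qed
    finally show "(\<Prod>vj\<in>?L \<times> {..<m}. \<integral>\<^sup>+r. ?g vj \<omega> r \<partial>distr M borel (\<xi> (fst vj) (snd vj))) =
        (\<Prod>v\<in>?L. if ?a \<omega> v then ?u (?x \<omega> v) ^ min (\<rho> v \<omega>) m else 1)"
      unfolding distr_displacement .
  qed
  also have "\<dots> = (\<integral>\<^sup>+\<omega>. A \<omega> * (\<Prod>v\<in>?L. \<integral>\<^sup>+n. (if ?a \<omega> v then ?u (?x \<omega> v) ^ min n m else 1)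
      \<partial>distr M (count_space UNIV) (\<rho> v)) \<partial>M)"
  proof (rule integrate_out_prod[where \<sigma> = Offspring and J = "hist k"])
    fix v assume v: "v \<in> ?L"
    note [measurable] = am[OF v] xm[OF v]
    have "(\<lambda>z. (\<lambda>n z. if ?a (fst z) v then ?u (?x (fst z) v) ^ min n m else 1) (snd z) z)
        \<in> borel_measurable (srcs (hist k) \<Otimes>\<^sub>M count_space UNIV)"
      by (rule measurable_compose_countable) measurable
    then show "(\<lambda>(\<omega>, n). if ?a \<omega> v then ?u (?x \<omega> v) ^ min n m else 1) \<in> borel_measurable (srcs (hist k) \<Otimes>\<^sub>M count_space UNIV)"
      by (simp add: case_prod_beta')
  qed (use A in \<open>auto simp: inj_on_def hist_def labels_def offspring_srcs finite_lists_length_eq\<close>)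
  also have "\<dots> = (\<integral>\<^sup>+\<omega>. A \<omega> * (\<Prod>v\<in>?L. if ?a \<omega> v then offspring_mean displacement_law p m w (?x \<omega> v) else 1) \<partial>M)"
    unfolding offspring_law
    by (intro nn_integral_cong arg_cong2[where f="(*)"] refl prod.cong)
      (auto simp: offspring_mean_def measure_pmf.emeasure_space_1)
  finally show ?thesis .
qed

text \<open>Iterating this from the last generation down to the immigrants turns the expectation of a
  multiplicative functional of the tree into one of the immigrants only.\<close>

lemma integrate_out_generations:
  assumes e: "e \<in> borel_measurable borel" and w: "w \<in> borel_measurable borel"
  shows "(\<integral>\<^sup>+\<omega>. (\<Prod>k<l. \<Prod>v\<in>labels m k. if alive \<rho> \<omega> v then e (position S \<xi> \<omega> v) else 1) *
      (\<Prod>v\<in>labels m l. if alive \<rho> \<omega> v then w (position S \<xi> \<omega> v) else 1) \<partial>M) =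
    (\<integral>\<^sup>+\<omega>. (\<Prod>i<m. ((\<lambda>w x. e x * offspring_mean displacement_law p m w x) ^^ l) w (S i \<omega>)) \<partial>M)"
  using w
proof (induction l arbitrary: w)
  case 0
  have "labels m 0 = (\<lambda>i. (i, [])) ` {..<m}" by (auto simp: labels_def)
  then have "(\<Prod>v\<in>labels m 0. if alive \<rho> \<omega> v then w (position S \<xi> \<omega> v) else 1) = (\<Prod>i<m. w (S i \<omega>))" for \<omega>
    by (simp add: prod.reindex inj_on_def)
  then show ?case by simp
next
  case (Suc l)
  let ?Q = "\<lambda>w x. e x * offspring_mean displacement_law p m w x"
  let ?E = "\<lambda>k \<omega>. \<Prod>v\<in>labels m k. if alive \<rho> \<omega> v then e (position S \<xi> \<omega> v) else 1"
  interpret D: prob_space displacement_law by (rule prob_space_displacement_law)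
  have Em: "?E k \<in> borel_measurable (srcs (hist l))" if "k \<le> l" for k
  proof (rule borel_measurable_prod_ennreal)
    fix v assume v: "v \<in> labels m k"
    have [measurable]: "(\<lambda>\<omega>. alive \<rho> \<omega> v) \<in> measurable (srcs (hist l)) (count_space UNIV)"
      "(\<lambda>\<omega>. position S \<xi> \<omega> v) \<in> borel_measurable (srcs (hist l))"
      using alive_hist[of "snd v" l "fst v"] position_hist[of "snd v" l "fst v"] v that by (auto simp: labels_def)
    note [measurable] = e
    show "(\<lambda>\<omega>. if alive \<rho> \<omega> v then e (position S \<xi> \<omega> v) else 1) \<in> borel_measurable (srcs (hist l))"
      by measurable
  qed
  have "(\<integral>\<^sup>+\<omega>. (\<Prod>k<Suc l. ?E k \<omega>) * (\<Prod>v\<in>labels m (Suc l). if alive \<rho> \<omega> v then w (position S \<xi> \<omega> v) else 1) \<partial>M) =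
      (\<integral>\<^sup>+\<omega>. (\<Prod>k<Suc l. ?E k \<omega>) * (\<Prod>v\<in>labels m l. if alive \<rho> \<omega> v then
        offspring_mean displacement_law p m w (position S \<xi> \<omega> v) else 1) \<partial>M)"
    by (intro integrate_out_generation borel_measurable_prod_ennreal Em Suc.prems) auto
  also have "\<dots> = (\<integral>\<^sup>+\<omega>. (\<Prod>k<l. ?E k \<omega>) * (\<Prod>v\<in>labels m l. if alive \<rho> \<omega> v then ?Q w (position S \<xi> \<omega> v) else 1) \<partial>M)"
  proof (intro nn_integral_cong)
    fix \<omega>
    have "?E l \<omega> * (\<Prod>v\<in>labels m l. if alive \<rho> \<omega> v then offspring_mean displacement_law p m w (position S \<xi> \<omega> v) else 1) =
        (\<Prod>v\<in>labels m l. if alive \<rho> \<omega> v then ?Q w (position S \<xi> \<omega> v) else 1)"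
      unfolding prod.distrib[symmetric] by (intro prod.cong) auto
    then show "(\<Prod>k<Suc l. ?E k \<omega>) * (\<Prod>v\<in>labels m l. if alive \<rho> \<omega> v then
        offspring_mean displacement_law p m w (position S \<xi> \<omega> v) else 1) =
      (\<Prod>k<l. ?E k \<omega>) * (\<Prod>v\<in>labels m l. if alive \<rho> \<omega> v then ?Q w (position S \<xi> \<omega> v) else 1)"
      by (simp add: mult.assoc)
  qed
  also have "\<dots> = (\<integral>\<^sup>+\<omega>. (\<Prod>i<m. (?Q ^^ l) (?Q w) (S i \<omega>)) \<partial>M)"
    using Suc.prems e D.sigma_finite_measure_axioms
    by (intro Suc.IH borel_measurable_times_ennreal measurable_offspring_mean) auto
  finally show ?case unfolding funpow_Suc_right comp_apply .
qed

end

section \<open>Products over the immigrants\<close>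


context branching_particle_system
begin

definition immigrant_count :: "real set \<Rightarrow> 'a \<Rightarrow> ennreal" where
  "immigrant_count B \<omega> = emeasure (count_space UNIV) {i. S i \<omega> \<in> B}"

lemma point_process_count:
  assumes "\<omega> \<in> space M" "B \<in> sets borel" "B \<subseteq> {0..}"
  shows "emeasure (distr (count_space UNIV) (restrict_space borel {0..}) (\<lambda>i. S i \<omega>)) B = immigrant_count B \<omega>"
  using assms immigrants_nonneg
  by (subst emeasure_distr) (auto simp: immigrant_count_def sets_restrict_space_iff space_restrict_space vimage_def)

lemma intensity:
  fixes a :: real
  assumes "B \<in> sets borel" "B \<subseteq> {0..a}" "0 \<le> a" "0 \<le> \<mu>"
  shows "B \<in> sets (scale_measure (ennreal \<mu>) (restrict_space lborel {0..}))"
    "emeasure (scale_measure (ennreal \<mu>) (restrict_space lborel {0..})) B = ennreal (\<mu> * measure lborel B)"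
    "measure (scale_measure (ennreal \<mu>) (restrict_space lborel {0..})) B = \<mu> * measure lborel B"
proof -
  have B: "B \<subseteq> {0..}" using assms(2) by auto
  show "B \<in> sets (scale_measure (ennreal \<mu>) (restrict_space lborel {0..}))"
    unfolding sets_scale_measure by (rule sets_restrict_space_iff[THEN iffD2]) (use assms B in auto)
  have "emeasure lborel B \<le> emeasure lborel {0..a}"
    by (intro emeasure_mono) (use assms in auto)
  then have "emeasure lborel B < \<infinity>" by (rule le_less_trans) (use assms(3) in simp)
  then have "emeasure lborel B = ennreal (measure lborel B)"
    by (intro emeasure_eq_ennreal_measure) auto
  then show *: "emeasure (scale_measure (ennreal \<mu>) (restrict_space lborel {0..})) B = ennreal (\<mu> * measure lborel B)"
    using B assms by (simp add: emeasure_restrict_space ennreal_mult)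
  show "measure (scale_measure (ennreal \<mu>) (restrict_space lborel {0..})) B = \<mu> * measure lborel B"
    unfolding measure_def * using assms by simp
qed

lemma immigrant_count_measurable:
  assumes "B \<in> sets borel" shows "immigrant_count B \<in> borel_measurable M"
proof -
  note [measurable] = immigrants_measurable assms
  have "immigrant_count B \<omega> = (\<Sum>i. indicator B (S i \<omega>))" for \<omega>
    unfolding immigrant_count_def
    by (simp add: nn_integral_indicator[symmetric] nn_integral_count_space_nat indicator_def
      del: nn_integral_indicator)
  then have "immigrant_count B = (\<lambda>\<omega>. \<Sum>i. indicator B (S i \<omega>))" by auto
  then show ?thesis by simp
qed

lemma immigrant_product_mono:
  fixes g h :: "real \<Rightarrow> real"
  assumes [measurable]: "g \<in> borel_measurable borel" "h \<in> borel_measurable borel"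
    and gh: "\<And>x. 0 \<le> g x" "\<And>x. g x \<le> h x" "\<And>x. h x \<le> 1"
  shows "expectation (\<lambda>\<omega>. \<Prod>i<n. g (S i \<omega>)) \<le> expectation (\<lambda>\<omega>. \<Prod>i<n. h (S i \<omega>))"
proof (rule integral_mono)
  note [measurable] = immigrants_measurable
  have g1: "g x \<le> 1" "0 \<le> h x" for x using gh order_trans by blast+
  show "integrable M (\<lambda>\<omega>. \<Prod>i<n. g (S i \<omega>))" "integrable M (\<lambda>\<omega>. \<Prod>i<n. h (S i \<omega>))"
    using gh g1 by (auto intro!: integrable_const_bound[of _ 1] AE_I2 prod_le_1 simp: abs_prod)
qed (use gh in \<open>auto intro: prod_mono\<close>)

context
  fixes a :: real assumes a: "0 \<le> a" and mu: "0 \<le> \<mu>"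
begin

lemma immigrant_count_prob:
  assumes B: "B \<in> sets borel" "B \<subseteq> {0..a}"
  shows "prob {\<omega>\<in>space M. immigrant_count B \<omega> = of_nat k} =
    exp (- (\<mu> * measure lborel B)) * (\<mu> * measure lborel B) ^ k / fact k"
proof -
  have "B \<subseteq> {0..}" using B by auto
  have eq: "{\<omega>\<in>space M. immigrant_count B \<omega> = of_nat k} = {\<omega>\<in>space M.
      emeasure (distr (count_space UNIV) (restrict_space borel {0..}) (\<lambda>i. S i \<omega>)) B = of_nat k}"
    using point_process_count[OF _ B(1) \<open>B \<subseteq> {0..}\<close>] by auto
  have "emeasure (scale_measure (ennreal \<mu>) (restrict_space lborel {0..})) B < \<infinity>"
    unfolding intensity(2)[OF B a mu] by simp
  then have "prob {\<omega>\<in>space M. emeasure (distr (count_space UNIV) (restrict_space borel {0..}) (\<lambda>i. S i \<omega>)) B = of_nat k} =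
      exp (- measure (scale_measure (ennreal \<mu>) (restrict_space lborel {0..})) B) *
      measure (scale_measure (ennreal \<mu>) (restrict_space lborel {0..})) B ^ k / fact k"
    using immigrants_poisson intensity(1)[OF B a mu] unfolding poisson_random_measure_def by blast
  then show ?thesis unfolding eq intensity(3)[OF B a mu] .
qed

text \<open>The probabilities of finite counts add up to \<open>1\<close>, by the exponential series.\<close>

lemma immigrants_locally_finite: "AE \<omega> in M. finite {i. S i \<omega> \<in> {0..a}}"
proof -
  let ?X = "immigrant_count {0..a}" and ?l = "\<mu> * measure lborel {0..a}"
  have Xm[measurable]: "?X \<in> borel_measurable M" by (rule immigrant_count_measurable) simp
  let ?E = "\<lambda>k. {\<omega>\<in>space M. ?X \<omega> = of_nat k}"
  have Em: "?E k \<in> events" for k by measurable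
  have "(\<lambda>k. prob (?E k)) sums prob (\<Union>k. ?E k)"
    using Em by (intro finite_measure_UNION) (auto simp: disjoint_family_on_def)
  moreover have "(\<lambda>k. prob (?E k)) sums 1"
  proof -
    have "(\<lambda>k. exp (- ?l) * (?l ^ k /\<^sub>R fact k)) sums (exp (- ?l) * exp ?l)"
      by (intro sums_mult exp_converges)
    then show ?thesis by (simp add: immigrant_count_prob exp_minus field_simps)
  qed
  ultimately have "prob (\<Union>k. ?E k) = 1" using sums_unique2 by blast
  moreover have "(\<Union>k. ?E k) \<in> events" using Em by auto
  ultimately have "AE \<omega> in M. \<omega> \<in> (\<Union>k. ?E k)" by (simp add: prob_eq_1)
  then show ?thesis
  proof eventually_elim
    case (elim \<omega>)
    then obtain k where "?X \<omega> = of_nat k" by auto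
    then have "?X \<omega> \<noteq> \<infinity>" by (metis ennreal_of_nat_eq_real_of_nat ennreal_neq_top infinity_ennreal_def)
    then show ?case by (auto simp: immigrant_count_def intro: ccontr)
  qed
qed

text \<open>The power \<open>c ^ z\<close> of a count \<open>z\<close>, extended by \<open>0\<close> to all values that are not natural numbers.\<close>

definition pgf_weight :: "real \<Rightarrow> ennreal \<Rightarrow> ennreal" where
  "pgf_weight c z = (\<Sum>k. ennreal (c ^ k) * indicator {of_nat k} z)"

lemma pgf_weight_measurable [measurable]: "pgf_weight c \<in> borel_measurable borel"
  unfolding pgf_weight_def[abs_def] by measurable

lemma pgf_weight_of_nat: "pgf_weight c (of_nat n) = ennreal (c ^ n)"
proof -
  have "pgf_weight c (of_nat n) = (\<Sum>k\<in>{n}. ennreal (c ^ k) * indicator {of_nat k} (of_nat n :: ennreal))"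
    unfolding pgf_weight_def by (rule suminf_finite) (auto simp: indicator_def)
  then show ?thesis by simp
qed

lemma immigrant_count_pgf:
  assumes B: "B \<in> sets borel" "B \<subseteq> {0..a}" and c: "0 \<le> c"
  shows "(\<integral>\<^sup>+\<omega>. pgf_weight c (immigrant_count B \<omega>) \<partial>M) = ennreal (exp (- (\<mu> * measure lborel B * (1 - c))))"
proof -
  let ?l = "\<mu> * measure lborel B"
  have l: "0 \<le> ?l" using mu by simp
  note [measurable] = immigrant_count_measurable[OF B(1)]
  have "(\<integral>\<^sup>+\<omega>. pgf_weight c (immigrant_count B \<omega>) \<partial>M) =
      (\<Sum>k. \<integral>\<^sup>+\<omega>. ennreal (c ^ k) * indicator {of_nat k} (immigrant_count B \<omega>) \<partial>M)"
    unfolding pgf_weight_def by (intro nn_integral_suminf) measurable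
  also have "\<dots> = (\<Sum>k. ennreal (exp (- ?l) * ((c * ?l) ^ k /\<^sub>R fact k)))"
  proof (intro suminf_cong)
    fix k
    have "(\<integral>\<^sup>+\<omega>. ennreal (c ^ k) * indicator {of_nat k} (immigrant_count B \<omega>) \<partial>M) =
        (\<integral>\<^sup>+\<omega>. ennreal (c ^ k) * indicator {\<omega>\<in>space M. immigrant_count B \<omega> = of_nat k} \<omega> \<partial>M)"
      by (intro nn_integral_cong) (auto simp: indicator_def)
    also have "\<dots> = ennreal (c ^ k) * emeasure M {\<omega>\<in>space M. immigrant_count B \<omega> = of_nat k}"
      by (intro nn_integral_cmult_indicator) measurable
    also have "\<dots> = ennreal (c ^ k * prob {\<omega>\<in>space M. immigrant_count B \<omega> = of_nat k})"
      using c by (simp add: emeasure_eq_measure ennreal_mult)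
    also have "c ^ k * prob {\<omega>\<in>space M. immigrant_count B \<omega> = of_nat k} = exp (- ?l) * ((c * ?l) ^ k /\<^sub>R fact k)"
      unfolding immigrant_count_prob[OF B] by (simp add: field_simps power_mult_distrib)
    finally show "(\<integral>\<^sup>+\<omega>. ennreal (c ^ k) * indicator {of_nat k} (immigrant_count B \<omega>) \<partial>M) =
        ennreal (exp (- ?l) * ((c * ?l) ^ k /\<^sub>R fact k))" .
  qed
  also have "\<dots> = ennreal (exp (- ?l) * exp (c * ?l))"
    using c l by (intro suminf_ennreal_eq sums_mult exp_converges) auto
  also have "exp (- ?l) * exp (c * ?l) = exp (- (?l * (1 - c)))"
    by (simp add: exp_add[symmetric] algebra_simps)
  finally show ?thesis .
qed

text \<open>If \<open>w\<close> takes finitely many values, the product splits into powers of these values.  The exponents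
  count immigrants in disjoint level sets and are thus independent Poisson variables.\<close>

lemma poisson_product_grid:
  assumes w: "w \<in> borel_measurable borel" and k: "0 < k" and grid: "\<And>x. \<exists>j\<le>k. w x = real j / real k"
    and one: "\<And>x. a < x \<Longrightarrow> w x = 1"
  shows "(\<lambda>n. expectation (\<lambda>\<omega>. \<Prod>i<n. w (S i \<omega>))) \<longlonglongrightarrow> exp (- (\<mu> * (LINT x:{0..a}|lborel. 1 - w x)))"
proof -
  note [measurable] = w immigrants_measurable
  define B where "B j = {x \<in> {0..a}. w x = real j / real k}" for j :: nat
  have Bm[measurable]: "B j \<in> sets borel" and Ba: "B j \<subseteq> {0..a}" for j
    unfolding B_def by auto
  have Bdisj: "i = j" if "x \<in> B i" "x \<in> B j" for x i j using that k by (auto simp: B_def)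
  have w01: "0 \<le> w x" "w x \<le> 1" for x using grid[of x] k by auto
  have decomp: "(\<Prod>i<n. w (S i \<omega>)) = (\<Prod>j\<le>k. (real j / real k) ^ card {i. i < n \<and> S i \<omega> \<in> B j})"
    if \<omega>: "\<omega> \<in> space M" for n \<omega>
  proof -
    have "w (S i \<omega>) = (\<Prod>j\<le>k. if S i \<omega> \<in> B j then real j / real k else 1)" for i
    proof (cases "S i \<omega> \<le> a")
      case True
      obtain j where j: "j \<le> k" "w (S i \<omega>) = real j / real k" using grid by blast
      then have "S i \<omega> \<in> B j" using True immigrants_nonneg[OF \<omega>] by (auto simp: B_def)
      then have "S i \<omega> \<in> B l \<longleftrightarrow> l = j" for l using Bdisj by auto
      then show ?thesis using j by (simp add: prod.delta)
    next
      case False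
      then have "S i \<omega> \<notin> B j" for j by (auto simp: B_def)
      then show ?thesis using one False by simp
    qed
    then have "(\<Prod>i<n. w (S i \<omega>)) = (\<Prod>i<n. \<Prod>j\<le>k. if S i \<omega> \<in> B j then real j / real k else 1)" by simp
    also have "\<dots> = (\<Prod>j\<le>k. \<Prod>i<n. if S i \<omega> \<in> B j then real j / real k else 1)" by (rule prod.swap)
    also have "\<dots> = (\<Prod>j\<le>k. (real j / real k) ^ card {i. i < n \<and> S i \<omega> \<in> B j})"
      by (intro prod.cong refl) (simp add: prod.If_cases Int_def)
    finally show ?thesis .
  qed
  define Z where "Z \<omega> = (\<Prod>j\<le>k. pgf_weight (real j / real k) (immigrant_count (B j) \<omega>))" for \<omega>
  have Zm[measurable]: "Z \<in> borel_measurable M"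
    unfolding Z_def[abs_def] using immigrant_count_measurable[OF Bm]
    by (intro borel_measurable_prod_ennreal measurable_compose[OF _ pgf_weight_measurable]) auto
  have good: "(\<lambda>n. \<Prod>i<n. w (S i \<omega>)) \<longlonglongrightarrow> enn2real (Z \<omega>) \<and> Z \<omega> \<le> 1"
    if \<omega>: "\<omega> \<in> space M" and fin: "finite {i. S i \<omega> \<in> {0..a}}" for \<omega>
  proof -
    have finB: "finite {i. S i \<omega> \<in> B j}" for j
      by (rule finite_subset[OF _ fin]) (use Ba[of j] in blast)
    have Zeq: "Z \<omega> = ennreal (\<Prod>j\<le>k. (real j / real k) ^ card {i. S i \<omega> \<in> B j})"
      unfolding Z_def immigrant_count_def using finB
      by (simp add: pgf_weight_of_nat prod_ennreal)
    obtain n0 where n0: "\<And>i. i \<in> {i. S i \<omega> \<in> {0..a}} \<Longrightarrow> i < n0"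
      using fin by (metis finite_nat_set_iff_bounded)
    have "(\<Prod>i<n. w (S i \<omega>)) = (\<Prod>j\<le>k. (real j / real k) ^ card {i. S i \<omega> \<in> B j})" if "n0 \<le> n" for n
    proof -
      have "{i. i < n \<and> S i \<omega> \<in> B j} = {i. S i \<omega> \<in> B j}" for j
        using n0 that Ba[of j] by force
      then show ?thesis using decomp[OF \<omega>] by simp
    qed
    then have "\<forall>\<^sub>F n in sequentially. (\<Prod>i<n. w (S i \<omega>)) = enn2real (Z \<omega>)"
      unfolding Zeq by (intro eventually_sequentiallyI[of n0]) (simp add: prod_nonneg)
    moreover have "(\<Prod>j\<le>k. (real j / real k) ^ card {i. S i \<omega> \<in> B j}) \<le> 1"
      using k by (intro prod_le_1) (auto intro!: power_le_one)
    ultimately show ?thesis by (auto simp: Zeq intro: tendsto_eventually)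
  qed
  have "(\<lambda>n. expectation (\<lambda>\<omega>. \<Prod>i<n. w (S i \<omega>))) \<longlonglongrightarrow> expectation (\<lambda>\<omega>. enn2real (Z \<omega>))"
  proof (rule integral_dominated_convergence[where w = "\<lambda>_. 1"])
    show "AE \<omega> in M. (\<lambda>n. \<Prod>i<n. w (S i \<omega>)) \<longlonglongrightarrow> enn2real (Z \<omega>)"
      using immigrants_locally_finite AE_space by eventually_elim (use good in auto)
    show "AE \<omega> in M. norm (\<Prod>i<n. w (S i \<omega>)) \<le> 1" for n
      using w01 by (auto simp: abs_prod intro!: prod_le_1 AE_I2)
  qed auto
  moreover have "expectation (\<lambda>\<omega>. enn2real (Z \<omega>)) = exp (- (\<mu> * (LINT x:{0..a}|lborel. 1 - w x)))"
  proof -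
    have "(\<integral>\<^sup>+\<omega>. Z \<omega> \<partial>M) = (\<Prod>j\<le>k. \<integral>\<^sup>+\<omega>. pgf_weight (real j / real k) (immigrant_count (B j) \<omega>) \<partial>M)"
      unfolding Z_def
    proof (rule indep_vars_nn_integral)
      let ?N = "\<lambda>\<omega>. distr (count_space UNIV) (restrict_space borel {0..}) (\<lambda>i. S i \<omega>)"
      have "range B \<subseteq> sets (scale_measure (ennreal \<mu>) (restrict_space lborel {0..}))"
        using intensity(1)[OF Bm Ba a mu] by auto
      moreover have "disjoint_family B" using Bdisj by (auto simp: disjoint_family_on_def)
      ultimately have "indep_vars (\<lambda>_. borel) (\<lambda>j \<omega>. emeasure (?N \<omega>) (B j)) UNIV"
        using immigrants_poisson unfolding poisson_random_measure_def by blast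
      then have "indep_vars (\<lambda>_. borel) (\<lambda>j. immigrant_count (B j)) UNIV"
        unfolding indep_vars_def2
      proof (elim conjE, intro conjI ballI)
        fix j show "random_variable borel (immigrant_count (B j))" by (rule immigrant_count_measurable[OF Bm])
        have "emeasure (?N \<omega>) (B j) = immigrant_count (B j) \<omega>" if "\<omega> \<in> space M" for \<omega> j
          using Ba[of j] by (intro point_process_count[OF that Bm]) auto
        then have "(\<lambda>\<omega>. emeasure (?N \<omega>) (B j)) -` A \<inter> space M = immigrant_count (B j) -` A \<inter> space M" for A j
          by auto
        moreover assume "indep_sets (\<lambda>j. {(\<lambda>\<omega>. emeasure (?N \<omega>) (B j)) -` A \<inter> space M |A. A \<in> sets borel}) UNIV"
        ultimately show "indep_sets (\<lambda>j. {immigrant_count (B j) -` A \<inter> space M |A. A \<in> sets borel}) UNIV"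
          by simp
      qed
      then have "indep_vars (\<lambda>_. borel) (\<lambda>j. immigrant_count (B j)) {..k}"
        by (rule indep_vars_subset) auto
      then show "indep_vars (\<lambda>_. borel) (\<lambda>j \<omega>. pgf_weight (real j / real k) (immigrant_count (B j) \<omega>)) {..k}"
        by (rule indep_vars_compose2) measurable
    qed auto
    also have "\<dots> = (\<Prod>j\<le>k. ennreal (exp (- (\<mu> * measure lborel (B j) * (1 - real j / real k)))))"
      using Ba by (intro prod.cong refl immigrant_count_pgf) auto
    also have "\<dots> = ennreal (exp (- (\<mu> * (\<Sum>j\<le>k. (1 - real j / real k) * measure lborel (B j)))))"
      by (simp add: prod_ennreal exp_sum[symmetric] sum_negf[symmetric] sum_distrib_left mult_ac)
    also have "(\<Sum>j\<le>k. (1 - real j / real k) * measure lborel (B j)) = (LINT x:{0..a}|lborel. 1 - w x)"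
    proof -
      have fB: "emeasure lborel (B j) < \<infinity>" for j
        using a by (intro le_less_trans[OF emeasure_mono[OF Ba[of j], of lborel]]) auto
      have "(LINT x:{0..a}|lborel. 1 - w x) = (LINT x|lborel. (\<Sum>j\<le>k. (1 - real j / real k) * indicator (B j) x))"
        unfolding set_lebesgue_integral_def
      proof (intro Bochner_Integration.integral_cong refl)
        fix x
        show "indicator {0..a} x *\<^sub>R (1 - w x) = (\<Sum>j\<le>k. (1 - real j / real k) * indicator (B j) x)"
        proof (cases "x \<in> {0..a}")
          case True
          obtain j where j: "j \<le> k" "w x = real j / real k" using grid by blast
          then have "x \<in> B j" using True by (auto simp: B_def)
          then have "(indicator (B l) x :: real) = (if l = j then 1 else 0)" for l using Bdisj by (auto simp: indicator_def)
          then have "(\<Sum>l\<le>k. (1 - real l / real k) * indicator (B l) x) =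
              (\<Sum>l\<le>k. if l = j then 1 - real j / real k else 0)"
            by (intro sum.cong) auto
          then show ?thesis using j True by simp
        next
          case False
          then have "x \<notin> B j" for j by (auto simp: B_def)
          then show ?thesis using False by simp
        qed
      qed
      also have "\<dots> = (\<Sum>j\<le>k. (1 - real j / real k) * measure lborel (B j))"
        using fB by (subst Bochner_Integration.integral_sum) auto
      finally show ?thesis by simp
    qed
    finally have "(\<integral>\<^sup>+\<omega>. Z \<omega> \<partial>M) = ennreal (exp (- (\<mu> * (LINT x:{0..a}|lborel. 1 - w x))))" .
    moreover have "(\<integral>\<^sup>+\<omega>. Z \<omega> \<partial>M) = (\<integral>\<^sup>+\<omega>. ennreal (enn2real (Z \<omega>)) \<partial>M)"
    proof (rule nn_integral_cong_AE)
      show "AE \<omega> in M. Z \<omega> = ennreal (enn2real (Z \<omega>))"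
        using immigrants_locally_finite AE_space
      proof eventually_elim
        case (elim \<omega>)
        then have "Z \<omega> \<le> 1" using good by auto
        then have "Z \<omega> < top" using le_less_trans[of "Z \<omega>" 1 top] by simp
        then show ?case by simp
      qed
    qed
    ultimately show ?thesis by (subst integral_eq_nn_integral) auto
  qed
  ultimately show ?thesis by simp
qed

text \<open>A general \<open>w\<close> is squeezed between functions with values in multiples of \<open>1 / k\<close>; the corresponding
  limits differ by at most \<open>\<mu> * a / k\<close>.\<close>

lemma poisson_product:
  assumes w: "w \<in> borel_measurable borel" and w01: "\<And>x. 0 \<le> w x" "\<And>x. w x \<le> 1"
    and one: "\<And>x. a < x \<Longrightarrow> w x = 1"
  shows "(\<lambda>n. expectation (\<lambda>\<omega>. \<Prod>i<n. w (S i \<omega>))) \<longlonglongrightarrow> exp (- (\<mu> * (LINT x:{0..a}|lborel. 1 - w x)))"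
proof (rule tendstoI)
  fix e :: real assume e: "0 < e"
  note [measurable] = w immigrants_measurable
  let ?I = "\<lambda>w :: real \<Rightarrow> real. LINT x:{0..a}|lborel. 1 - w x" and ?E = "\<lambda>(w :: real \<Rightarrow> real) n. expectation (\<lambda>\<omega>. \<Prod>i<n. w (S i \<omega>))"
  obtain k :: nat where k: "2 * \<mu> * a / e < k" using reals_Archimedean2 by blast
  have "0 \<le> 2 * \<mu> * a / e" using mu a e by simp
  then have k0: "0 < k" using k by linarith
  have ke: "\<mu> * (a / k) < e / 2" using k k0 e by (simp add: field_simps)
  define lo where "lo x = of_int \<lfloor>k * w x\<rfloor> / real k" for x
  define hi where "hi x = of_int \<lceil>k * w x\<rceil> / real k" for x
  have kw: "0 \<le> k * w x" "k * w x \<le> k" for x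
    using w01[of x] by (auto intro: mult_left_le)
  have grid_lo: "\<exists>j\<le>k. lo x = real j / real k" for x
    using kw[of x] by (intro exI[of _ "nat \<lfloor>k * w x\<rfloor>"]) (auto simp: lo_def nat_le_iff floor_le_iff)
  have grid_hi: "\<exists>j\<le>k. hi x = real j / real k" for x
    using kw[of x] by (intro exI[of _ "nat \<lceil>k * w x\<rceil>"]) (auto simp: hi_def nat_le_iff ceiling_le_iff)
  have [measurable]: "lo \<in> borel_measurable borel" "hi \<in> borel_measurable borel"
    unfolding lo_def hi_def by measurable
  have lo_w: "lo x \<le> w x" and w_hi: "w x \<le> hi x" and hi_lo: "hi x - lo x \<le> 1 / k" for x
  proof -
    have "of_int \<lfloor>k * w x\<rfloor> \<le> k * w x" "k * w x \<le> of_int \<lceil>k * w x\<rceil>"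
      "of_int (\<lceil>k * w x\<rceil> - \<lfloor>k * w x\<rfloor>) \<le> (of_int 1 :: real)"
      using ceiling_diff_floor_le_1[of "k * w x"] unfolding of_int_le_iff by linarith+
    then show "lo x \<le> w x" "w x \<le> hi x" "hi x - lo x \<le> 1 / k"
      using k0 unfolding lo_def hi_def diff_divide_distrib[symmetric]
      by (simp_all add: divide_le_eq le_divide_eq mult.commute divide_right_mono)
  qed
  have lo01: "0 \<le> lo x" "lo x \<le> 1" and hi01: "0 \<le> hi x" "hi x \<le> 1" for x
    using grid_lo[of x] grid_hi[of x] k0 by auto
  have lim_lo: "?E lo \<longlonglongrightarrow> exp (- (\<mu> * ?I lo))"
    by (rule poisson_product_grid[OF _ k0 grid_lo]) (use one k0 in \<open>auto simp: lo_def\<close>)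
  have lim_hi: "?E hi \<longlonglongrightarrow> exp (- (\<mu> * ?I hi))"
    by (rule poisson_product_grid[OF _ k0 grid_hi]) (use one k0 in \<open>auto simp: hi_def\<close>)
  have intble: "set_integrable lborel {0..a} (\<lambda>x. 1 - g x)"
    if [measurable]: "g \<in> borel_measurable borel" and "\<And>x. 0 \<le> g x" "\<And>x. g x \<le> 1" for g :: "real \<Rightarrow> real"
    unfolding set_integrable_def
    by (rule integrableI_bounded_set_indicator[where B = 1]) (use that a in auto)
  have I_mono: "?I g \<le> ?I h" if "g \<in> borel_measurable borel" "h \<in> borel_measurable borel"
    "\<And>x. 0 \<le> h x" "\<And>x. h x \<le> g x" "\<And>x. g x \<le> 1" for g h :: "real \<Rightarrow> real"
    using that by (intro set_integral_mono intble) (auto intro: order_trans)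
  have I1: "?I w \<le> ?I lo" "?I hi \<le> ?I w"
    using lo_w w_hi lo01 hi01 w01 by (intro I_mono; simp)+
  have "?I lo - ?I hi = (LINT x:{0..a}|lborel. (1 - lo x) - (1 - hi x))"
    using lo01 hi01 by (intro set_integral_diff(2)[symmetric] intble) auto
  also have "\<dots> \<le> (LINT x:{0..a}|lborel. 1 / k)"
  proof (rule set_integral_mono)
    show "set_integrable lborel {0..a} (\<lambda>x. (1 - lo x) - (1 - hi x))"
      by (rule set_integral_diff(1)[OF intble intble]) (use lo01 hi01 in auto)
    show "set_integrable lborel {0..a} (\<lambda>x. 1 / real k)"
      unfolding set_integrable_def using a
      by (intro integrable_scaleR_left integrable_real_indicator) auto
    show "(1 - lo x) - (1 - hi x) \<le> 1 / real k" for x using hi_lo[of x] by simp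
  qed
  also have "\<dots> = a / k" using a by (simp add: set_integral_const)
  finally have I2: "?I lo - ?I hi \<le> a / k" .
  have I0: "0 \<le> ?I hi" unfolding set_lebesgue_integral_def
    using hi01 by (intro integral_nonneg_AE) (auto intro!: AE_I2 simp: indicator_def)
  have exp_diff: "exp (- x) - exp (- y) \<le> y - x" if "0 \<le> x" "x \<le> y" for x y :: real
  proof -
    have "exp (- x) - exp (- y) = exp (- x) * (1 - exp (- (y - x)))"
      by (simp add: algebra_simps exp_add[symmetric] exp_diff exp_minus field_simps)
    moreover have "1 - exp (- (y - x)) \<le> y - x" using exp_ge_add_one_self[of "- (y - x)"] by linarith
    then have "exp (- x) * (1 - exp (- (y - x))) \<le> 1 * (y - x)"
      using that by (intro mult_mono) auto
    ultimately show ?thesis by simp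
  qed
  have "\<mu> * ?I lo - \<mu> * ?I hi \<le> \<mu> * (a / k)"
    using I2 mu unfolding right_diff_distrib[symmetric] by (intro mult_left_mono)
  then have diff: "exp (- (\<mu> * ?I hi)) - exp (- (\<mu> * ?I lo)) < e / 2"
    using exp_diff[of "\<mu> * ?I hi" "\<mu> * ?I lo"] I0 I1 mu ke by (smt (verit) mult_left_mono mult_nonneg_nonneg)
  have between: "exp (- (\<mu> * ?I lo)) \<le> exp (- (\<mu> * ?I w))" "exp (- (\<mu> * ?I w)) \<le> exp (- (\<mu> * ?I hi))"
    using I1 mu by (auto intro: mult_left_mono)
  have "\<forall>\<^sub>F n in sequentially. dist (?E lo n) (exp (- (\<mu> * ?I lo))) < e / 2"
    "\<forall>\<^sub>F n in sequentially. dist (?E hi n) (exp (- (\<mu> * ?I hi))) < e / 2"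
    using e by (intro tendstoD[OF lim_lo] tendstoD[OF lim_hi]; simp)+
  then show "\<forall>\<^sub>F n in sequentially. dist (?E w n) (exp (- (\<mu> * ?I w))) < e"
  proof eventually_elim
    case (elim n)
    have "?E lo n \<le> ?E w n" "?E w n \<le> ?E hi n"
      using lo01 hi01 w01 lo_w w_hi by (intro immigrant_product_mono; simp)+
    then show ?case using elim diff between unfolding dist_real_def abs_less_iff by linarith
  qed
qed

end

end

section \<open>The Laplace functional of a cluster\<close>


definition truncated_pgf :: "nat pmf \<Rightarrow> nat \<Rightarrow> real \<Rightarrow> real" where
  "truncated_pgf p m s = measure_pmf.expectation p (\<lambda>n. s ^ min n m)"

text \<open>The expectation of the product of \<open>exp (- f)\<close> over the descendants of a particle at \<open>x\<close> (itself
  included), cut off after \<open>n\<close> generations and \<open>m\<close> children per particle.\<close>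

primrec cluster :: "real measure \<Rightarrow> nat pmf \<Rightarrow> (real \<Rightarrow> real) \<Rightarrow> nat \<Rightarrow> nat \<Rightarrow> real \<Rightarrow> real" where
  "cluster D p f m 0 = (\<lambda>x. exp (- f x))"
| "cluster D p f m (Suc n) = (\<lambda>x. exp (- f x) * truncated_pgf p m (\<integral>y. cluster D p f m n (x + y) \<partial>D))"

lemma truncated_pgf_integrable:
  "0 \<le> s \<Longrightarrow> s \<le> 1 \<Longrightarrow> integrable (measure_pmf p) (\<lambda>n. s ^ min n m :: real)"
  by (rule measure_pmf.integrable_const_bound[of _ 1]) (auto simp: power_le_one)

lemma truncated_pgf_bounds:
  assumes "0 \<le> s" "s \<le> 1" shows "0 \<le> truncated_pgf p m s" "truncated_pgf p m s \<le> 1"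
proof -
  show "0 \<le> truncated_pgf p m s" unfolding truncated_pgf_def using assms by (intro integral_nonneg_AE) auto
  have "truncated_pgf p m s \<le> measure_pmf.expectation p (\<lambda>_. 1)" unfolding truncated_pgf_def
    using assms by (intro integral_mono truncated_pgf_integrable) (auto simp: power_le_one)
  then show "truncated_pgf p m s \<le> 1" by simp
qed

lemma truncated_pgf_mono:
  assumes "0 \<le> s" "s \<le> s'" "s' \<le> 1" "m' \<le> m" shows "truncated_pgf p m s \<le> truncated_pgf p m' s'"
  unfolding truncated_pgf_def
proof (intro integral_mono truncated_pgf_integrable)
  fix n
  have "s ^ min n m \<le> s ^ min n m'" using assms by (intro power_decreasing) auto
  also have "\<dots> \<le> s' ^ min n m'" using assms by (intro power_mono) auto
  finally show "s ^ min n m \<le> s' ^ min n m'" .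
qed (use assms in auto)

lemma truncated_pgf_one [simp]: "truncated_pgf p m 1 = 1"
  by (simp add: truncated_pgf_def)

lemma truncated_pgf_tendsto:
  assumes s: "\<And>n. 0 \<le> s n" "\<And>n. s n \<le> 1" and lim: "s \<longlonglongrightarrow> t"
  shows "(\<lambda>n. truncated_pgf p n (s n)) \<longlonglongrightarrow> generating_function p t"
  unfolding truncated_pgf_def generating_function_def
proof (rule integral_dominated_convergence[where w = "\<lambda>_. 1"])
  show "AE k in measure_pmf p. (\<lambda>n. s n ^ min k n) \<longlonglongrightarrow> t ^ k"
  proof (rule AE_I2)
    fix k
    have "\<forall>\<^sub>F n in sequentially. s n ^ k = s n ^ min k n"
      by (rule eventually_sequentiallyI[of k]) (simp add: min_absorb1)
    from Lim_transform_eventually[OF tendsto_power[OF lim] this]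
    show "(\<lambda>n. s n ^ min k n) \<longlonglongrightarrow> t ^ k" .
  qed
qed (use s in \<open>auto simp: power_le_one\<close>)

locale nonneg_displacement = prob_space D for D :: "real measure" +
  assumes sets_D [simp, measurable_cong]: "sets D = sets borel" and nonneg_D: "AE y in D. 0 \<le> y"
begin

lemma space_D [simp]: "space D = UNIV"
  using sets_eq_imp_space_eq[OF sets_D] by simp

lemma prob_UNIV [simp]: "prob UNIV = 1"
  using prob_space by simp

lemma shift_measurable [measurable]:
  fixes w :: "real \<Rightarrow> real"
  assumes w [measurable]: "w \<in> borel_measurable borel"
  shows "(\<lambda>x. \<integral>y. w (x + y) \<partial>D) \<in> borel_measurable borel"
  by (rule borel_measurable_lebesgue_integral) measurable

lemma shift_integrable:
  fixes w :: "real \<Rightarrow> real"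
  assumes w [measurable]: "w \<in> borel_measurable borel" and "\<And>x. 0 \<le> w x" "\<And>x. w x \<le> B"
  shows "integrable D (\<lambda>y. w (x + y))"
  by (rule integrable_const_bound[of _ B]) (use assms(2,3) in auto)

lemma shift_bounds:
  fixes w :: "real \<Rightarrow> real"
  assumes w: "w \<in> borel_measurable borel" "\<And>x. 0 \<le> w x" "\<And>x. w x \<le> B"
  shows "0 \<le> (\<integral>y. w (x + y) \<partial>D)" "(\<integral>y. w (x + y) \<partial>D) \<le> B"
proof -
  show "0 \<le> (\<integral>y. w (x + y) \<partial>D)" using w by (intro integral_nonneg_AE) auto
  have "(\<integral>y. w (x + y) \<partial>D) \<le> (\<integral>y. B \<partial>D)"
    by (intro integral_mono shift_integrable[OF w]) (use w in auto)
  then show "(\<integral>y. w (x + y) \<partial>D) \<le> B" by (simp add: prob_space)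
qed

lemma shift_mono:
  fixes w w' :: "real \<Rightarrow> real"
  assumes "w \<in> borel_measurable borel" "\<And>x. 0 \<le> w x" "\<And>x. w x \<le> B"
    "w' \<in> borel_measurable borel" "\<And>x. 0 \<le> w' x" "\<And>x. w' x \<le> B"
    "\<And>y. 0 \<le> y \<Longrightarrow> w (x + y) \<le> w' (x' + y)"
  shows "(\<integral>y. w (x + y) \<partial>D) \<le> (\<integral>y. w' (x' + y) \<partial>D)"
proof (rule integral_mono_AE)
  show "AE y in D. w (x + y) \<le> w' (x' + y)"
    using nonneg_D by eventually_elim (use assms(7) in auto)
qed (use shift_integrable[OF assms(1-3)] shift_integrable[OF assms(4-6)] in auto)

context
  fixes p :: "nat pmf" and f :: "real \<Rightarrow> real"
  assumes f [measurable]: "f \<in> borel_measurable borel" and f0: "\<And>x. 0 \<le> f x"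
begin

lemma cluster_bounds:
  "cluster D p f m n \<in> borel_measurable borel \<and> (\<forall>x. 0 \<le> cluster D p f m n x \<and> cluster D p f m n x \<le> 1)"
proof (induction n)
  case 0
  show ?case using f0 by auto
next
  case (Suc n)
  let ?s = "\<lambda>x. \<integral>y. cluster D p f m n (x + y) \<partial>D"
  have [measurable]: "cluster D p f m n \<in> borel_measurable borel" using Suc by simp
  have s: "0 \<le> ?s x" "?s x \<le> 1" for x using shift_bounds[of "cluster D p f m n" 1] Suc by auto
  have "(\<lambda>z. (\<lambda>n z. ?s (fst z) ^ min n m) (snd z) z) \<in> borel_measurable (borel \<Otimes>\<^sub>M count_space UNIV)"
    by (rule measurable_compose_countable) measurable
  then have "(\<lambda>(x, n). ?s x ^ min n m) \<in> borel_measurable (borel \<Otimes>\<^sub>M measure_pmf p)"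
    by (subst measurable_cong_sets[OF sets_pair_measure_cong[OF refl sets_measure_pmf_count_space] refl])
      (simp add: case_prod_beta')
  then have [measurable]: "(\<lambda>x. truncated_pgf p m (?s x)) \<in> borel_measurable borel"
    unfolding truncated_pgf_def by (rule measure_pmf.borel_measurable_lebesgue_integral)
  have "exp (- f x) * truncated_pgf p m (?s x) \<le> 1 * 1" for x
    using truncated_pgf_bounds[OF s] f0 by (intro mult_mono) auto
  then show ?case using truncated_pgf_bounds[OF s] by simp
qed

lemma cluster_measurable [measurable]: "cluster D p f m n \<in> borel_measurable borel"
  and cluster_nonneg: "0 \<le> cluster D p f m n x" and cluster_le_1: "cluster D p f m n x \<le> 1"
  using cluster_bounds by auto

lemma cluster_shift_bounds:
  "0 \<le> (\<integral>y. cluster D p f m n (x + y) \<partial>D)" "(\<integral>y. cluster D p f m n (x + y) \<partial>D) \<le> 1"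
  by (rule shift_bounds[OF cluster_measurable cluster_nonneg cluster_le_1])+

lemma cluster_step_mono:
  assumes "m' \<le> m" "f x' \<le> f x" "\<And>y. 0 \<le> y \<Longrightarrow> cluster D p f m n (x + y) \<le> cluster D p f m' n' (x' + y)"
  shows "cluster D p f m (Suc n) x \<le> cluster D p f m' (Suc n') x'"
proof -
  have "(\<integral>y. cluster D p f m n (x + y) \<partial>D) \<le> (\<integral>y. cluster D p f m' n' (x' + y) \<partial>D)"
    by (rule shift_mono) (use assms(3) cluster_nonneg cluster_le_1 in auto)
  then show ?thesis
    unfolding cluster.simps using assms(1,2) cluster_shift_bounds
    by (intro mult_mono truncated_pgf_mono truncated_pgf_bounds) auto
qed

lemma cluster_antimono_width: "m' \<le> m \<Longrightarrow> cluster D p f m n x \<le> cluster D p f m' n x"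
proof (induction n arbitrary: x)
  case (Suc n)
  then show ?case by (intro cluster_step_mono) auto
qed simp

lemma cluster_antimono_depth: "cluster D p f m (Suc n) x \<le> cluster D p f m n x"
proof (induction n arbitrary: x)
  case 0
  show ?case using truncated_pgf_bounds(2)[OF cluster_shift_bounds[of m 0 x]]
    by (simp add: mult_left_le)
next
  case (Suc n)
  then show ?case by (intro cluster_step_mono) auto
qed

lemma cluster_mono_position:
  assumes "antimono_on {0..} f" "0 \<le> x" "x \<le> x'"
  shows "cluster D p f m n x \<le> cluster D p f m n x'"
  using assms(2,3)
proof (induction n arbitrary: x x')
  case 0
  then show ?case using assms(1) by (auto simp: monotone_on_def)
next
  case (Suc n)
  then show ?case using assms(1) by (intro cluster_step_mono) (auto simp: monotone_on_def)
qed

lemma cluster_beyond: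
  assumes "\<And>x. a < x \<Longrightarrow> f x = 0" shows "a < x \<Longrightarrow> cluster D p f m n x = 1"
proof (induction n arbitrary: x)
  case 0
  then show ?case using assms by simp
next
  case (Suc n)
  have "(\<integral>y. cluster D p f m n (x + y) \<partial>D) = (\<integral>y. 1 \<partial>D)"
  proof (rule integral_cong_AE)
    show "AE y in D. cluster D p f m n (x + y) = 1"
      using nonneg_D by eventually_elim (use Suc in auto)
  qed auto
  then show ?case using Suc.prems assms by (simp add: prob_space)
qed

text \<open>The recursion for real numbers computes the iterates that arise when the generations are integrated out.\<close>

lemma cluster_ennreal:
  "ennreal (cluster D p f m n x) =
    ((\<lambda>w x. ennreal (exp (- f x)) * offspring_mean D p m w x) ^^ n) (\<lambda>x. ennreal (exp (- f x))) x"
proof (induction n arbitrary: x)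
  case (Suc n)
  let ?c = "cluster D p f m n"
  have "(\<integral>\<^sup>+y. ennreal (?c (x + y)) \<partial>D) = ennreal (\<integral>y. ?c (x + y) \<partial>D)"
    using cluster_nonneg by (intro nn_integral_eq_integral shift_integrable[of _ 1] cluster_le_1) auto
  then have "offspring_mean D p m (\<lambda>x. ennreal (?c x)) x =
      (\<integral>\<^sup>+n. ennreal ((\<integral>y. ?c (x + y) \<partial>D) ^ min n m) \<partial>measure_pmf p)"
    using cluster_shift_bounds by (simp add: offspring_mean_def ennreal_power)
  also have "\<dots> = ennreal (truncated_pgf p m (\<integral>y. ?c (x + y) \<partial>D))"
    unfolding truncated_pgf_def using cluster_shift_bounds
    by (intro nn_integral_eq_integral truncated_pgf_integrable) auto
  finally have "ennreal (cluster D p f m (Suc n) x) = ennreal (exp (- f x)) * offspring_mean D p m (\<lambda>x. ennreal (?c x)) x"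
    using truncated_pgf_bounds[OF cluster_shift_bounds] by (simp add: ennreal_mult)
  also have "(\<lambda>x. ennreal (?c x)) = ((\<lambda>w x. ennreal (exp (- f x)) * offspring_mean D p m w x) ^^ n) (\<lambda>x. ennreal (exp (- f x)))"
    using Suc by auto
  finally show ?case by simp
qed simp

lemma cluster_decseq: "decseq (\<lambda>n. cluster D p f n n x)"
proof (rule decseq_SucI)
  fix n
  have "cluster D p f (Suc n) (Suc n) x \<le> cluster D p f n (Suc n) x" by (rule cluster_antimono_width) simp
  also have "\<dots> \<le> cluster D p f n n x" by (rule cluster_antimono_depth)
  finally show "cluster D p f (Suc n) (Suc n) x \<le> cluster D p f n n x" .
qed

text \<open>The Laplace functional of the whole cluster of a particle, as a function of its position.\<close>

definition cluster_limit :: "real \<Rightarrow> real" where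
  "cluster_limit x = lim (\<lambda>n. cluster D p f n n x)"

lemma cluster_tendsto: "(\<lambda>n. cluster D p f n n x) \<longlonglongrightarrow> cluster_limit x"
proof -
  obtain L where "(\<lambda>n. cluster D p f n n x) \<longlonglongrightarrow> L"
    using decseq_convergent[OF cluster_decseq[of x], of 0] cluster_nonneg by metis
  then show ?thesis unfolding cluster_limit_def by (simp add: limI)
qed

lemma cluster_limit_measurable [measurable]: "cluster_limit \<in> borel_measurable borel"
  by (rule borel_measurable_LIMSEQ_real[OF cluster_tendsto]) auto

lemma cluster_limit_le: "cluster_limit x \<le> cluster D p f n n x"
  by (rule decseq_ge[OF cluster_decseq cluster_tendsto])

lemma cluster_limit_bounds: "0 \<le> cluster_limit x" "cluster_limit x \<le> 1"
  by (rule LIMSEQ_le_const[OF cluster_tendsto]) (use cluster_nonneg in auto,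
    rule order_trans[OF cluster_limit_le cluster_le_1])

lemma cluster_limit_mono:
  assumes "antimono_on {0..} f" "0 \<le> x" "x \<le> x'" shows "cluster_limit x \<le> cluster_limit x'"
  by (rule LIMSEQ_le[OF cluster_tendsto cluster_tendsto]) (use cluster_mono_position[OF assms] in auto)

lemma cluster_limit_beyond:
  assumes "\<And>x. a < x \<Longrightarrow> f x = 0" "a < x" shows "cluster_limit x = 1"
  using cluster_tendsto[of x] cluster_beyond[OF assms] by (simp add: LIMSEQ_const_iff)

text \<open>Depth and width are cut off at the same \<open>n\<close>.  Raising only the depth by one produces a sequence
  between two neighbours of the diagonal sequence, to which the recursion applies.\<close>

lemma cluster_limit_fixed_point:
  "cluster_limit x = exp (- f x) * generating_function p (\<integral>y. cluster_limit (x + y) \<partial>D)"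
proof (rule LIMSEQ_unique)
  show "(\<lambda>n. cluster D p f n (Suc n) x) \<longlonglongrightarrow> cluster_limit x"
  proof (rule tendsto_sandwich)
    show "(\<lambda>n. cluster D p f (Suc n) (Suc n) x) \<longlonglongrightarrow> cluster_limit x"
      by (rule LIMSEQ_Suc[OF cluster_tendsto])
    show "\<forall>\<^sub>F n in sequentially. cluster D p f (Suc n) (Suc n) x \<le> cluster D p f n (Suc n) x"
      by (intro always_eventually allI cluster_antimono_width) simp
    show "\<forall>\<^sub>F n in sequentially. cluster D p f n (Suc n) x \<le> cluster D p f n n x"
      by (intro always_eventually allI cluster_antimono_depth)
  qed (rule cluster_tendsto)
  have "(\<lambda>n. \<integral>y. cluster D p f n n (x + y) \<partial>D) \<longlonglongrightarrow> (\<integral>y. cluster_limit (x + y) \<partial>D)"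
    by (rule integral_dominated_convergence[where w = "\<lambda>_. 1"])
      (use cluster_tendsto cluster_nonneg cluster_le_1 in auto)
  then show "(\<lambda>n. cluster D p f n (Suc n) x) \<longlonglongrightarrow> exp (- f x) * generating_function p (\<integral>y. cluster_limit (x + y) \<partial>D)"
    unfolding cluster.simps by (intro tendsto_intros truncated_pgf_tendsto cluster_shift_bounds)
qed

end

end

section \<open>The Laplace functional of the population\<close>


locale positive_branching_system = branching_particle_system +
  assumes mu_nonneg: "0 \<le> \<mu>" and density_zero: "\<And>t. t < 0 \<Longrightarrow> \<phi> t = 0"
begin

lemma density_measurable: "(\<lambda>x. ennreal (\<phi> x)) \<in> borel_measurable lborel"
  using displacement_density[of undefined undefined] by (simp add: distributed_def)

sublocale D: nonneg_displacement displacement_law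
proof (intro nonneg_displacement.intro nonneg_displacement_axioms.intro prob_space_displacement_law)
  have "AE y in lborel. 0 < ennreal (\<phi> y) \<longrightarrow> 0 \<le> y"
    by (rule AE_I2) (metis density_zero ennreal_0 less_irrefl not_le)
  then show "AE y in displacement_law. 0 \<le> y"
    unfolding displacement_law_def by (subst AE_density[OF density_measurable])
qed simp

definition truncated_total :: "(real \<Rightarrow> real) \<Rightarrow> nat \<Rightarrow> 'a \<Rightarrow> real" where
  "truncated_total f n \<omega> = (\<Sum>k\<le>n. \<Sum>v\<in>labels n k. if alive \<rho> \<omega> v then f (position S \<xi> \<omega> v) else 0)"

lemma truncated_total_measurable:
  assumes [measurable]: "f \<in> borel_measurable borel"
  shows "truncated_total f n \<in> borel_measurable M"
proof -
  note [measurable] = alive_measurable position_measurable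
  show ?thesis unfolding truncated_total_def[abs_def] by measurable
qed

context
  fixes f :: "real \<Rightarrow> real" and a :: real
  assumes f [measurable]: "f \<in> borel_measurable borel" and f0: "\<And>x. 0 \<le> f x"
    and beyond: "\<And>x. a < x \<Longrightarrow> f x = 0" and a: "0 \<le> a"
begin

lemma truncated_total_nonneg: "0 \<le> truncated_total f n \<omega>"
  unfolding truncated_total_def using f0 by (intro sum_nonneg) auto

lemma truncated_total_laplace:
  "expectation (\<lambda>\<omega>. exp (- truncated_total f n \<omega>)) =
    expectation (\<lambda>\<omega>. \<Prod>i<n. cluster displacement_law p f n n (S i \<omega>))"
proof -
  note [measurable] = truncated_total_measurable[OF f] immigrants_measurable D.cluster_measurable[OF f f0]
  let ?e = "\<lambda>x. ennreal (exp (- f x))"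
  have "ennreal (exp (- truncated_total f n \<omega>)) =
      (\<Prod>k<n. \<Prod>v\<in>labels n k. if alive \<rho> \<omega> v then ?e (position S \<xi> \<omega> v) else 1) *
      (\<Prod>v\<in>labels n n. if alive \<rho> \<omega> v then ?e (position S \<xi> \<omega> v) else 1)" for \<omega>
  proof -
    have "exp (- truncated_total f n \<omega>) =
        (\<Prod>k\<le>n. \<Prod>v\<in>labels n k. exp (- (if alive \<rho> \<omega> v then f (position S \<xi> \<omega> v) else 0)))"
      by (simp add: truncated_total_def exp_sum[symmetric] sum_negf[symmetric])
    then have "ennreal (exp (- truncated_total f n \<omega>)) =
        (\<Prod>k\<le>n. \<Prod>v\<in>labels n k. ennreal (exp (- (if alive \<rho> \<omega> v then f (position S \<xi> \<omega> v) else 0))))"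
      by (simp add: prod_ennreal prod_nonneg)
    also have "\<dots> = (\<Prod>k\<le>n. \<Prod>v\<in>labels n k. if alive \<rho> \<omega> v then ?e (position S \<xi> \<omega> v) else 1)"
      by (intro prod.cong) auto
    finally show ?thesis by (simp add: lessThan_Suc_atMost[symmetric])
  qed
  note eq = this
  have e: "?e \<in> borel_measurable borel" by simp
  have "(\<integral>\<^sup>+\<omega>. ennreal (exp (- truncated_total f n \<omega>)) \<partial>M) =
      (\<integral>\<^sup>+\<omega>. (\<Prod>i<n. ((\<lambda>w x. ?e x * offspring_mean displacement_law p n w x) ^^ n) ?e (S i \<omega>)) \<partial>M)"
    unfolding eq by (rule integrate_out_generations[OF e e])
  also have "\<dots> = (\<integral>\<^sup>+\<omega>. ennreal (\<Prod>i<n. cluster displacement_law p f n n (S i \<omega>)) \<partial>M)"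
    unfolding D.cluster_ennreal[OF f f0, symmetric] using D.cluster_nonneg[OF f f0] by (simp add: prod_ennreal)
  finally show ?thesis
    using D.cluster_nonneg[OF f f0] by (simp add: integral_eq_nn_integral prod_nonneg)
qed

text \<open>In the product over the first \<open>n\<close> immigrants the factor depends on \<open>n\<close> as well.  It is bounded below
  by the limit \<open>cluster_limit\<close>, and above by \<open>cluster\<close> with the cutoff frozen at some \<open>k\<close>; for these
  fixed factors the Poisson formula gives the limit.\<close>

lemma laplace_functional:
  "(\<lambda>n. expectation (\<lambda>\<omega>. exp (- truncated_total f n \<omega>))) \<longlonglongrightarrow>
    exp (- (\<mu> * (LINT x:{0..a}|lborel. 1 - D.cluster_limit p f x)))"
proof -
  let ?w = "D.cluster_limit p f" and ?c = "\<lambda>n. cluster displacement_law p f n n"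
  let ?E = "\<lambda>(g :: real \<Rightarrow> real) n. expectation (\<lambda>\<omega>. \<Prod>i<n. g (S i \<omega>))"
  let ?I = "\<lambda>g :: real \<Rightarrow> real. exp (- (\<mu> * (LINT x:{0..a}|lborel. 1 - g x)))"
  note bounds = D.cluster_nonneg[OF f f0] D.cluster_le_1[OF f f0] D.cluster_limit_bounds[OF f f0]
  note [measurable] = D.cluster_measurable[OF f f0] D.cluster_limit_measurable[OF f f0] immigrants_measurable
  have lim_w: "?E ?w \<longlonglongrightarrow> ?I ?w"
    by (rule poisson_product[OF a mu_nonneg]) (use bounds D.cluster_limit_beyond[OF f f0 beyond] in auto)
  have lim_c: "?E (?c k) \<longlonglongrightarrow> ?I (?c k)" for k
    by (rule poisson_product[OF a mu_nonneg]) (use bounds D.cluster_beyond[OF f f0 beyond] in auto)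
  have "(\<lambda>k. LINT x:{0..a}|lborel. 1 - ?c k x) \<longlonglongrightarrow> (LINT x:{0..a}|lborel. 1 - ?w x)"
    unfolding set_lebesgue_integral_def
  proof (rule integral_dominated_convergence[where w = "indicator {0..a}"])
    show "integrable lborel (indicator {0..a} :: real \<Rightarrow> real)" using a by (intro integrable_real_indicator) auto
    show "AE x in lborel. (\<lambda>k. indicator {0..a} x *\<^sub>R (1 - ?c k x)) \<longlonglongrightarrow> indicator {0..a} x *\<^sub>R (1 - ?w x)"
      by (intro AE_I2 tendsto_intros D.cluster_tendsto[OF f f0])
    show "AE x in lborel. norm (indicator {0..a} x *\<^sub>R (1 - ?c k x)) \<le> indicator {0..a} x" for k
      using bounds by (auto intro!: AE_I2 simp: indicator_def abs_le_iff)
  qed auto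
  then have lim_I: "(\<lambda>k. ?I (?c k)) \<longlonglongrightarrow> ?I ?w" by (intro tendsto_intros)
  have "(\<lambda>n. ?E (?c n) n) \<longlonglongrightarrow> ?I ?w"
  proof (rule order_tendstoI)
    fix b assume "b < ?I ?w"
    then have "\<forall>\<^sub>F n in sequentially. b < ?E ?w n" by (rule order_tendstoD[OF lim_w])
    then show "\<forall>\<^sub>F n in sequentially. b < ?E (?c n) n"
    proof eventually_elim
      case (elim n)
      have "?E ?w n \<le> ?E (?c n) n"
        using bounds D.cluster_limit_le[OF f f0] by (intro immigrant_product_mono) auto
      then show ?case using elim by linarith
    qed
  next
    fix b assume "?I ?w < b"
    then have "\<forall>\<^sub>F k in sequentially. ?I (?c k) < b" by (rule order_tendstoD[OF lim_I])
    then obtain k where k: "?I (?c k) < b" by (auto simp: eventually_sequentially)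
    then have "\<forall>\<^sub>F n in sequentially. ?E (?c k) n < b" by (rule order_tendstoD[OF lim_c])
    then show "\<forall>\<^sub>F n in sequentially. ?E (?c n) n < b"
      using eventually_ge_at_top[of k]
    proof eventually_elim
      case (elim n)
      have "?E (?c n) n \<le> ?E (?c k) n"
        using bounds decseqD[OF D.cluster_decseq[OF f f0] elim(2)] by (intro immigrant_product_mono) auto
      then show ?case using elim by linarith
    qed
  qed
  then show ?thesis by (simp only: truncated_total_laplace)
qed

end

definition particles :: "real set \<Rightarrow> 'a \<Rightarrow> label set" where
  "particles B \<omega> = {v. alive \<rho> \<omega> v \<and> position S \<xi> \<omega> v \<in> B}"

lemma particle_count_eq: "particle_count S \<rho> \<xi> \<omega> B = emeasure (count_space UNIV) (particles B \<omega>)"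
  by (simp add: particle_count_def particles_def)

lemma particle_count_measurable [measurable]:
  assumes [measurable]: "B \<in> sets borel" shows "(\<lambda>\<omega>. particle_count S \<rho> \<xi> \<omega> B) \<in> borel_measurable M"
proof -
  note [measurable] = alive_measurable position_measurable
  let ?g = "\<lambda>\<omega> v. if alive \<rho> \<omega> v then indicator B (position S \<xi> \<omega> v) else 0 :: ennreal"
  interpret L: sigma_finite_measure "count_space UNIV :: label measure"
    by (rule sigma_finite_measure_count_space)
  have "particle_count S \<rho> \<xi> \<omega> B = (\<integral>\<^sup>+v. indicator {v. alive \<rho> \<omega> v \<and> position S \<xi> \<omega> v \<in> B} v \<partial>count_space UNIV)" for \<omega>
    by (simp add: particle_count_def)
  also have "\<dots> \<omega> = (\<integral>\<^sup>+v. ?g \<omega> v \<partial>count_space UNIV)" for \<omega>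
    by (intro nn_integral_cong) (simp add: indicator_def)
  finally have eq: "particle_count S \<rho> \<xi> \<omega> B = (\<integral>\<^sup>+v. ?g \<omega> v \<partial>count_space UNIV)" for \<omega> .
  have "(\<lambda>z. (\<lambda>v z. ?g (fst z) v) (snd z) z) \<in> borel_measurable (M \<Otimes>\<^sub>M count_space UNIV)"
    by (rule measurable_compose_countable) measurable
  then have "(\<lambda>(\<omega>, v). ?g \<omega> v) \<in> borel_measurable (M \<Otimes>\<^sub>M count_space UNIV)"
    by (simp add: case_prod_beta')
  from L.borel_measurable_nn_integral[OF this] show ?thesis by (simp add: eq)
qed

definition truncated_labels :: "nat \<Rightarrow> label set" where
  "truncated_labels n = (\<Union>k\<le>n. labels n k)"

lemma finite_truncated_labels [simp]: "finite (truncated_labels n)"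
  by (simp add: truncated_labels_def)

lemma truncated_labels_eventually: "finite V \<Longrightarrow> \<exists>n0. \<forall>n\<ge>n0. V \<subseteq> truncated_labels n"
proof (induction V rule: finite_induct)
  case (insert v V)
  obtain i u where v: "v = (i, u)" by (cases v)
  obtain n0 where n0: "\<forall>n\<ge>n0. V \<subseteq> truncated_labels n" using insert by auto
  obtain b where b: "\<And>j. j \<in> set u \<Longrightarrow> j < b" using finite_nat_set_iff_bounded[of "set u"] by auto
  have "v \<in> truncated_labels n" if "Suc i + length u + b \<le> n" for n
    unfolding truncated_labels_def labels_def v
    using that b by (auto intro!: bexI[of _ "length u"] dest!: b intro: less_le_trans)
  then have "\<forall>n\<ge>n0 + (Suc i + length u + b). insert v V \<subseteq> truncated_labels n" using n0 by auto
  then show ?case ..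
qed auto

lemma truncated_total_eq:
  "truncated_total f n \<omega> = (\<Sum>v\<in>truncated_labels n \<inter> {v. alive \<rho> \<omega> v}. f (position S \<xi> \<omega> v))"
proof -
  have "truncated_total f n \<omega> = (\<Sum>v\<in>truncated_labels n. if alive \<rho> \<omega> v then f (position S \<xi> \<omega> v) else 0)"
    unfolding truncated_total_def truncated_labels_def
    by (rule sum.UNION_disjoint[symmetric]) (auto simp: labels_def finite_lists_length_eq)
  then show ?thesis by (simp add: sum.If_cases)
qed

text \<open>If the Laplace functional of \<open>\<theta>\<close> times the number of particles in \<open>[0, a]\<close> tends to \<open>1\<close> as
  \<open>\<theta>\<close> decreases to \<open>0\<close>, then that number is almost surely finite:
  the truncated totals tend to infinity on the event that it is infinite, so that this event contributes
  nothing to the limiting Laplace functional.\<close>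

lemma particles_finite:
  assumes a: "0 \<le> a" and small: "\<And>e. 0 < e \<Longrightarrow> \<exists>\<theta>>0.
    \<mu> * (LINT x:{0..a}|lborel. 1 - D.cluster_limit p (\<lambda>x. \<theta> * indicator {0..a} x) x) \<le> e"
  shows "AE \<omega> in M. finite (particles {0..a} \<omega>)"
proof -
  let ?F = "{\<omega>\<in>space M. particle_count S \<rho> \<xi> \<omega> {0..a} < \<infinity>}"
  have F: "?F \<in> events" by measurable
  have fin: "finite (particles {0..a} \<omega>)" if "\<omega> \<in> ?F" for \<omega>
    using that by (auto simp: particle_count_eq emeasure_count_space split: if_splits)
  have "1 - e \<le> prob ?F" if e: "0 < e" for e
  proof -
    obtain \<theta> where \<theta>: "0 < \<theta>" and le: "\<mu> * (LINT x:{0..a}|lborel. 1 - D.cluster_limit p (\<lambda>x. \<theta> * indicator {0..a} x) x) \<le> e"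
      using small[OF e] by auto
    define f where "f x = \<theta> * indicator {0..a} x" for x :: real
    have fm[measurable]: "f \<in> borel_measurable borel" unfolding f_def by measurable
    have f0: "0 \<le> f x" for x using \<theta> by (simp add: f_def)
    have beyond: "f x = 0" if "a < x" for x using that by (simp add: f_def)
    note [measurable] = truncated_total_measurable[OF fm]
    have total: "truncated_total f n \<omega> = \<theta> * card (truncated_labels n \<inter> particles {0..a} \<omega>)" for n \<omega>
    proof -
      have "truncated_total f n \<omega> = (\<Sum>v\<in>truncated_labels n \<inter> particles {0..a} \<omega>. \<theta>)"
        unfolding truncated_total_eq
        by (rule sum.mono_neutral_cong_right) (auto simp: particles_def f_def)
      then show ?thesis by (simp add: mult.commute)
    qed
    have inf: "(\<lambda>n. exp (- truncated_total f n \<omega>) * indicator (- ?F) \<omega>) \<longlonglongrightarrow> 0" if \<omega>: "\<omega> \<in> space M" for \<omega>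
    proof (cases "\<omega> \<in> ?F")
      case False
      then have "infinite (particles {0..a} \<omega>)"
        using \<omega> by (auto simp: particle_count_eq emeasure_count_space of_nat_less_top split: if_splits)
      have "filterlim (\<lambda>n. card (truncated_labels n \<inter> particles {0..a} \<omega>)) at_top sequentially"
        unfolding filterlim_at_top
      proof
        fix b :: nat
        obtain V where V: "V \<subseteq> particles {0..a} \<omega>" "finite V" "card V = b"
          using infinite_arbitrarily_large[OF \<open>infinite _\<close>, of b] by auto
        obtain n0 where "\<forall>n\<ge>n0. V \<subseteq> truncated_labels n" using truncated_labels_eventually[OF V(2)] by auto
        then show "\<forall>\<^sub>F n in sequentially. b \<le> card (truncated_labels n \<inter> particles {0..a} \<omega>)"
          unfolding V(3)[symmetric] by (intro eventually_sequentiallyI[of n0] card_mono) (use V in auto)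
      qed
      then have "filterlim (\<lambda>n. truncated_total f n \<omega>) at_top sequentially"
        unfolding total using \<theta>
        by (intro filterlim_tendsto_pos_mult_at_top[OF tendsto_const] filterlim_compose[OF filterlim_real_sequentially]) auto
      then have "(\<lambda>n. exp (- truncated_total f n \<omega>)) \<longlonglongrightarrow> 0"
        by (intro filterlim_compose[OF exp_at_bot] filterlim_compose[OF filterlim_uminus_at_bot_at_top])
      then show ?thesis by (auto intro: tendsto_mult_left_zero)
    qed simp
    have lim0: "(\<lambda>n. expectation (\<lambda>\<omega>. exp (- truncated_total f n \<omega>) * indicator (space M - ?F) \<omega>)) \<longlonglongrightarrow> expectation (\<lambda>\<omega>. 0)"
    proof (rule integral_dominated_convergence[where w = "\<lambda>_. 1"])
      show "AE \<omega> in M. (\<lambda>n. exp (- truncated_total f n \<omega>) * indicator (space M - ?F) \<omega>) \<longlonglongrightarrow> 0"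
        using inf by (intro AE_I2) (auto simp: indicator_def)
      show "AE \<omega> in M. norm (exp (- truncated_total f n \<omega>) * indicator (space M - ?F) \<omega>) \<le> 1" for n
        using truncated_total_nonneg[OF fm f0 beyond a] by (intro AE_I2) (auto simp: indicator_def)
      show "(\<lambda>\<omega>. exp (- truncated_total f n \<omega>) * indicator (space M - ?F) \<omega>) \<in> borel_measurable M" for n
        using F by measurable
    qed auto
    have "expectation (\<lambda>\<omega>. exp (- truncated_total f n \<omega>)) \<le>
        prob ?F + expectation (\<lambda>\<omega>. exp (- truncated_total f n \<omega>) * indicator (space M - ?F) \<omega>)" for n
    proof -
      have i: "integrable M (\<lambda>\<omega>. exp (- truncated_total f n \<omega>) * indicator (space M - ?F) \<omega>)"
        "integrable M (\<lambda>\<omega>. exp (- truncated_total f n \<omega>))"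
        using F truncated_total_nonneg[OF fm f0 beyond a]
        by (auto intro!: integrable_const_bound[of _ 1] AE_I2 simp: indicator_def)
      have iF: "integrable M (indicator ?F :: 'a \<Rightarrow> real)"
        by (intro integrable_real_indicator F) (simp add: less_top[symmetric])
      have "expectation (\<lambda>\<omega>. exp (- truncated_total f n \<omega>)) \<le>
          expectation (\<lambda>\<omega>. indicator ?F \<omega> + exp (- truncated_total f n \<omega>) * indicator (space M - ?F) \<omega>)"
        by (rule integral_mono[OF i(2) Bochner_Integration.integrable_add[OF iF i(1)]])
          (use truncated_total_nonneg[OF fm f0 beyond a] in \<open>auto simp: indicator_def\<close>)
      also have "\<dots> = prob ?F + expectation (\<lambda>\<omega>. exp (- truncated_total f n \<omega>) * indicator (space M - ?F) \<omega>)"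
        using Bochner_Integration.integral_add[OF iF i(1)] F by simp
      finally show ?thesis .
    qed
    moreover have "(\<lambda>n. prob ?F + expectation (\<lambda>\<omega>. exp (- truncated_total f n \<omega>) * indicator (space M - ?F) \<omega>)) \<longlonglongrightarrow> prob ?F + 0"
      using lim0 by (intro tendsto_intros) simp
    ultimately have "exp (- (\<mu> * (LINT x:{0..a}|lborel. 1 - D.cluster_limit p f x))) \<le> prob ?F + 0"
      by (intro LIMSEQ_le[OF laplace_functional[OF fm f0 beyond a]]) auto
    moreover have "1 - e \<le> exp (- (\<mu> * (LINT x:{0..a}|lborel. 1 - D.cluster_limit p f x)))"
    proof -
      have "1 - e \<le> 1 + - (\<mu> * (LINT x:{0..a}|lborel. 1 - D.cluster_limit p f x))"
        using le unfolding f_def by linarith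
      also have "\<dots> \<le> exp (- (\<mu> * (LINT x:{0..a}|lborel. 1 - D.cluster_limit p f x)))"
        by (rule exp_ge_add_one_self)
      finally show ?thesis .
    qed
    ultimately show ?thesis by linarith
  qed
  then have "1 \<le> prob ?F" by (meson diff_le_eq field_le_epsilon)
  then have "prob ?F = 1" by (intro antisym prob_le_1)
  then have "AE \<omega> in M. \<omega> \<in> ?F" using F by (simp add: prob_eq_1)
  then show ?thesis by eventually_elim (use fin in auto)
qed

text \<open>When the population in \<open>[0, a]\<close> is finite, the truncated totals are eventually constant.\<close>

lemma laplace_particle_counts:
  fixes J :: "'j set" and \<tau> :: "'j \<Rightarrow> real"
  assumes J: "finite J" and \<theta>: "\<And>t. 0 \<le> \<theta> t" and a: "0 \<le> a" "\<And>t. t \<in> J \<Longrightarrow> \<tau> t \<le> a"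
    and fin: "AE \<omega> in M. finite (particles {0..a} \<omega>)"
  shows "expectation (\<lambda>\<omega>. exp (- (\<Sum>t\<in>J. \<theta> t * enn2real (particle_count S \<rho> \<xi> \<omega> {0..\<tau> t})))) =
    exp (- (\<mu> * (LINT x:{0..a}|lborel. 1 - D.cluster_limit p (\<lambda>x. \<Sum>t\<in>J. \<theta> t * indicator {0..\<tau> t} x) x)))"
proof -
  define f where "f x = (\<Sum>t\<in>J. \<theta> t * indicator {0..\<tau> t} x)" for x :: real
  have fm[measurable]: "f \<in> borel_measurable borel" unfolding f_def by measurable
  have f0: "0 \<le> f x" for x using \<theta> by (auto simp: f_def intro!: sum_nonneg)
  have outside: "f x = 0" if "x \<notin> {0..a}" for x
    unfolding f_def by (intro sum.neutral) (use that a(2) in \<open>fastforce simp: indicator_def\<close>)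
  then have beyond: "f x = 0" if "a < x" for x using that by simp
  note [measurable] = truncated_total_measurable[OF fm]
  have "(\<lambda>n. expectation (\<lambda>\<omega>. exp (- truncated_total f n \<omega>))) \<longlonglongrightarrow>
      expectation (\<lambda>\<omega>. exp (- (\<Sum>t\<in>J. \<theta> t * enn2real (particle_count S \<rho> \<xi> \<omega> {0..\<tau> t}))))"
  proof (rule integral_dominated_convergence[where w = "\<lambda>_. 1"])
    show "AE \<omega> in M. (\<lambda>n. exp (- truncated_total f n \<omega>)) \<longlonglongrightarrow>
        exp (- (\<Sum>t\<in>J. \<theta> t * enn2real (particle_count S \<rho> \<xi> \<omega> {0..\<tau> t})))"
      using fin
    proof eventually_elim
      case (elim \<omega>)
      let ?P = "particles {0..a} \<omega>"
      have sub: "particles {0..\<tau> t} \<omega> \<subseteq> ?P" if "t \<in> J" for t using a(2)[OF that] by (auto simp: particles_def)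
      have count: "enn2real (particle_count S \<rho> \<xi> \<omega> {0..\<tau> t}) = card (particles {0..\<tau> t} \<omega>)" if "t \<in> J" for t
        using finite_subset[OF sub[OF that] elim] by (simp add: particle_count_eq)
      obtain n0 where n0: "\<forall>n\<ge>n0. ?P \<subseteq> truncated_labels n" using truncated_labels_eventually[OF elim] by auto
      have "truncated_total f n \<omega> = (\<Sum>t\<in>J. \<theta> t * enn2real (particle_count S \<rho> \<xi> \<omega> {0..\<tau> t}))" if "n0 \<le> n" for n
      proof -
        have "truncated_total f n \<omega> = (\<Sum>v\<in>?P. f (position S \<xi> \<omega> v))"
          unfolding truncated_total_eq
        proof (rule sum.mono_neutral_right)
          show "?P \<subseteq> truncated_labels n \<inter> {v. alive \<rho> \<omega> v}" using n0 that by (auto simp: particles_def)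
          show "\<forall>v\<in>truncated_labels n \<inter> {v. alive \<rho> \<omega> v} - ?P. f (position S \<xi> \<omega> v) = 0"
            using outside by (auto simp: particles_def)
        qed simp
        also have "\<dots> = (\<Sum>t\<in>J. \<Sum>v\<in>?P. \<theta> t * indicator {0..\<tau> t} (position S \<xi> \<omega> v))"
          unfolding f_def by (rule sum.swap)
        also have "\<dots> = (\<Sum>t\<in>J. \<theta> t * enn2real (particle_count S \<rho> \<xi> \<omega> {0..\<tau> t}))"
        proof (intro sum.cong refl)
          fix t assume t: "t \<in> J"
          have "(\<Sum>v\<in>?P. \<theta> t * indicator {0..\<tau> t} (position S \<xi> \<omega> v)) = (\<Sum>v\<in>particles {0..\<tau> t} \<omega>. \<theta> t)"
            by (rule sum.mono_neutral_cong_right[OF elim sub[OF t]]) (auto simp: particles_def indicator_def)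
          then show "(\<Sum>v\<in>?P. \<theta> t * indicator {0..\<tau> t} (position S \<xi> \<omega> v)) =
              \<theta> t * enn2real (particle_count S \<rho> \<xi> \<omega> {0..\<tau> t})"
            by (simp add: count[OF t] mult.commute)
        qed
        finally show ?thesis .
      qed
      then have "\<forall>\<^sub>F n in sequentially. exp (- truncated_total f n \<omega>) =
          exp (- (\<Sum>t\<in>J. \<theta> t * enn2real (particle_count S \<rho> \<xi> \<omega> {0..\<tau> t})))"
        by (intro eventually_sequentiallyI[of n0]) simp
      then show ?case by (rule tendsto_eventually)
    qed
    show "AE \<omega> in M. norm (exp (- truncated_total f n \<omega>)) \<le> 1" for n
      using truncated_total_nonneg[OF fm f0 beyond a(1)] by auto
  qed auto
  from LIMSEQ_unique[OF this laplace_functional[OF fm f0 beyond a(1)]]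
  show ?thesis unfolding f_def[abs_def] by simp
qed

end

section \<open>The cluster equation near criticality\<close>


lemma powr_add_le:
  fixes x y :: real assumes "0 \<le> x" "0 \<le> y" "0 \<le> r" "r \<le> 1"
  shows "(x + y) powr r \<le> x powr r + y powr r"
proof (cases "x + y = 0")
  case False
  then have s: "0 < x + y" using assms by auto
  have le: "z / (x + y) * (x + y) powr r \<le> z powr r" if z: "0 \<le> z" "z \<le> x + y" for z
  proof (cases "z = 0")
    case False
    then have z0: "0 < z" using z by auto
    have "z / (x + y) = (z / (x + y)) powr 1" using z0 s by simp
    also have "\<dots> \<le> (z / (x + y)) powr r" using z0 s z assms by (intro powr_mono') auto
    also have "\<dots> = z powr r / (x + y) powr r" using z0 s by (simp add: powr_divide)
    finally have "z / (x + y) * (x + y) powr r \<le> z powr r / (x + y) powr r * (x + y) powr r"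
      by (intro mult_right_mono) auto
    then show ?thesis using s by simp
  qed simp
  have "(x + y) powr r = x / (x + y) * (x + y) powr r + y / (x + y) * (x + y) powr r"
    using s by (simp add: add_divide_distrib[symmetric] distrib_right[symmetric])
  also have "\<dots> \<le> x powr r + y powr r" using assms by (intro add_mono le) auto
  finally show ?thesis .
qed (use assms in auto)

lemma powr_le_linear:
  fixes d s :: real assumes "0 \<le> d" "0 < s" "0 < r" "r \<le> 1"
  shows "d powr r \<le> s powr r + s powr (r - 1) * d"
proof (cases "d \<le> s")
  case True
  then have "d powr r \<le> s powr r" using assms by (intro powr_mono2) auto
  then show ?thesis using assms by (simp add: add_increasing2)
next
  case False
  then have d: "0 < d" "s \<le> d" using assms by auto
  have "d powr r = d powr (r - 1) * d" using d by (simp add: powr_diff)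
  also have "\<dots> \<le> s powr (r - 1) * d" using d assms by (intro mult_right_mono powr_mono2') auto
  finally show ?thesis by (simp add: add_increasing)
qed

text \<open>The last assumption is the asymptotic equivalence of \<open>H x\<close> and \<open>K * x powr (1 + \<beta>)\<close> at \<open>0\<close>.\<close>

locale critical_branching = nonneg_displacement +
  fixes p :: "nat pmf" and \<beta> K :: real and H :: "real \<Rightarrow> real"
  assumes H: "\<And>u. 0 \<le> u \<Longrightarrow> u \<le> 1 \<Longrightarrow> H u = generating_function p (1 - u) - 1 + u"
    and beta: "0 < \<beta>" and K: "0 < K"
    and H_mono: "\<And>x y. 0 \<le> x \<Longrightarrow> x \<le> y \<Longrightarrow> y \<le> 1 \<Longrightarrow> H x \<le> H y"
    and H_near_0: "\<And>\<epsilon>. 0 < \<epsilon> \<Longrightarrow> \<exists>\<eta>>0. \<forall>x. 0 < x \<and> x < \<eta> \<longrightarrow>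
      K * (1 - \<epsilon>) * x powr (1 + \<beta>) \<le> H x \<and> H x \<le> K * (1 + \<epsilon>) * x powr (1 + \<beta>)"
begin

lemma generating_function_bounds:
  assumes "0 \<le> s" "s \<le> 1" shows "0 \<le> generating_function p s" "generating_function p s \<le> 1"
proof -
  show "0 \<le> generating_function p s" unfolding generating_function_def using assms by (intro integral_nonneg_AE) auto
  have "generating_function p s \<le> measure_pmf.expectation p (\<lambda>_. 1)" unfolding generating_function_def
    using assms by (intro integral_mono measure_pmf.integrable_const_bound[of _ 1]) (auto simp: power_le_one)
  then show "generating_function p s \<le> 1" by simp
qed

lemma H_0: "H 0 = 0" using H[of 0] by (simp add: generating_function_def)

context
  fixes f :: "real \<Rightarrow> real" and a :: real
  assumes f [measurable]: "f \<in> borel_measurable borel" and f0: "\<And>x. 0 \<le> f x"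
    and anti: "antimono_on {0..} f" and beyond: "\<And>x. a < x \<Longrightarrow> f x = 0" and a: "0 \<le> a"
begin

text \<open>For small \<open>f\<close> the Laplace functional of a cluster is close to \<open>1\<close>; the defect measures the difference, and
  the mean defect is its average at the position of a child.\<close>

definition defect :: "real \<Rightarrow> real" where "defect x = 1 - cluster_limit p f x"
definition mean_defect :: "real \<Rightarrow> real" where "mean_defect x = (\<integral>y. defect (x + y) \<partial>D)"

lemma defect_measurable [measurable]: "defect \<in> borel_measurable borel"
  and mean_defect_measurable [measurable]: "mean_defect \<in> borel_measurable borel"
proof -
  note [measurable] = cluster_limit_measurable[OF f f0]
  show [measurable]: "defect \<in> borel_measurable borel" unfolding defect_def[abs_def] by measurable
  show "mean_defect \<in> borel_measurable borel" unfolding mean_defect_def[abs_def] by measurable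
qed

lemma defect_bounds: "0 \<le> defect x" "defect x \<le> 1"
  using cluster_limit_bounds[OF f f0, of p x] by (auto simp: defect_def)

lemma mean_defect_bounds: "0 \<le> mean_defect x" "mean_defect x \<le> 1"
  unfolding mean_defect_def by (rule shift_bounds[OF defect_measurable defect_bounds])+

lemma defect_beyond: "a < x \<Longrightarrow> defect x = 0"
  using cluster_limit_beyond[OF f f0 beyond, where x = x and p = p] by (simp add: defect_def)

text \<open>Since \<open>f\<close> decreases, so does the defect; hence averaging it over the displacement of a child
  can only decrease it.  This sign makes the comparison of \<open>H (mean_defect x)\<close> with \<open>f x\<close> elementary.\<close>

lemma mean_defect_le: assumes "0 \<le> x" shows "mean_defect x \<le> defect x"
proof -
  have "mean_defect x \<le> (\<integral>y. defect x \<partial>D)" unfolding mean_defect_def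
  proof (rule integral_mono_AE)
    show "AE y in D. defect (x + y) \<le> defect x"
      using nonneg_D by eventually_elim
        (use assms cluster_limit_mono[OF f f0 anti] in \<open>auto simp: defect_def\<close>)
  qed (use shift_integrable[OF defect_measurable defect_bounds] in auto)
  then show ?thesis by simp
qed

text \<open>The fixed point equation reads \<open>1 - defect = exp (- f) * (1 - mean_defect + H mean_defect)\<close>, where the
  last factor is a value of the generating function and lies in the unit interval.\<close>

lemma defect_equation:
  "defect x - mean_defect x = (1 - mean_defect x + H (mean_defect x)) * (1 - exp (- f x)) - H (mean_defect x)"
    and survival_bounds: "1 - mean_defect x \<le> 1 - mean_defect x + H (mean_defect x)" 
      "1 - mean_defect x + H (mean_defect x) \<le> 1"
proof -
  have i: "integrable D (\<lambda>y. cluster_limit p f (x + y))"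
    by (rule shift_integrable[OF cluster_limit_measurable[OF f f0] cluster_limit_bounds[OF f f0]])
  have m: "mean_defect x = 1 - (\<integral>y. cluster_limit p f (x + y) \<partial>D)"
    unfolding mean_defect_def defect_def using i by simp
  then have "H (mean_defect x) = generating_function p (\<integral>y. cluster_limit p f (x + y) \<partial>D) - 1 + mean_defect x"
    using H[OF mean_defect_bounds, of x] by (simp add: m)
  moreover have "defect x = 1 - exp (- f x) * generating_function p (\<integral>y. cluster_limit p f (x + y) \<partial>D)"
    unfolding defect_def by (subst cluster_limit_fixed_point[OF f f0]) simp
  ultimately show "defect x - mean_defect x = (1 - mean_defect x + H (mean_defect x)) * (1 - exp (- f x)) - H (mean_defect x)"
    by (simp add: algebra_simps)
  show "1 - mean_defect x \<le> 1 - mean_defect x + H (mean_defect x)"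
    using H_mono[of 0 "mean_defect x"] mean_defect_bounds H_0 by auto
  show "1 - mean_defect x + H (mean_defect x) \<le> 1"
    using H[OF mean_defect_bounds, of x] generating_function_bounds[of "1 - mean_defect x"] mean_defect_bounds[of x] by simp
qed

text \<open>A nonnegative difference \<open>defect - mean_defect\<close> in the equation leaves an upper bound on \<open>H\<close>.\<close>

lemma H_mean_defect_le:
  assumes "0 \<le> x" shows "H (mean_defect x) \<le> f x" "defect x \<le> mean_defect x + f x"
proof -
  have "(1 - mean_defect x + H (mean_defect x)) * (1 - exp (- f x)) \<le> 1 * f x"
    using survival_bounds[of x] mean_defect_bounds[of x] f0[of x] exp_ge_add_one_self[of "- f x"]
    by (intro mult_mono) (linarith | simp)+
  moreover have "0 \<le> H (mean_defect x)" using survival_bounds(1)[of x] by simp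
  ultimately show "H (mean_defect x) \<le> f x" "defect x \<le> mean_defect x + f x"
    using defect_equation[of x] mean_defect_le[OF assms] by linarith+
qed

lemma H_mean_defect_ge:
  assumes "mean_defect x \<le> \<epsilon>" "f x \<le> \<epsilon>" "\<epsilon> \<le> 1"
  shows "(1 - \<epsilon>)\<^sup>2 * f x \<le> H (mean_defect x) + (defect x - mean_defect x)"
proof -
  have "(1 - \<epsilon>) * f x \<le> (1 - f x) * f x" using assms f0[of x] by (intro mult_right_mono) auto
  also have "\<dots> \<le> 1 - exp (- f x)"
  proof -
    \<comment> \<open>this amounts to \<open>1 - exp (- f) \<ge> f / (1 + f) \<ge> (1 - f) * f\<close>\<close>
    have "exp (- f x) * (1 + f x) \<le> exp (- f x) * exp (f x)"
      by (intro mult_left_mono exp_ge_add_one_self) auto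
    then have e: "exp (- f x) * (1 + f x) \<le> 1" by (simp add: exp_minus)
    have "1 \<le> (1 - f x + f x * f x) * (1 + f x)" using f0[of x] by (simp add: algebra_simps)
    then have "exp (- f x) * (1 + f x) \<le> (1 - f x + f x * f x) * (1 + f x)" using e by linarith
    then have "exp (- f x) \<le> 1 - f x + f x * f x" using f0[of x] by (simp add: mult_le_cancel_right)
    then show ?thesis by (simp add: algebra_simps)
  qed
  finally have 1: "(1 - \<epsilon>) * f x \<le> 1 - exp (- f x)" .
  have "(1 - \<epsilon>) * ((1 - \<epsilon>) * f x) \<le> (1 - mean_defect x + H (mean_defect x)) * (1 - exp (- f x))"
    using 1 survival_bounds(1)[of x] assms f0[of x] by (intro mult_mono) auto
  then show ?thesis using defect_equation[of x] by (simp add: power2_eq_square mult.assoc)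
qed

lemma integrable_bounded_interval:
  fixes g :: "real \<Rightarrow> real"
  assumes "g \<in> borel_measurable borel" "\<And>x. 0 \<le> x \<Longrightarrow> \<bar>g x\<bar> \<le> B"
  shows "set_integrable lborel {0..a} g"
  unfolding set_integrable_def
  by (rule integrableI_bounded_set_indicator[where B = B]) (use assms a in auto)

text \<open>The two averages of the defect over \<open>[0, a]\<close> differ by boundary terms only, as Lebesgue measure is
  invariant under translations.\<close>

lemma defect_integral_le:
  assumes b: "\<And>x. 0 \<le> x \<Longrightarrow> defect x \<le> b"
  shows "(LINT x:{0..a}|lborel. defect x - mean_defect x) \<le> b * (\<integral>y. min y a \<partial>D)"
proof -
  interpret DL: pair_sigma_finite D lborel ..
  have b0: "0 \<le> b" using b[of 0] defect_bounds[of 0] by linarith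
  define g where "g x = ennreal (indicator {0..} x * defect x)" for x
  have gm[measurable]: "g \<in> borel_measurable borel" unfolding g_def by measurable
  let ?i = "indicator {0..a} :: real \<Rightarrow> ennreal"
  have shift: "(\<integral>\<^sup>+x. ?i x * ennreal (defect x) \<partial>lborel) \<le>
      (\<integral>\<^sup>+x. ?i x * ennreal (defect (x + y)) \<partial>lborel) + ennreal (b * min y a)" if y: "0 \<le> y" for y
  proof -
    have "(\<integral>\<^sup>+x. ?i x * ennreal (defect x) \<partial>lborel) \<le> (\<integral>\<^sup>+x. g x \<partial>lborel)"
      by (intro nn_integral_mono) (auto simp: g_def indicator_def)
    also have "\<dots> = (\<integral>\<^sup>+x. g (y + x) \<partial>lborel)"
      using nn_integral_real_affine[of g 1 y] by simp
    also have "\<dots> \<le> (\<integral>\<^sup>+x. ?i x * ennreal (defect (x + y)) + ennreal b * indicator {- y..min 0 (a - y)} x \<partial>lborel)"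
    proof (intro nn_integral_mono)
      fix x
      consider "a < x + y" | "x + y \<le> a" "0 \<le> x" | "x + y \<le> a" "x < 0" "- y \<le> x" | "x + y < 0" by linarith
      then show "g (y + x) \<le> ?i x * ennreal (defect (x + y)) + ennreal b * indicator {- y..min 0 (a - y)} x"
      proof cases
        case 1 then show ?thesis by (simp add: g_def defect_beyond add.commute)
      next
        case 2 then show ?thesis using y by (simp add: g_def add.commute)
      next
        case 3 then show ?thesis using b[of "y + x"] by (simp add: g_def ennreal_leI)
      next
        case 4 then show ?thesis by (simp add: g_def)
      qed
    qed
    also have "\<dots> = (\<integral>\<^sup>+x. ?i x * ennreal (defect (x + y)) \<partial>lborel) + ennreal b * emeasure lborel {- y..min 0 (a - y)}"
      by (subst nn_integral_add) (auto simp: nn_integral_cmult)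
    also have "ennreal b * emeasure lborel {- y..min 0 (a - y)} = ennreal (b * min y a)"
      using y a b0 by (simp add: ennreal_mult min_def)
    finally show ?thesis .
  qed
  have "(\<integral>\<^sup>+x. ?i x * ennreal (defect x) \<partial>lborel) = (\<integral>\<^sup>+y. (\<integral>\<^sup>+x. ?i x * ennreal (defect x) \<partial>lborel) \<partial>D)"
    by (simp add: emeasure_space_1[simplified])
  also have "\<dots> \<le> (\<integral>\<^sup>+y. (\<integral>\<^sup>+x. ?i x * ennreal (defect (x + y)) \<partial>lborel) + ennreal (b * min y a) \<partial>D)"
    by (rule nn_integral_mono_AE) (use nonneg_D shift in \<open>auto elim!: eventually_mono\<close>)
  also have "\<dots> = (\<integral>\<^sup>+y. (\<integral>\<^sup>+x. ?i x * ennreal (defect (x + y)) \<partial>lborel) \<partial>D) + (\<integral>\<^sup>+y. ennreal (b * min y a) \<partial>D)"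
    by (rule nn_integral_add) measurable
  also have "(\<integral>\<^sup>+y. (\<integral>\<^sup>+x. ?i x * ennreal (defect (x + y)) \<partial>lborel) \<partial>D) =
      (\<integral>\<^sup>+x. (\<integral>\<^sup>+y. ?i x * ennreal (defect (x + y)) \<partial>D) \<partial>lborel)"
    by (rule DL.Fubini'[symmetric]) measurable
  also have "\<dots> = (\<integral>\<^sup>+x. ?i x * ennreal (mean_defect x) \<partial>lborel)"
    unfolding mean_defect_def
    using shift_integrable[OF defect_measurable defect_bounds] defect_bounds
    by (intro nn_integral_cong) (simp add: nn_integral_cmult nn_integral_eq_integral)
  also have "(\<integral>\<^sup>+y. ennreal (b * min y a) \<partial>D) = ennreal (b * (\<integral>y. min y a \<partial>D))"
  proof -
    have "(\<integral>\<^sup>+y. ennreal (b * min y a) \<partial>D) = ennreal (\<integral>y. b * min y a \<partial>D)"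
    proof (rule nn_integral_eq_integral)
      show nn: "AE y in D. 0 \<le> b * min y a" using nonneg_D by eventually_elim (use a b0 in auto)
      show "integrable D (\<lambda>y. b * min y a)"
        using nonneg_D a b0 by (intro integrable_const_bound[of _ "b * a"])
          (auto elim!: eventually_mono simp: abs_mult intro: mult_left_mono)
    qed
    then show ?thesis by simp
  qed
  finally have le: "(\<integral>\<^sup>+x. ?i x * ennreal (defect x) \<partial>lborel) \<le>
      (\<integral>\<^sup>+x. ?i x * ennreal (mean_defect x) \<partial>lborel) + ennreal (b * (\<integral>y. min y a \<partial>D))" .
  have real: "(\<integral>\<^sup>+x. ?i x * ennreal (h x) \<partial>lborel) = ennreal (LINT x:{0..a}|lborel. h x)"
    if "h \<in> borel_measurable borel" "\<And>x. 0 \<le> h x" "\<And>x. h x \<le> 1" for h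
  proof -
    have "set_integrable lborel {0..a} h" by (rule integrable_bounded_interval[of _ 1]) (use that in auto)
    moreover have "?i x * ennreal (h x) = ennreal (indicator {0..a} x *\<^sub>R h x)" for x by (simp add: indicator_def)
    ultimately show ?thesis unfolding set_integrable_def set_lebesgue_integral_def
      using that by (simp add: nn_integral_eq_integral)
  qed
  have nn: "0 \<le> (LINT x:{0..a}|lborel. mean_defect x)" "0 \<le> b * (\<integral>y. min y a \<partial>D)"
  proof -
    show "0 \<le> (LINT x:{0..a}|lborel. mean_defect x)" unfolding set_lebesgue_integral_def
      using mean_defect_bounds by (intro integral_nonneg_AE) auto
    show "0 \<le> b * (\<integral>y. min y a \<partial>D)"
      using b0 nonneg_D a by (intro mult_nonneg_nonneg integral_nonneg_AE) (auto elim!: eventually_mono)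
  qed
  have "(LINT x:{0..a}|lborel. defect x) \<le> (LINT x:{0..a}|lborel. mean_defect x) + b * (\<integral>y. min y a \<partial>D)"
    using le real[OF defect_measurable defect_bounds] real[OF mean_defect_measurable mean_defect_bounds] nn
    by (simp add: ennreal_plus[symmetric] del: ennreal_plus)
  moreover have "(LINT x:{0..a}|lborel. defect x - mean_defect x) =
      (LINT x:{0..a}|lborel. defect x) - (LINT x:{0..a}|lborel. mean_defect x)"
    using defect_bounds mean_defect_bounds
    by (intro set_integral_diff(2) integrable_bounded_interval[of _ 1]) auto
  ultimately show ?thesis by linarith
qed

text \<open>Two-sided estimates of the integral of the defect.  The first compares \<open>H\<close> with a power from
  below; the second treats the difference \<open>defect - mean_defect\<close> as a perturbation of \<open>f\<close>, at the
  price of a free threshold \<open>s\<close>.\<close>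

context
  fixes c \<eta> \<epsilon> :: real
  assumes fc: "\<And>x. f x \<le> c" and \<epsilon>: "0 < \<epsilon>" "\<epsilon> < 1" and \<eta>: "0 < \<eta>" "\<eta> \<le> 1" and cH: "c < H \<eta>"
    and near: "\<And>x. 0 < x \<Longrightarrow> x \<le> \<eta> \<Longrightarrow> K * (1 - \<epsilon>) * x powr (1 + \<beta>) \<le> H x \<and> H x \<le> K * (1 + \<epsilon>) * x powr (1 + \<beta>)"
begin

text \<open>If \<open>H\<close> is below \<open>H \<eta>\<close>, its argument is below \<open>\<eta>\<close> and the power bounds for \<open>H\<close> are available.\<close>

lemma mean_defect_small: assumes "0 \<le> x" shows "mean_defect x < \<eta>"
proof (rule ccontr)
  assume "\<not> ?thesis"
  then have "H \<eta> \<le> H (mean_defect x)" using \<eta> mean_defect_bounds by (intro H_mono) auto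
  then show False using H_mean_defect_le(1)[OF assms] fc[of x] cH by linarith
qed

lemma mean_defect_upper:
  assumes x: "0 \<le> x" shows "mean_defect x \<le> (1 / (K * (1 - \<epsilon>))) powr (1 / (1 + \<beta>)) * f x powr (1 / (1 + \<beta>))"
proof (cases "mean_defect x = 0")
  case False
  let ?u = "mean_defect x"
  have u: "0 < ?u" using False mean_defect_bounds[of x] by linarith
  have K': "0 < K * (1 - \<epsilon>)" using K \<epsilon> by simp
  have "K * (1 - \<epsilon>) * ?u powr (1 + \<beta>) \<le> f x"
    using near[OF u] mean_defect_small[OF x] H_mean_defect_le(1)[OF x] by linarith
  then have "?u powr (1 + \<beta>) \<le> 1 / (K * (1 - \<epsilon>)) * f x" using K' by (simp add: field_simps)
  then have "(?u powr (1 + \<beta>)) powr (1 / (1 + \<beta>)) \<le> (1 / (K * (1 - \<epsilon>)) * f x) powr (1 / (1 + \<beta>))"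
    using beta by (intro powr_mono2) auto
  also have "(1 / (K * (1 - \<epsilon>)) * f x) powr (1 / (1 + \<beta>)) = (1 / (K * (1 - \<epsilon>))) powr (1 / (1 + \<beta>)) * f x powr (1 / (1 + \<beta>))"
    by (rule powr_mult)
  finally show ?thesis using u beta by (simp add: powr_powr)
qed simp

lemma defect_upper:
  assumes x: "0 \<le> x"
  shows "defect x \<le> (1 / (K * (1 - \<epsilon>))) powr (1 / (1 + \<beta>)) * f x powr (1 / (1 + \<beta>)) + f x"
    and "defect x \<le> (1 / (K * (1 - \<epsilon>))) powr (1 / (1 + \<beta>)) * c powr (1 / (1 + \<beta>)) + c"
proof -
  show 1: "defect x \<le> (1 / (K * (1 - \<epsilon>))) powr (1 / (1 + \<beta>)) * f x powr (1 / (1 + \<beta>)) + f x"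
    using mean_defect_upper[OF x] H_mean_defect_le(2)[OF x] by linarith
  have "f x powr (1 / (1 + \<beta>)) \<le> c powr (1 / (1 + \<beta>))" using f0 fc beta by (intro powr_mono2) auto
  then have "(1 / (K * (1 - \<epsilon>))) powr (1 / (1 + \<beta>)) * f x powr (1 / (1 + \<beta>)) \<le>
      (1 / (K * (1 - \<epsilon>))) powr (1 / (1 + \<beta>)) * c powr (1 / (1 + \<beta>))" by (intro mult_left_mono) auto
  then show "defect x \<le> (1 / (K * (1 - \<epsilon>))) powr (1 / (1 + \<beta>)) * c powr (1 / (1 + \<beta>)) + c"
    using 1 fc[of x] by linarith
qed

lemma f_power_integrable: "set_integrable lborel {0..a} (\<lambda>x. f x powr (1 / (1 + \<beta>)))"
  using f0 fc beta by (intro integrable_bounded_interval[of _ "c powr (1 / (1 + \<beta>))"]) (auto intro: powr_mono2)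

lemma defect_set_integrable: "set_integrable lborel {0..a} defect" "set_integrable lborel {0..a} mean_defect"
  "set_integrable lborel {0..a} f"
proof -
  show "set_integrable lborel {0..a} defect" "set_integrable lborel {0..a} mean_defect"
    using defect_bounds mean_defect_bounds by (auto intro!: integrable_bounded_interval[of _ 1])
  show "set_integrable lborel {0..a} f" using f0 fc by (auto intro!: integrable_bounded_interval[of _ c])
qed

lemma defect_integral_upper:
  "(LINT x:{0..a}|lborel. defect x) \<le>
    (1 / (K * (1 - \<epsilon>))) powr (1 / (1 + \<beta>)) * (LINT x:{0..a}|lborel. f x powr (1 / (1 + \<beta>))) + (LINT x:{0..a}|lborel. f x)"
proof -
  let ?k = "(1 / (K * (1 - \<epsilon>))) powr (1 / (1 + \<beta>))"
  have i: "set_integrable lborel {0..a} (\<lambda>x. ?k * f x powr (1 / (1 + \<beta>)))"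
    using f_power_integrable by (rule set_integrable_mult_right)
  have "(LINT x:{0..a}|lborel. defect x) \<le> (LINT x:{0..a}|lborel. ?k * f x powr (1 / (1 + \<beta>)) + f x)"
    by (rule set_integral_mono[OF defect_set_integrable(1) set_integral_add(1)[OF i defect_set_integrable(3)]])
      (use defect_upper(1) in auto)
  also have "\<dots> = (LINT x:{0..a}|lborel. ?k * f x powr (1 / (1 + \<beta>))) + (LINT x:{0..a}|lborel. f x)"
    by (rule set_integral_add(2)[OF i defect_set_integrable(3)])
  finally show ?thesis by simp
qed

lemma defect_integral_lower:
  assumes s: "0 < s" and small: "\<eta> \<le> \<epsilon>" "c \<le> \<epsilon>"
  shows "((1 - \<epsilon>)\<^sup>2) powr (1 / (1 + \<beta>)) * (LINT x:{0..a}|lborel. f x powr (1 / (1 + \<beta>))) \<le>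
    (K * (1 + \<epsilon>)) powr (1 / (1 + \<beta>)) * (LINT x:{0..a}|lborel. defect x) + s powr (1 / (1 + \<beta>)) * a +
    s powr (1 / (1 + \<beta>) - 1) * (LINT x:{0..a}|lborel. defect x - mean_defect x)"
proof -
  let ?r = "1 / (1 + \<beta>)"
  have r: "0 < ?r" "?r \<le> 1" using beta by auto
  let ?d = "\<lambda>x. defect x - mean_defect x"
  have pt: "((1 - \<epsilon>)\<^sup>2) powr ?r * f x powr ?r \<le> (K * (1 + \<epsilon>)) powr ?r * defect x + (s powr ?r + s powr (?r - 1) * ?d x)"
    if x: "0 \<le> x" for x
  proof -
    let ?u = "mean_defect x"
    have u0: "0 \<le> ?u" "?u \<le> defect x" "0 \<le> ?d x" using mean_defect_bounds mean_defect_le[OF x] by auto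
    \<comment> \<open>the power \<open>1 / (1 + \<beta>) \<le> 1\<close> is subadditive, which separates the perturbation from the main term\<close>
    have H: "H ?u \<le> K * (1 + \<epsilon>) * ?u powr (1 + \<beta>)"
      using near[of ?u] mean_defect_small[OF x] u0 H_0 by (cases "?u = 0") auto
    have "(1 - \<epsilon>)\<^sup>2 * f x \<le> K * (1 + \<epsilon>) * ?u powr (1 + \<beta>) + ?d x"
      using H_mean_defect_ge[of x \<epsilon>] mean_defect_small[OF x] small fc[of x] \<epsilon> H by linarith
    then have "((1 - \<epsilon>)\<^sup>2 * f x) powr ?r \<le> (K * (1 + \<epsilon>) * ?u powr (1 + \<beta>) + ?d x) powr ?r"
      using f0[of x] r by (intro powr_mono2) auto
    also have "\<dots> \<le> (K * (1 + \<epsilon>) * ?u powr (1 + \<beta>)) powr ?r + ?d x powr ?r"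
      using K \<epsilon> u0 r by (intro powr_add_le) auto
    also have "(K * (1 + \<epsilon>) * ?u powr (1 + \<beta>)) powr ?r = (K * (1 + \<epsilon>)) powr ?r * ?u"
    proof -
      have "(?u powr (1 + \<beta>)) powr ?r = ?u" using u0 beta by (cases "?u = 0") (auto simp: powr_powr)
      then show ?thesis using K \<epsilon> by (simp add: powr_mult)
    qed
    also have "(K * (1 + \<epsilon>)) powr ?r * ?u \<le> (K * (1 + \<epsilon>)) powr ?r * defect x"
      using u0 by (intro mult_left_mono) auto
    also have "?d x powr ?r \<le> s powr ?r + s powr (?r - 1) * ?d x"
      using u0 s r by (intro powr_le_linear)
    finally show ?thesis using f0[of x] by (simp add: powr_mult)
  qed
  have i1: "set_integrable lborel {0..a} (\<lambda>x. (K * (1 + \<epsilon>)) powr ?r * defect x)"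
    using defect_set_integrable(1) by (rule set_integrable_mult_right)
  have ci: "set_integrable lborel {0..a} (\<lambda>x. s powr ?r)"
    by (rule integrable_bounded_interval[of _ "s powr ?r"]) auto
  have i2: "set_integrable lborel {0..a} (\<lambda>x. s powr (?r - 1) * ?d x)"
    using set_integral_diff(1)[OF defect_set_integrable(1,2)] by (rule set_integrable_mult_right)
  have "(LINT x:{0..a}|lborel. ((1 - \<epsilon>)\<^sup>2) powr ?r * f x powr ?r) \<le>
      (LINT x:{0..a}|lborel. (K * (1 + \<epsilon>)) powr ?r * defect x + (s powr ?r + s powr (?r - 1) * ?d x))"
    by (rule set_integral_mono[OF set_integrable_mult_right[OF f_power_integrable]
      set_integral_add(1)[OF i1 set_integral_add(1)[OF ci i2]]]) (use pt in auto)
  also have "\<dots> = (LINT x:{0..a}|lborel. (K * (1 + \<epsilon>)) powr ?r * defect x) +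
      ((LINT x:{0..a}|lborel. s powr ?r) + (LINT x:{0..a}|lborel. s powr (?r - 1) * ?d x))"
    by (simp only: set_integral_add(2)[OF i1 set_integral_add(1)[OF ci i2]] set_integral_add(2)[OF ci i2])
  also have "(LINT x:{0..a}|lborel. s powr ?r) = s powr ?r * a"
    using a by (subst set_integral_const) auto
  finally show ?thesis by (simp add: add.assoc)
qed

end

end

end

lemma min_le_powr:
  fixes y a r :: real assumes "0 \<le> y" "0 < a" "0 < r" "r \<le> 1"
  shows "min y a \<le> a powr (1 - r) * y powr r"
proof (cases "y \<le> a")
  case True
  show ?thesis
  proof (cases "y = 0")
    case False
    then have "y = y powr (1 - r) * y powr r" using assms by (simp add: powr_add[symmetric])
    also have "\<dots> \<le> a powr (1 - r) * y powr r" using True assms by (intro mult_right_mono powr_mono2) auto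
    finally show ?thesis by (simp add: min_def)
  qed (use assms in auto)
next
  case False
  have "a = a powr (1 - r) * a powr r" using assms by (simp add: powr_add[symmetric])
  also have "\<dots> \<le> a powr (1 - r) * y powr r" using False assms by (intro mult_left_mono powr_mono2) auto
  finally show ?thesis by (simp add: min_def)
qed

lemma set_integral_scale:
  fixes h :: "real \<Rightarrow> real" assumes "0 < T"
  shows "(LINT x:{0..a * T}|lborel. h (x / T)) = T * (LINT x:{0..a}|lborel. h x)"
proof -
  have "(LINT x:{0..a * T}|lborel. h (x / T)) =
      \<bar>T\<bar> *\<^sub>R (LINT x|lborel. indicator {0..a * T} (0 + T * x) *\<^sub>R h ((0 + T * x) / T))"
    unfolding set_lebesgue_integral_def using assms by (intro lborel_integral_real_affine) auto
  also have "(\<lambda>x. indicator {0..a * T} (0 + T * x) *\<^sub>R h ((0 + T * x) / T)) = (\<lambda>x. indicator {0..a} x *\<^sub>R h x)"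
    using assms by (auto simp: fun_eq_iff indicator_def zero_le_mult_iff mult.commute)
  finally show ?thesis using assms by (simp add: set_lebesgue_integral_def)
qed

context critical_branching
begin

text \<open>Writing \<open>v = defect\<close>, the equation reads \<open>H (mean_defect) \<approx> f\<close> up to the difference
  \<open>v - mean_defect\<close>, whose integral is of smaller order by the moment condition.  Since \<open>H\<close> behaves
  like \<open>K\<close> times the power \<open>1 + \<beta>\<close>, the defect is asymptotically \<open>(f / K) powr (1 / (1 + \<beta>))\<close>.
  In the scaling chosen here the power of \<open>T\<close> in \<open>f\<close> and the length of the interval compensate each other.\<close>

lemma defect_integral_tendsto:
  fixes g :: "real \<Rightarrow> real" and a r c :: real
  assumes g: "g \<in> borel_measurable borel" "\<And>x. 0 \<le> g x" "\<And>x. g x \<le> c" "antimono_on {0..} g"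
      "\<And>x. a < x \<Longrightarrow> g x = 0"
    and a: "0 < a" and r: "\<beta> < r" "r \<le> 1" and moment: "integrable D (\<lambda>y. y powr r)"
  shows "((\<lambda>T. LINT x:{0..a * T}|lborel. 1 - cluster_limit p (\<lambda>x. T powr - (1 + \<beta>) * g (x / T)) x) \<longlongrightarrow>
    (1 / K) powr (1 / (1 + \<beta>)) * (LINT x:{0..a}|lborel. g x powr (1 / (1 + \<beta>)))) at_top"
proof -
  note [measurable] = g(1)
  let ?r = "1 / (1 + \<beta>)"
  have rr: "0 < ?r" "?r \<le> 1" using beta by auto
  define f where "f T x = T powr - (1 + \<beta>) * g (x / T)" for T x :: real
  define X where "X T = (LINT x:{0..a * T}|lborel. defect (f T) x)" for T
  define I where "I = (LINT x:{0..a}|lborel. g x powr ?r)"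
  define I1 where "I1 = (LINT x:{0..a}|lborel. g x)"
  define m where "m = (\<integral>y. y powr r \<partial>D)"
  have c0: "0 \<le> c" using g(2)[of 0] g(3)[of 0] by linarith
  have fm: "f T \<in> borel_measurable borel" for T unfolding f_def by measurable
  have f0: "0 \<le> f T x" for T x using g(2) by (simp add: f_def)
  have fanti: "antimono_on {0..} (f T)" if "0 < T" for T
  proof (rule monotone_onI)
    fix x y :: real assume "x \<in> {0..}" "y \<in> {0..}" "x \<le> y"
    then have "g (y / T) \<le> g (x / T)"
      using that by (intro monotone_onD[OF g(4)]) (auto intro: divide_right_mono)
    then show "f T y \<le> f T x" by (auto simp: f_def intro: mult_left_mono)
  qed
  have fbeyond: "f T x = 0" if "0 < T" "a * T < x" for T x
    using that g(5)[of "x / T"] by (simp add: f_def field_simps)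
  have fc: "f T x \<le> T powr - (1 + \<beta>) * c" for T x
    using g(3) by (auto simp: f_def intro!: mult_left_mono)
  have If: "(LINT x:{0..a * T}|lborel. f T x powr ?r) = I" if T: "0 < T" for T
  proof -
    have "- (1 + \<beta>) * ?r = - 1" using beta by (simp add: field_simps)
    then have "f T x powr ?r = T powr - 1 * g (x / T) powr ?r" for x
      by (simp only: f_def powr_mult powr_powr)
    then have "(LINT x:{0..a * T}|lborel. f T x powr ?r) = T powr - 1 * (LINT x:{0..a * T}|lborel. g (x / T) powr ?r)"
      by simp
    then show ?thesis using set_integral_scale[OF T, of a "\<lambda>x. g x powr ?r"] T
      by (simp add: I_def powr_minus)
  qed
  have I1f: "(LINT x:{0..a * T}|lborel. f T x) = T powr - \<beta> * I1" if T: "0 < T" for T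
  proof -
    have "(LINT x:{0..a * T}|lborel. f T x) = T powr - (1 + \<beta>) * (T * I1)"
      unfolding f_def using set_integral_scale[OF T, of a g] by (simp add: I1_def)
    also have "T powr - (1 + \<beta>) * (T * I1) = T powr - \<beta> * I1"
      using T by (simp add: powr_diff powr_minus field_simps powr_add)
    finally show ?thesis .
  qed
  have m0: "0 \<le> m" unfolding m_def by (intro integral_nonneg_AE) auto
  have min_int: "(\<integral>y. min y (a * T) \<partial>D) \<le> (a * T) powr (1 - r) * m" if T: "0 < T" for T
  proof -
    have "(\<integral>y. min y (a * T) \<partial>D) \<le> (\<integral>y. (a * T) powr (1 - r) * y powr r \<partial>D)"
    proof (rule integral_mono_AE)
      show "integrable D (\<lambda>y. min y (a * T))"
        using nonneg_D a T by (intro integrable_const_bound[of _ "a * T"]) (auto elim!: eventually_mono)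
      show "AE y in D. min y (a * T) \<le> (a * T) powr (1 - r) * y powr r"
        using nonneg_D by eventually_elim (use a T r beta in \<open>intro min_le_powr\<close>, auto)
    qed (use moment in auto)
    then show ?thesis by (simp add: m_def)
  qed
  \<comment> \<open>the constant in the supremum bound for the defect\<close>
  define B where "B \<epsilon> = (1 / (K * (1 - \<epsilon>))) powr ?r * c powr ?r + c" for \<epsilon>
  have estimates: "\<forall>\<^sub>F T in at_top.
      X T \<le> (1 / (K * (1 - \<epsilon>))) powr ?r * I + T powr - \<beta> * I1 \<and>
      ((1 - \<epsilon>)\<^sup>2) powr ?r * I \<le> (K * (1 + \<epsilon>)) powr ?r * X T + \<epsilon> powr ?r * a +
        \<epsilon> powr (?r - 1) * (B \<epsilon> * (a powr (1 - r) * m)) * T powr (\<beta> - r)"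
    if \<epsilon>: "0 < \<epsilon>" "\<epsilon> < 1" for \<epsilon>
  proof -
    obtain \<eta>0 where \<eta>0: "0 < \<eta>0" "\<And>x. 0 < x \<Longrightarrow> x < \<eta>0 \<Longrightarrow>
        K * (1 - \<epsilon>) * x powr (1 + \<beta>) \<le> H x \<and> H x \<le> K * (1 + \<epsilon>) * x powr (1 + \<beta>)"
      using H_near_0[OF \<epsilon>(1)] by blast
    define \<eta> where "\<eta> = min \<epsilon> (\<eta>0 / 2)"
    have \<eta>: "0 < \<eta>" "\<eta> \<le> 1" "\<eta> \<le> \<epsilon>" "\<eta> < \<eta>0" using \<epsilon> \<eta>0(1) by (auto simp: \<eta>_def)
    have near: "K * (1 - \<epsilon>) * x powr (1 + \<beta>) \<le> H x \<and> H x \<le> K * (1 + \<epsilon>) * x powr (1 + \<beta>)" if "0 < x" "x \<le> \<eta>" for x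
      using \<eta>0(2) that \<eta> by auto
    have "0 < K * (1 - \<epsilon>) * \<eta> powr (1 + \<beta>)" using K \<epsilon> \<eta> by simp
    then have H\<eta>: "0 < H \<eta>" using near[of \<eta>] \<eta> by linarith
    have "((\<lambda>T. T powr - (1 + \<beta>) * c) \<longlongrightarrow> 0 * c) at_top"
      using beta by (intro tendsto_intros tendsto_neg_powr filterlim_ident) auto
    then have "\<forall>\<^sub>F T in at_top. T powr - (1 + \<beta>) * c < min \<epsilon> (H \<eta>)"
      using \<epsilon> H\<eta> by (intro order_tendstoD) auto
    then show ?thesis
      using eventually_ge_at_top[of 1]
    proof eventually_elim
      case (elim T)
      then have T: "1 \<le> T" "0 < T" by auto
      have aT: "0 \<le> a * T" using a T by simp
      let ?c = "T powr - (1 + \<beta>) * c"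
      have cH: "?c < H \<eta>" and c\<epsilon>: "?c \<le> \<epsilon>" using elim by auto
      note ctx = fm[of T] f0[of T] fanti[OF T(2)] fbeyond[OF T(2)] aT fc[of T] \<epsilon> \<eta>(1,2) cH near
      have up: "X T \<le> (1 / (K * (1 - \<epsilon>))) powr ?r * I + T powr - \<beta> * I1"
        using defect_integral_upper[OF ctx] unfolding X_def If[OF T(2)] I1f[OF T(2)] .
      \<comment> \<open>a threshold below the order of \<open>f T\<close>: its own contribution is small with \<open>\<epsilon>\<close>, the other one with \<open>1 / T\<close>\<close>
      let ?s = "\<epsilon> * T powr - (1 + \<beta>)"
      have s: "0 < ?s" using \<epsilon> T by simp
      define d where "d = (LINT x:{0..a * T}|lborel. defect (f T) x - mean_defect (f T) x)"
      have low: "((1 - \<epsilon>)\<^sup>2) powr ?r * I \<le> (K * (1 + \<epsilon>)) powr ?r * X T + ?s powr ?r * (a * T) + ?s powr (?r - 1) * d"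
        using defect_integral_lower[OF ctx s \<eta>(3) c\<epsilon>] unfolding X_def d_def If[OF T(2)] .
      have s1: "?s powr ?r * (a * T) = \<epsilon> powr ?r * a"
      proof -
        have "- (1 + \<beta>) * ?r = - 1" using beta by (simp add: field_simps)
        then have "?s powr ?r = \<epsilon> powr ?r * T powr - 1" by (simp only: powr_mult powr_powr)
        then show ?thesis using T by (simp add: powr_minus)
      qed
      have s2: "?s powr (?r - 1) = \<epsilon> powr (?r - 1) * T powr \<beta>"
      proof -
        have "- (1 + \<beta>) * (?r - 1) = \<beta>" using beta by (simp add: field_simps)
        then show ?thesis using \<epsilon> T by (simp add: powr_mult powr_powr)
      qed
      have sup: "defect (f T) x \<le> B \<epsilon> / T" if "0 \<le> x" for x
      proof -
        have "- (1 + \<beta>) * ?r = - 1" using beta by (simp add: field_simps)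
        then have "?c powr ?r = T powr - 1 * c powr ?r" by (simp only: powr_mult powr_powr)
        then have "?c powr ?r = c powr ?r / T" using T by (simp add: powr_minus divide_inverse mult.commute)
        moreover have "?c \<le> c / T"
        proof -
          have "T powr - (1 + \<beta>) \<le> T powr - 1" using T beta by (intro powr_mono) auto
          then have "?c \<le> T powr - 1 * c" using c0 by (intro mult_right_mono)
          then show ?thesis using T by (simp add: powr_minus field_simps)
        qed
        ultimately show ?thesis
          using defect_upper(2)[OF ctx that] by (simp add: B_def add_divide_distrib)
      qed
      have B0: "0 \<le> B \<epsilon>" using c0 by (simp add: B_def)
      have "d \<le> B \<epsilon> / T * (\<integral>y. min y (a * T) \<partial>D)"
        unfolding d_def by (rule defect_integral_le[OF fm f0 fanti[OF T(2)] fbeyond[OF T(2)] aT sup])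
      also have "\<dots> \<le> B \<epsilon> / T * ((a * T) powr (1 - r) * m)"
        using B0 T by (intro mult_left_mono min_int) auto
      also have "\<dots> = B \<epsilon> * (a powr (1 - r) * m) * T powr - r"
        using a T by (simp add: powr_mult powr_diff powr_minus field_simps)
      finally have "?s powr (?r - 1) * d \<le> (\<epsilon> powr (?r - 1) * T powr \<beta>) * (B \<epsilon> * (a powr (1 - r) * m) * T powr - r)"
        unfolding s2 by (intro mult_left_mono) auto
      also have "\<dots> = \<epsilon> powr (?r - 1) * (B \<epsilon> * (a powr (1 - r) * m)) * T powr (\<beta> - r)"
        by (simp add: powr_diff powr_minus field_simps)
      finally show ?case using up low unfolding s1 by linarith
    qed
  qed
  have "(X \<longlongrightarrow> (1 / K) powr ?r * I) at_top"
  proof (rule order_tendstoI)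
    fix y assume y: "(1 / K) powr ?r * I < y"
    have "((\<lambda>\<epsilon>. (1 / (K * (1 - \<epsilon>))) powr ?r * I) \<longlongrightarrow> (1 / (K * (1 - 0))) powr ?r * I) (at_right 0)"
      using K by (intro tendsto_intros) auto
    then have "\<forall>\<^sub>F \<epsilon> in at_right 0. (1 / (K * (1 - \<epsilon>))) powr ?r * I < y"
      using y by (intro order_tendstoD) auto
    moreover have "\<forall>\<^sub>F \<epsilon> in at_right (0 :: real). 0 < \<epsilon> \<and> \<epsilon> < 1"
      by (intro eventually_conj eventually_at_rightI[of 0 1]) auto
    ultimately have "\<forall>\<^sub>F \<epsilon> in at_right 0. (0 < \<epsilon> \<and> \<epsilon> < 1) \<and> (1 / (K * (1 - \<epsilon>))) powr ?r * I < y"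
      by eventually_elim auto
    then obtain \<epsilon> where \<epsilon>: "0 < \<epsilon>" "\<epsilon> < 1" "(1 / (K * (1 - \<epsilon>))) powr ?r * I < y"
      using eventually_happens[of _ "at_right (0::real)"] by auto
    have "((\<lambda>T. (1 / (K * (1 - \<epsilon>))) powr ?r * I + T powr - \<beta> * I1) \<longlongrightarrow> (1 / (K * (1 - \<epsilon>))) powr ?r * I + 0 * I1) at_top"
      using beta by (intro tendsto_intros tendsto_neg_powr filterlim_ident) auto
    then have "\<forall>\<^sub>F T in at_top. (1 / (K * (1 - \<epsilon>))) powr ?r * I + T powr - \<beta> * I1 < y"
      using \<epsilon>(3) by (intro order_tendstoD) auto
    with estimates[OF \<epsilon>(1,2)] show "\<forall>\<^sub>F T in at_top. X T < y" by eventually_elim auto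
  next
    fix y assume y: "y < (1 / K) powr ?r * I"
    let ?L = "\<lambda>\<epsilon>. (((1 - \<epsilon>)\<^sup>2) powr ?r * I - \<epsilon> powr ?r * a) / (K * (1 + \<epsilon>)) powr ?r"
    have "((\<lambda>\<epsilon>::real. \<epsilon> powr ?r) \<longlongrightarrow> 0 powr ?r) (at_right 0)"
      by (rule tendsto_powr'[OF tendsto_ident_at tendsto_const])
        (use rr in \<open>auto simp: eventually_at_filter\<close>)
    note E = this
    have E1: "((\<lambda>\<epsilon>. ((1 - \<epsilon>)\<^sup>2) powr ?r * I) \<longlongrightarrow> ((1 - 0)\<^sup>2) powr ?r * I) (at_right 0)"
      by (intro tendsto_intros) auto
    have E2: "((\<lambda>\<epsilon>. (K * (1 + \<epsilon>)) powr ?r) \<longlongrightarrow> (K * (1 + 0)) powr ?r) (at_right 0)"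
      using K by (intro tendsto_intros) auto
    have "(?L \<longlongrightarrow> (((1 - 0)\<^sup>2) powr ?r * I - 0 powr ?r * a) / (K * (1 + 0)) powr ?r) (at_right 0)"
      by (rule tendsto_divide[OF tendsto_diff[OF E1 tendsto_mult[OF E tendsto_const]] E2]) (use K in auto)
    moreover have "(1 / K) powr ?r * I = (((1 - 0)\<^sup>2) powr ?r * I - 0 powr ?r * a) / (K * (1 + 0)) powr ?r"
      using K by (simp add: powr_divide)
    ultimately have "\<forall>\<^sub>F \<epsilon> in at_right 0. y < ?L \<epsilon>" using y by (intro order_tendstoD) auto
    moreover have "\<forall>\<^sub>F \<epsilon> in at_right (0 :: real). 0 < \<epsilon> \<and> \<epsilon> < 1"
      by (intro eventually_conj eventually_at_rightI[of 0 1]) auto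
    ultimately have "\<forall>\<^sub>F \<epsilon> in at_right 0. (0 < \<epsilon> \<and> \<epsilon> < 1) \<and> y < ?L \<epsilon>"
      by eventually_elim auto
    then obtain \<epsilon> where \<epsilon>: "0 < \<epsilon>" "\<epsilon> < 1" "y < ?L \<epsilon>"
      using eventually_happens[of _ "at_right (0::real)"] by auto
    let ?k = "(K * (1 + \<epsilon>)) powr ?r" and ?C = "\<epsilon> powr (?r - 1) * (B \<epsilon> * (a powr (1 - r) * m))"
    have k: "0 < ?k" using K \<epsilon> by simp
    have "((\<lambda>T. (((1 - \<epsilon>)\<^sup>2) powr ?r * I - \<epsilon> powr ?r * a - ?C * T powr (\<beta> - r)) / ?k) \<longlongrightarrow>
        (((1 - \<epsilon>)\<^sup>2) powr ?r * I - \<epsilon> powr ?r * a - ?C * 0) / ?k) at_top"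
      using k r by (intro tendsto_intros tendsto_neg_powr filterlim_ident) auto
    then have "\<forall>\<^sub>F T in at_top. y < (((1 - \<epsilon>)\<^sup>2) powr ?r * I - \<epsilon> powr ?r * a - ?C * T powr (\<beta> - r)) / ?k"
      using \<epsilon>(3) by (intro order_tendstoD) auto
    with estimates[OF \<epsilon>(1,2)] show "\<forall>\<^sub>F T in at_top. y < X T"
    proof eventually_elim
      case (elim T)
      have "(((1 - \<epsilon>)\<^sup>2) powr ?r * I - \<epsilon> powr ?r * a - ?C * T powr (\<beta> - r)) / ?k \<le> X T"
        using elim(1) k by (simp add: pos_divide_le_eq mult.commute algebra_simps)
      then show ?case using elim(2) by linarith
    qed
  qed
  moreover have "\<forall>\<^sub>F T in at_top. X T = (LINT x:{0..a * T}|lborel. 1 - cluster_limit p (\<lambda>x. T powr - (1 + \<beta>) * g (x / T)) x)"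
    using eventually_gt_at_top[of 0]
  proof eventually_elim
    case (elim T)
    have aT: "0 \<le> a * T" using a elim by simp
    have "defect (f T) = (\<lambda>x. 1 - cluster_limit p (f T) x)"
      by (rule ext) (rule defect_def[OF fm f0 fanti[OF elim] fbeyond[OF elim] aT])
    then show ?case by (simp add: X_def f_def[abs_def])
  qed
  ultimately show ?thesis unfolding I_def by (rule Lim_transform_eventually)
qed

text \<open>The sup bound for the defect tends to \<open>0\<close> with the size of \<open>f\<close>; this gives the local finiteness of the
  population.\<close>

lemma defect_integral_small:
  assumes a: "0 \<le> a" and e: "0 < e"
  shows "\<exists>\<theta>>0. (LINT x:{0..a}|lborel. 1 - cluster_limit p (\<lambda>x. \<theta> * indicator {0..a} x) x) \<le> e"
proof -
  let ?r = "1 / (1 + \<beta>)"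
  obtain \<eta>0 where \<eta>0: "0 < \<eta>0" "\<And>x. 0 < x \<Longrightarrow> x < \<eta>0 \<Longrightarrow>
      K * (1 - 1 / 2) * x powr (1 + \<beta>) \<le> H x \<and> H x \<le> K * (1 + 1 / 2) * x powr (1 + \<beta>)"
    using H_near_0[of "1 / 2"] by auto
  define \<eta> where "\<eta> = min 1 (\<eta>0 / 2)"
  have \<eta>: "0 < \<eta>" "\<eta> \<le> 1" "\<eta> < \<eta>0" using \<eta>0(1) by (auto simp: \<eta>_def)
  have near: "K * (1 - 1 / 2) * x powr (1 + \<beta>) \<le> H x \<and> H x \<le> K * (1 + 1 / 2) * x powr (1 + \<beta>)" if "0 < x" "x \<le> \<eta>" for x
    using \<eta>0(2) that \<eta> by auto
  have "0 < K * (1 - 1 / 2) * \<eta> powr (1 + \<beta>)" using K \<eta> by simp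
  then have H\<eta>: "0 < H \<eta>" using near[of \<eta>] \<eta> by linarith
  let ?b = "\<lambda>\<theta>. ((1 / (K * (1 - 1 / 2))) powr ?r * \<theta> powr ?r + \<theta>) * a"
  have "((\<lambda>\<epsilon>::real. \<epsilon> powr ?r) \<longlongrightarrow> 0 powr ?r) (at_right 0)"
    by (rule tendsto_powr'[OF tendsto_ident_at tendsto_const])
      (use divide_pos_pos[of 1 "1 + \<beta>"] beta in \<open>auto simp: eventually_at_filter\<close>)
  then have "(?b \<longlongrightarrow> ((1 / (K * (1 - 1 / 2))) powr ?r * 0 powr ?r + 0) * a) (at_right 0)"
    by (intro tendsto_add tendsto_mult tendsto_const tendsto_ident_at)
  then have "\<forall>\<^sub>F \<theta> in at_right 0. ?b \<theta> < e" using e by (intro order_tendstoD) auto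
  moreover have "\<forall>\<^sub>F \<theta> in at_right 0. 0 < \<theta> \<and> \<theta> < H \<eta>"
    using H\<eta> by (intro eventually_conj eventually_at_rightI[of 0 "H \<eta>"]) auto
  ultimately have "\<forall>\<^sub>F \<theta> in at_right 0. (0 < \<theta> \<and> \<theta> < H \<eta>) \<and> ?b \<theta> < e"
    by eventually_elim auto
  then obtain \<theta> where \<theta>: "0 < \<theta>" "\<theta> < H \<eta>" "?b \<theta> < e"
    using eventually_happens[of _ "at_right (0::real)"] by auto
  define f where "f x = \<theta> * indicator {0..a} x" for x :: real
  have fm: "f \<in> borel_measurable borel" unfolding f_def by measurable
  have f0: "0 \<le> f x" for x using \<theta> by (simp add: f_def)
  have fanti: "antimono_on {0..} f" using \<theta> by (auto simp: monotone_on_def f_def indicator_def)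
  have fbeyond: "f x = 0" if "a < x" for x using that by (simp add: f_def)
  have fc: "f x \<le> \<theta>" for x using \<theta> by (simp add: f_def indicator_def)
  have half: "(0::real) < 1 / 2" "1 / 2 < (1::real)" by auto
  note ctx = fm f0 fanti fbeyond a fc half \<eta>(1,2) \<theta>(2) near
  have "(LINT x:{0..a}|lborel. defect f x) \<le> (LINT x:{0..a}|lborel. (1 / (K * (1 - 1 / 2))) powr ?r * \<theta> powr ?r + \<theta>)"
    by (rule set_integral_mono[OF defect_set_integrable(1)[OF ctx]
      integrable_bounded_interval[OF fm f0 fanti fbeyond a, of _ "\<bar>(1 / (K * (1 - 1 / 2))) powr ?r * \<theta> powr ?r + \<theta>\<bar>"]])
      (use defect_upper(2)[OF ctx] in auto)
  also have "\<dots> = ?b \<theta>" using a by (subst set_integral_const) auto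
  finally have "(LINT x:{0..a}|lborel. defect f x) \<le> e" using \<theta>(3) by linarith
  moreover have "defect f = (\<lambda>x. 1 - cluster_limit p f x)" by (rule ext) (rule defect_def[OF fm f0 fanti fbeyond a])
  ultimately have "(LINT x:{0..a}|lborel. 1 - cluster_limit p f x) \<le> e" by simp
  then show ?thesis using \<theta>(1) unfolding f_def[abs_def] by blast
qed

end

section \<open>Laplace functionals of subordinators\<close>


lemma (in subordinator) nonneg_paths: "AE \<omega> in M. L 0 \<omega> = 0 \<and> (\<forall>s t. 0 \<le> s \<longrightarrow> s \<le> t \<longrightarrow> L s \<omega> \<le> L t \<omega>)"
  using starts_at_zero nondecreasing
  by eventually_elim (auto simp: mono_on_def sample_path_def)

lemma (in subordinator) sample_path_monotone:
  assumes "0 < c" shows "AE \<omega> in M. sample_path (\<lambda>t \<omega>. c * L t \<omega>) \<omega> \<in> monotone_paths"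
  using nonneg_paths cadlag_paths
proof eventually_elim
  case (elim \<omega>)
  let ?x = "sample_path L \<omega>" and ?y = "sample_path (\<lambda>t \<omega>. c * L t \<omega>) \<omega>"
  have y: "?y t = c * ?x t" if "0 \<le> t" for t using that by (simp add: sample_path_def)
  have "(?y \<longlongrightarrow> ?y t) (at_right t)" if t: "0 \<le> t" for t
  proof (rule Lim_transform_eventually)
    show "((\<lambda>s. c * ?x s) \<longlongrightarrow> ?y t) (at_right t)"
      unfolding y[OF t] using elim(2) t by (intro tendsto_intros) (auto simp: skorokhod_space_def)
    show "\<forall>\<^sub>F s in at_right t. c * ?x s = ?y s"
      using eventually_at_right_less[of t] by eventually_elim (use y t in auto)
  qed
  moreover have "\<exists>l. (?y \<longlongrightarrow> l) (at_left t)" if t: "0 < t" for t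
  proof -
    have "\<exists>l. (?x \<longlongrightarrow> l) (at_left t)" using elim(2) t by (simp add: skorokhod_space_def)
    then obtain l where "(?x \<longlongrightarrow> l) (at_left t)" ..
    then have "((\<lambda>s. c * ?x s) \<longlongrightarrow> c * l) (at_left t)" by (intro tendsto_intros)
    moreover have "\<forall>\<^sub>F s in at_left t. 0 < s" using t by (intro eventually_at_leftI[of 0]) auto
    then have "\<forall>\<^sub>F s in at_left t. c * ?x s = ?y s" by eventually_elim (use y in auto)
    ultimately show ?thesis by - (rule exI[of _ "c * l"], rule Lim_transform_eventually)
  qed
  ultimately have "?y \<in> skorokhod_space" by (auto simp: skorokhod_space_def sample_path_def)
  moreover have "mono_on {0..} ?y" "?y 0 = 0"
    using elim(1) assms by (auto simp: mono_on_def sample_path_def intro: mult_left_mono)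
  ultimately show ?case by (simp add: monotone_paths_def)
qed

text \<open>Summation by parts over the increments between the points of \<open>J\<close>: the increment over an interval
  ending at \<open>s\<close> is weighted by the sum of all \<open>\<theta> t\<close> with \<open>s \<le> t\<close>, which is the value on that interval of the
  step function under the integral.\<close>

lemma (in stable_subordinator) laplace_functional:
  assumes J: "finite J" "J \<subseteq> {0..}" and \<theta>: "\<And>t. 0 \<le> \<theta> t" and a: "\<And>t. t \<in> J \<Longrightarrow> t \<le> a"
  shows "expectation (\<lambda>\<omega>. exp (- (\<Sum>t\<in>J. \<theta> t * L t \<omega>))) =
    exp (- (LINT x:{0..a}|lborel. (\<Sum>t\<in>J. \<theta> t * indicator {0..t} x) powr \<alpha>))"
proof -
  define n where "n = card J"
  define xs where "xs = sorted_list_of_set J"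
  have xs: "set xs = J" "length xs = n" "sorted xs" "distinct xs"
    using J by (auto simp: xs_def n_def)
  \<comment> \<open>the points of \<open>J\<close> in increasing order, preceded by \<open>0\<close> and followed by a constant sequence\<close>
  define s where "s i = (if i = 0 then 0 else if i \<le> n then xs ! (i - 1) else Max (insert 0 J))" for i
  have sJ: "s (Suc i) \<in> J" if "i < n" for i using that xs by (auto simp: s_def)
  have s_0: "s 0 = 0" by (simp add: s_def)
  have s_strict: "s (Suc i) < s (Suc j)" if "i < j" "j < n" for i j
  proof -
    have "xs ! i \<le> xs ! j" using xs that by (intro sorted_nth_mono) auto
    moreover have "xs ! i \<noteq> xs ! j" using xs that by (simp add: nth_eq_iff_index_eq)
    ultimately show ?thesis using that by (simp add: s_def)
  qed
  have s_mono: "mono s"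
  proof (rule monoI[OF lift_Suc_mono_le[of s]])
    fix i
    show "s i \<le> s (Suc i)"
    proof (cases i)
      case 0
      then show ?thesis using J sJ[of 0] by (cases "0 < n") (auto simp: s_0, auto simp: s_def)
    next
      case (Suc j)
      consider "Suc j < n" | "Suc j = n" | "n < Suc j" by linarith
      then show ?thesis
      proof cases
        case 1 then show ?thesis using s_strict[of j "Suc j"] Suc by auto
      next
        case 2
        then have "s i \<in> J" using sJ[of j] Suc by auto
        then have "s i \<le> Max (insert 0 J)" using J by (intro Max_ge) auto
        then show ?thesis using 2 Suc by (simp add: s_def)
      next
        case 3 then show ?thesis using Suc by (simp add: s_def)
      qed
    qed
  qed
  have J_eq: "J = (\<lambda>k. s (Suc k)) ` {..<n}"
  proof -
    have "J = (\<lambda>k. xs ! k) ` {..<n}" using xs by (auto simp: set_conv_nth)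
    also have "\<dots> = (\<lambda>k. s (Suc k)) ` {..<n}" by (intro image_cong) (auto simp: s_def)
    finally show ?thesis .
  qed
  have s_le: "s (Suc i) \<le> s (Suc k) \<longleftrightarrow> i \<le> k" if "i < n" "k < n" for i k
    using s_strict[of k i] monoD[OF s_mono, of "Suc i" "Suc k"] that by (cases "i \<le> k") auto
  define \<Delta> where "\<Delta> i \<omega> = L (s (Suc i)) \<omega> - L (s i) \<omega>" for i \<omega>
  define \<kappa> where "\<kappa> i = (\<Sum>t\<in>J. if s (Suc i) \<le> t then \<theta> t else 0)" for i
  have \<kappa>0: "0 \<le> \<kappa> i" for i using \<theta> by (auto simp: \<kappa>_def intro!: sum_nonneg)
  have s0: "0 \<le> s i" for i using s_mono s_0 by (metis le0 monoD)
  have sums: "(\<Sum>t\<in>J. \<theta> t * L t \<omega>) = (\<Sum>i<n. \<kappa> i * \<Delta> i \<omega>)" if "L 0 \<omega> = 0" for \<omega>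
  proof -
    have "L t \<omega> = (\<Sum>i<n. if s (Suc i) \<le> t then \<Delta> i \<omega> else 0)" if t: "t \<in> J" for t
    proof -
      obtain k where k: "k < n" "t = s (Suc k)" using t J_eq by auto
      have "(\<Sum>i<n. if s (Suc i) \<le> t then \<Delta> i \<omega> else 0) = (\<Sum>i\<in>{..<n} \<inter> {i. s (Suc i) \<le> t}. \<Delta> i \<omega>)"
        by (simp add: sum.If_cases)
      also have "{..<n} \<inter> {i. s (Suc i) \<le> t} = {..<Suc k}" using s_le k by auto
      also have "(\<Sum>i<Suc k. \<Delta> i \<omega>) = L (s (Suc k)) \<omega> - L (s 0) \<omega>"
        unfolding \<Delta>_def by (rule sum_lessThan_telescope)
      finally show ?thesis using k \<open>L 0 \<omega> = 0\<close> s_0 by simp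
    qed
    then have "(\<Sum>t\<in>J. \<theta> t * L t \<omega>) = (\<Sum>t\<in>J. \<Sum>i<n. \<theta> t * (if s (Suc i) \<le> t then \<Delta> i \<omega> else 0))"
      by (simp add: sum_distrib_left)
    also have "\<dots> = (\<Sum>i<n. \<Sum>t\<in>J. \<theta> t * (if s (Suc i) \<le> t then \<Delta> i \<omega> else 0))" by (rule sum.swap)
    also have "\<dots> = (\<Sum>i<n. \<kappa> i * \<Delta> i \<omega>)"
      unfolding \<kappa>_def sum_distrib_right by (intro sum.cong) auto
    finally show ?thesis .
  qed
  have \<Delta>m: "\<Delta> i \<in> borel_measurable M" for i
    unfolding \<Delta>_def[abs_def] by (intro borel_measurable_diff random_variables s0)
  have \<Delta>0: "AE \<omega> in M. 0 \<le> \<Delta> i \<omega>" for i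
    using nonneg_paths by eventually_elim (use s0 s_mono in \<open>auto simp: \<Delta>_def mono_def\<close>)
  have one: "expectation (\<lambda>\<omega>. exp (- \<kappa> i * \<Delta> i \<omega>)) = exp (- (s (Suc i) - s i) * \<kappa> i powr \<alpha>)" for i
  proof -
    have h: "0 \<le> s (Suc i) - s i" using s_mono by (simp add: mono_def)
    have "expectation (\<lambda>\<omega>. exp (- \<kappa> i * \<Delta> i \<omega>)) = (\<integral>x. exp (- \<kappa> i * x) \<partial>distr M borel (\<Delta> i))"
      using \<Delta>m by (subst integral_distr) auto
    also have "distr M borel (\<Delta> i) = distr M borel (L (s (Suc i) - s i))"
      using stationary_increments[OF s0 h, of i] by (simp add: \<Delta>_def[abs_def])
    also have "(\<integral>x. exp (- \<kappa> i * x) \<partial>distr M borel (L (s (Suc i) - s i))) =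
        expectation (\<lambda>\<omega>. exp (- \<kappa> i * L (s (Suc i) - s i) \<omega>))"
      using random_variables[OF h] by (subst integral_distr) auto
    also have "\<dots> = exp (- (s (Suc i) - s i) * \<kappa> i powr \<alpha>)" by (rule laplace[OF h \<kappa>0])
    finally show ?thesis .
  qed
  have "expectation (\<lambda>\<omega>. exp (- (\<Sum>t\<in>J. \<theta> t * L t \<omega>))) = expectation (\<lambda>\<omega>. \<Prod>i<n. exp (- \<kappa> i * \<Delta> i \<omega>))"
  proof (rule integral_cong_AE)
    show "AE \<omega> in M. exp (- (\<Sum>t\<in>J. \<theta> t * L t \<omega>)) = (\<Prod>i<n. exp (- \<kappa> i * \<Delta> i \<omega>))"
      using starts_at_zero by eventually_elim (simp add: sums exp_sum[symmetric] sum_negf)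
    have [measurable]: "t \<in> J \<Longrightarrow> L t \<in> borel_measurable M" for t using random_variables J by auto
    show "(\<lambda>\<omega>. exp (- (\<Sum>t\<in>J. \<theta> t * L t \<omega>))) \<in> borel_measurable M" by measurable
    note [measurable] = \<Delta>m
    show "(\<lambda>\<omega>. \<Prod>i<n. exp (- \<kappa> i * \<Delta> i \<omega>)) \<in> borel_measurable M" by measurable
  qed
  also have "\<dots> = (\<Prod>i<n. expectation (\<lambda>\<omega>. exp (- \<kappa> i * \<Delta> i \<omega>)))"
  proof (rule indep_vars_lebesgue_integral)
    have "indep_vars (\<lambda>_. borel) \<Delta> {..<n}"
      unfolding \<Delta>_def[abs_def] by (rule independent_increments) (use s0 s_mono in auto)
    then show "indep_vars (\<lambda>_. borel) (\<lambda>i \<omega>. exp (- \<kappa> i * \<Delta> i \<omega>)) {..<n}"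
      by (rule indep_vars_compose2) measurable
    show "integrable M (\<lambda>\<omega>. exp (- \<kappa> i * \<Delta> i \<omega>))" for i
      using \<Delta>0[of i] \<Delta>m[of i] \<kappa>0[of i]
      by (intro integrable_const_bound[of _ 1]) (auto elim!: eventually_mono)
  qed auto
  also have "\<dots> = exp (- (\<Sum>i<n. (s (Suc i) - s i) * \<kappa> i powr \<alpha>))"
    unfolding one by (simp only: exp_sum finite_lessThan sum_negf[symmetric] mult_minus_left)
  also have "(\<Sum>i<n. (s (Suc i) - s i) * \<kappa> i powr \<alpha>) =
      (LINT x:{0..a}|lborel. (\<Sum>t\<in>J. \<theta> t * indicator {0..t} x) powr \<alpha>)"
  proof -
    have "(LINT x:{0..a}|lborel. (\<Sum>t\<in>J. \<theta> t * indicator {0..t} x) powr \<alpha>) =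
        (LINT x|lborel. (\<Sum>i<n. \<kappa> i powr \<alpha> * indicator {s i<..s (Suc i)} x))"
      unfolding set_lebesgue_integral_def
    proof (rule integral_cong_AE)
      have "AE x in lborel. x \<noteq> (0::real)" by (rule AE_lborel_singleton)
      then show "AE x in lborel. indicator {0..a} x *\<^sub>R (\<Sum>t\<in>J. \<theta> t * indicator {0..t} x) powr \<alpha> =
          (\<Sum>i<n. \<kappa> i powr \<alpha> * indicator {s i<..s (Suc i)} x)"
      proof eventually_elim
        case (elim x)
        show ?case
        proof (cases "\<exists>i<n. x \<in> {s i<..s (Suc i)}")
          case True
          then obtain i where i: "i < n" "s i < x" "x \<le> s (Suc i)" by auto
          have uniq: "x \<in> {s j<..s (Suc j)} \<longleftrightarrow> j = i" if "j < n" for j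
          proof
            assume j: "x \<in> {s j<..s (Suc j)}"
            have "\<not> Suc i \<le> j" using monoD[OF s_mono, of "Suc i" j] i j by auto
            moreover have "\<not> Suc j \<le> i" using monoD[OF s_mono, of "Suc j" i] i j by auto
            ultimately show "j = i" by linarith
          qed (use i in auto)
          have "(\<Sum>j<n. \<kappa> j powr \<alpha> * indicator {s j<..s (Suc j)} x) = (\<Sum>j<n. if j = i then \<kappa> i powr \<alpha> else 0)"
            using uniq by (intro sum.cong) (auto simp: indicator_def)
          moreover have "(\<Sum>t\<in>J. \<theta> t * indicator {0..t} x) = \<kappa> i"
            unfolding \<kappa>_def
          proof (intro sum.cong refl)
            fix t assume "t \<in> J"
            then obtain k where k: "k < n" "t = s (Suc k)" using J_eq by auto
            have "x \<le> t \<longleftrightarrow> s (Suc i) \<le> t"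
            proof
              assume "x \<le> t"
              then have "s i < s (Suc k)" using i k by auto
              then have "i < Suc k" using s_mono by (metis monoD not_le)
              then show "s (Suc i) \<le> t" using k s_mono by (simp add: mono_def)
            qed (use i in auto)
            moreover have "0 \<le> x" using i s0[of i] by linarith
            ultimately show "\<theta> t * indicator {0..t} x = (if s (Suc i) \<le> t then \<theta> t else 0)" by auto
          qed
          moreover have "x \<in> {0..a}" using i s0[of i] a[OF sJ[OF i(1)]] by auto
          ultimately show ?thesis using i(1) by simp
        next
          case False
          then have "(\<Sum>j<n. \<kappa> j powr \<alpha> * indicator {s j<..s (Suc j)} x) = 0" by (intro sum.neutral) auto
          moreover have "(\<Sum>t\<in>J. \<theta> t * indicator {0..t} x) = 0"
          proof (intro sum.neutral ballI)
            fix t assume "t \<in> J"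
            then obtain k where k: "k < n" "t = s (Suc k)" using J_eq by auto
            have "x \<notin> {0..t}"
            proof
              assume x: "x \<in> {0..t}"
              define i where "i = (LEAST i. x \<le> s (Suc i))"
              have i: "x \<le> s (Suc i)" unfolding i_def
                by (rule LeastI[of "\<lambda>i. x \<le> s (Suc i)" k]) (use x k in auto)
              have "i \<le> k" unfolding i_def by (rule Least_le) (use x k in auto)
              moreover have "s i < x"
              proof (cases i)
                case 0
                then show ?thesis using x elim s_0 by auto
              next
                case (Suc j)
                then have "\<not> x \<le> s (Suc j)" using not_less_Least[of j "\<lambda>i. x \<le> s (Suc i)"] by (simp add: i_def)
                then show ?thesis using Suc by simp
              qed
              ultimately show False using False i k by auto
            qed
            then show "\<theta> t * indicator {0..t} x = 0" by simp
          qed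
          ultimately show ?thesis by simp
        qed
      qed
    qed measurable
    also have "\<dots> = (\<Sum>i<n. \<kappa> i powr \<alpha> * measure lborel {s i<..s (Suc i)})"
      using s_mono by (subst Bochner_Integration.integral_sum) (auto simp: mono_def)
    also have "\<dots> = (\<Sum>i<n. (s (Suc i) - s i) * \<kappa> i powr \<alpha>)"
      using s_mono by (intro sum.cong refl) (auto simp: mono_def mult.commute)
    finally show ?thesis by simp
  qed
  finally show ?thesis .
qed

section \<open>The scaling limit\<close>


text \<open>Only finitely many particles are near the position \<open>t * T\<close>, so that the counting path is constant on both
  sides of \<open>t\<close>.\<close>

lemma counting_path_monotone:
  fixes x :: "'v \<Rightarrow> real" and V :: "'v set"
  assumes fin: "\<And>b. finite {v \<in> V. x v \<in> {0..b}}" and zero: "{v \<in> V. x v \<in> {0..0}} = {}" and T: "0 < T" and c: "0 < c"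
  shows "(\<lambda>t\<in>{0..}. real (card {v \<in> V. x v \<in> {0..t * T}}) / c) \<in> monotone_paths"
proof -
  define N where "N b = real (card {v \<in> V. x v \<in> {0..b}})" for b
  let ?y = "\<lambda>t\<in>{0..}. N (t * T) / c"
  have N_mono: "N b \<le> N b'" if "b \<le> b'" for b b'
    unfolding N_def using that by (intro of_nat_mono card_mono fin) auto
  have gap: "\<exists>d>0. \<forall>v\<in>V. x v \<in> {0..b + 1} \<and> x v \<noteq> b \<longrightarrow> d \<le> \<bar>b - x v\<bar>" for b
  proof -
    have "finite (x ` {v \<in> V. x v \<in> {0..b + 1}})" using fin by auto
    from finite_set_avoid[OF this, of b] show ?thesis by (auto simp: dist_real_def)
  qed
  have "(?y \<longlongrightarrow> ?y t) (at_right t)" if t: "0 \<le> t" for t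
  proof (rule tendsto_eventually)
    obtain d where d: "0 < d" "\<And>v. v \<in> V \<Longrightarrow> x v \<in> {0..t * T + 1} \<Longrightarrow> x v \<noteq> t * T \<Longrightarrow> d \<le> \<bar>t * T - x v\<bar>"
      using gap[of "t * T"] by blast
    have "\<forall>\<^sub>F s in at_right t. s \<in> {t <..< t + min d 1 / T}"
      using d T by (intro eventually_at_rightI[of t "t + min d 1 / T"]) auto
    then show "\<forall>\<^sub>F s in at_right t. ?y s = ?y t"
    proof eventually_elim
      case (elim s)
      then have s: "t * T < s * T" "s * T < t * T + min d 1" using T by (auto simp: field_simps)
      have "x v \<le> t * T" if v: "v \<in> V" "0 \<le> x v" "x v \<le> s * T" for v
      proof (rule ccontr)
        assume neg: "\<not> x v \<le> t * T"
        have "x v \<in> {0..t * T + 1}" using v s(2) by auto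
        then have "d \<le> \<bar>t * T - x v\<bar>" using neg by (intro d(2) v(1)) auto
        then show False using neg v(3) s(2) by linarith
      qed
      then have "{v \<in> V. x v \<in> {0..s * T}} = {v \<in> V. x v \<in> {0..t * T}}" using s(1) by force
      then show ?case using t elim by (simp add: N_def)
    qed
  qed
  moreover have "\<exists>l. (?y \<longlongrightarrow> l) (at_left t)" if t: "0 < t" for t
  proof
    obtain d where d: "0 < d" "\<And>v. v \<in> V \<Longrightarrow> x v \<in> {0..t * T + 1} \<Longrightarrow> x v \<noteq> t * T \<Longrightarrow> d \<le> \<bar>t * T - x v\<bar>"
      using gap[of "t * T"] by blast
    let ?l = "real (card {v \<in> V. 0 \<le> x v \<and> x v < t * T}) / c"
    show "(?y \<longlongrightarrow> ?l) (at_left t)"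
    proof (rule tendsto_eventually)
      have "\<forall>\<^sub>F s in at_left t. s \<in> {max 0 (t - d / T) <..< t}"
        using d T t by (intro eventually_at_leftI[of "max 0 (t - d / T)" t]) auto
      then show "\<forall>\<^sub>F s in at_left t. ?y s = ?l"
      proof eventually_elim
        case (elim s)
        then have s: "t * T - d < s * T" "s * T < t * T" "0 \<le> s" using T by (auto simp: field_simps)
        have "x v \<le> s * T" if v: "v \<in> V" "0 \<le> x v" "x v < t * T" for v
        proof (rule ccontr)
          assume "\<not> x v \<le> s * T"
          then show False using d(2)[of v] v s by auto
        qed
        then have "{v \<in> V. x v \<in> {0..s * T}} = {v \<in> V. 0 \<le> x v \<and> x v < t * T}" using s(2) by force
        then show ?case using elim by (simp add: N_def)
      qed
    qed
  qed
  ultimately have "?y \<in> skorokhod_space" by (auto simp: skorokhod_space_def)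
  moreover have "mono_on {0..} ?y"
    using T c N_mono by (auto simp: mono_on_def intro!: divide_right_mono)
  moreover have "N 0 = 0" unfolding N_def zero by simp
  then have "?y 0 = 0" by simp
  ultimately show ?thesis by (simp add: monotone_paths_def N_def[abs_def])
qed

context positive_branching_system
begin

text \<open>The Laplace functional is an integral over \<open>[0, 0]\<close> and thus equals \<open>1\<close>.\<close>

lemma no_particles_at_0:
  assumes fin: "AE \<omega> in M. finite (particles {0..0} \<omega>)"
  shows "AE \<omega> in M. particles {0..0} \<omega> = {}"
proof -
  let ?n = "\<lambda>\<omega>. enn2real (particle_count S \<rho> \<xi> \<omega> {0..0})"
  have point: "(LINT x:{0..0}|lborel. h x) = 0" for h :: "real \<Rightarrow> real"
    unfolding set_lebesgue_integral_def
  proof (rule integral_eq_zero_AE)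
    have "AE x in lborel. x \<noteq> (0::real)" by (rule AE_lborel_singleton)
    then show "AE x in lborel. indicator {0..0} x *\<^sub>R h x = 0" by eventually_elim simp
  qed
  have "expectation (\<lambda>\<omega>. exp (- ?n \<omega>)) = 1"
    using laplace_particle_counts[of "{()}" "\<lambda>_. 1" 0 "\<lambda>_. 0"] fin
    unfolding point by simp
  moreover have i: "integrable M (\<lambda>\<omega>. exp (- ?n \<omega>))"
    by (intro integrable_const_bound[of _ 1]) auto
  ultimately have "expectation (\<lambda>\<omega>. 1 - exp (- ?n \<omega>)) = 0" by (simp add: prob_space)
  then have "AE \<omega> in M. 1 - exp (- ?n \<omega>) = 0"
    using i by (subst (asm) integral_nonneg_eq_0_iff_AE) auto
  with fin show ?thesis
    by eventually_elim (auto simp: particle_count_eq)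
qed

end

theorem theorem2p6:
  fixes M :: "'a measure" and \<mu> :: real and \<phi> :: "real \<Rightarrow> real" and p :: "nat pmf"
    and S :: "nat \<Rightarrow> 'a \<Rightarrow> real" and \<rho> :: "label \<Rightarrow> 'a \<Rightarrow> nat" and \<xi> :: "label \<Rightarrow> nat \<Rightarrow> 'a \<Rightarrow> real"
    and M' :: "'b measure" and L :: "real \<Rightarrow> 'b \<Rightarrow> real"
    and \<beta> K C \<delta> :: real and G H W :: "real \<Rightarrow> real"
  assumes mu: "\<mu> > 0"
    and phi_borel: "\<phi> \<in> borel_measurable borel"
    and phi_nonneg: "\<And>t. \<phi> t \<ge> 0"
    and phi_zero: "\<And>t. t < 0 \<Longrightarrow> \<phi> t = 0"
    and phi_int: "(\<integral>\<^sup>+t\<in>{0..}. ennreal (\<phi> t) \<partial>lborel) = 1"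
    and mean_one: "integrable (measure_pmf p) real" "measure_pmf.expectation p real = 1"
    and nontrivial: "p \<noteq> return_pmf 1"
    and system: "branching_particle_system M \<mu> \<phi> p S \<rho> \<xi>"
    and beta: "0 < \<beta>" "\<beta> < 1"
    and G: "G = generating_function p"
    and H: "\<And>u. u \<in> {0..1} \<Longrightarrow> H u = G (1 - u) - 1 + u"
    and K: "K > 0"
    and H_form: "\<And>x. x \<in> {0..1} \<Longrightarrow> H x = K * x powr (1 + \<beta>) * W x"
    and W_nonneg: "\<And>x. x \<in> {0..1} \<Longrightarrow> W x \<ge> 0"
    and W_bounded: "bounded (W ` {0..1})"
    and W_lim: "(W \<longlongrightarrow> 1) (at_right 0)"
    and C: "C > 0"
    and H_incr: "\<And>x y. 0 \<le> x \<Longrightarrow> x \<le> y \<Longrightarrow> y \<le> 1 \<Longrightarrow>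
                   0 \<le> H y - H x \<and> H y - H x \<le> C * (y - x) * y powr \<beta>"
    and delta: "\<delta> > 0"
    and moment: "set_integrable lborel {0..} (\<lambda>s. s powr (\<beta> + \<delta>) * \<phi> s)"
    and L: "stable_subordinator M' L (1 / (1 + \<beta>))"
  shows "converges_fdd at_top M (scaled_count \<beta> S \<rho> \<xi>)
           M' (\<lambda>t \<omega>. \<mu> powr (1 + \<beta>) / K * L t \<omega>) \<and>
         converges_in_law_M1 at_top M (scaled_count \<beta> S \<rho> \<xi>)
           M' (\<lambda>t \<omega>. \<mu> powr (1 + \<beta>) / K * L t \<omega>)"
proof -
  interpret B: branching_particle_system M \<mu> \<phi> p S \<rho> \<xi> by (rule system)
  interpret P: positive_branching_system M \<mu> \<phi> p S \<rho> \<xi>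
    by unfold_locales (use mu phi_zero in auto)
  interpret L: stable_subordinator M' L "1 / (1 + \<beta>)" by (rule L)
  let ?D = "B.displacement_law" and ?q = "1 / (1 + \<beta>)"
  interpret C: critical_branching ?D p \<beta> K H
  proof
    show "H u = generating_function p (1 - u) - 1 + u" if "0 \<le> u" "u \<le> 1" for u
      using H[of u] that by (simp add: G)
    show "H x \<le> H y" if "0 \<le> x" "x \<le> y" "y \<le> 1" for x y using H_incr[OF that] by simp
    fix \<epsilon> :: real assume \<epsilon>: "0 < \<epsilon>"
    have "\<forall>\<^sub>F x in at_right 0. dist (W x) 1 < \<epsilon>" using W_lim \<epsilon> by (rule tendstoD)
    then obtain \<eta> where \<eta>: "0 < \<eta>" "\<And>x. 0 < x \<Longrightarrow> x < \<eta> \<Longrightarrow> dist (W x) 1 < \<epsilon>"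
      unfolding eventually_at_right[OF zero_less_one] by auto
    show "\<exists>\<eta>>0. \<forall>x. 0 < x \<and> x < \<eta> \<longrightarrow>
        K * (1 - \<epsilon>) * x powr (1 + \<beta>) \<le> H x \<and> H x \<le> K * (1 + \<epsilon>) * x powr (1 + \<beta>)"
    proof (intro exI[of _ "min \<eta> 1"] conjI allI impI)
      fix x assume x: "0 < x \<and> x < min \<eta> 1"
      then have "\<bar>W x - 1\<bar> < \<epsilon>" using \<eta>(2)[of x] by (simp add: dist_real_def)
      then have "1 - \<epsilon> \<le> W x" "W x \<le> 1 + \<epsilon>" by linarith+
      then have "K * x powr (1 + \<beta>) * (1 - \<epsilon>) \<le> K * x powr (1 + \<beta>) * W x"
        "K * x powr (1 + \<beta>) * W x \<le> K * x powr (1 + \<beta>) * (1 + \<epsilon>)"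
        using K by (auto intro!: mult_left_mono)
      then show "K * (1 - \<epsilon>) * x powr (1 + \<beta>) \<le> H x" "H x \<le> K * (1 + \<epsilon>) * x powr (1 + \<beta>)"
        using H_form[of x] x by (simp_all add: mult_ac)
    qed (use \<eta> in auto)
  qed (use beta K in auto)
  \<comment> \<open>an exponent above \<open>\<beta>\<close> that is at most \<open>1\<close>; the corresponding moment is again finite\<close>
  define r where "r = min 1 (\<beta> + \<delta>)"
  have r: "\<beta> < r" "r \<le> 1" using beta delta by (auto simp: r_def)
  have moment_r: "integrable ?D (\<lambda>y. y powr r)"
  proof -
    have int1: "integrable lborel (\<lambda>y. indicator {0..} y * \<phi> y)"
    proof (rule integrableI_nn_integral_finite)
      show "(\<integral>\<^sup>+ y. ennreal (indicator {0..} y * \<phi> y) \<partial>lborel) = ennreal 1"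
      proof -
        have "ennreal (indicator {0..} y * \<phi> y) = ennreal (\<phi> y) * indicator {0..} y" for y
          by (simp add: indicator_def)
        then show ?thesis using phi_int by simp
      qed
    qed (use phi_borel phi_nonneg in auto)
    have int2: "integrable lborel (\<lambda>y. indicator {0..} y * (y powr (\<beta> + \<delta>) * \<phi> y))"
      using moment by (simp add: set_integrable_def)
    have "integrable lborel (\<lambda>y. \<phi> y *\<^sub>R y powr r)"
    proof (rule Bochner_Integration.integrable_bound[OF Bochner_Integration.integrable_add[OF int1 int2]])
      show "AE y in lborel. norm (\<phi> y *\<^sub>R y powr r) \<le>
          norm (indicator {0..} y * \<phi> y + indicator {0..} y * (y powr (\<beta> + \<delta>) * \<phi> y))"
      proof (rule AE_I2)
        fix y :: real
        show "norm (\<phi> y *\<^sub>R y powr r) \<le>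
            norm (indicator {0..} y * \<phi> y + indicator {0..} y * (y powr (\<beta> + \<delta>) * \<phi> y))"
        proof (cases "0 \<le> y")
          case True
          have "y powr r \<le> 1 + y powr (\<beta> + \<delta>)"
          proof (cases "y \<le> 1")
            case True
            then have "y powr r \<le> 1" using \<open>0 \<le> y\<close> r beta by (intro powr_le1) auto
            then show ?thesis by (simp add: add_increasing2)
          next
            case False
            then have "y powr r \<le> y powr (\<beta> + \<delta>)" by (intro powr_mono) (auto simp: r_def)
            then show ?thesis by simp
          qed
          then have "\<phi> y * y powr r \<le> \<phi> y * (1 + y powr (\<beta> + \<delta>))"
            using phi_nonneg by (intro mult_left_mono)
          then show ?thesis using True phi_nonneg[of y] by (simp add: algebra_simps abs_mult)
        next
          case False
          then show ?thesis using phi_zero[of y] by simp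
        qed
      qed
    qed (use phi_borel in measurable)
    then show ?thesis
      unfolding B.displacement_law_def
      by (subst integrable_density) (use phi_borel phi_nonneg in auto)
  qed
  have fin_a: "AE \<omega> in M. finite (P.particles {0..a} \<omega>)" if a: "0 \<le> a" for a
  proof (rule P.particles_finite[OF a])
    fix e :: real assume "0 < e"
    then obtain \<theta> where "0 < \<theta>"
      "(LINT x:{0..a}|lborel. 1 - P.D.cluster_limit p (\<lambda>x. \<theta> * indicator {0..a} x) x) \<le> e / \<mu>"
      using C.defect_integral_small[OF a, of "e / \<mu>"] mu by auto
    then show "\<exists>\<theta>>0. \<mu> * (LINT x:{0..a}|lborel. 1 - P.D.cluster_limit p (\<lambda>x. \<theta> * indicator {0..a} x) x) \<le> e"
      using mu by (intro exI[of _ \<theta>]) (simp add: field_simps)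
  qed
  have "AE \<omega> in M. \<forall>n::nat. finite (P.particles {0..real n} \<omega>)"
    using fin_a by (simp add: AE_all_countable)
  then have fin: "AE \<omega> in M. \<forall>a. finite (P.particles {0..a} \<omega>)"
  proof eventually_elim
    case (elim \<omega>)
    show ?case
    proof
      fix a :: real
      obtain n :: nat where "a \<le> n" using real_arch_simple by blast
      then have "P.particles {0..a} \<omega> \<subseteq> P.particles {0..real n} \<omega>" by (auto simp: P.particles_def)
      then show "finite (P.particles {0..a} \<omega>)" using elim finite_subset by blast
    qed
  qed
  define Y where "Y = scaled_count \<beta> S \<rho> \<xi>"
  define X where "X t \<omega> = \<mu> powr (1 + \<beta>) / K * L t \<omega>" for t \<omega>
  have c: "0 < \<mu> powr (1 + \<beta>) / K" using mu K by simp
  have Ym: "Y T t \<in> borel_measurable M" for T t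
    unfolding Y_def scaled_count_def[abs_def] by measurable
  have Y0: "0 \<le> Y T t \<omega>" for T t \<omega> by (simp add: Y_def scaled_count_def)
  have Ymono: "AE \<omega> in M. sample_path (Y T) \<omega> \<in> monotone_paths" if T: "0 < T" for T
    using fin P.no_particles_at_0[OF fin_a[OF order_refl]]
  proof eventually_elim
    case (elim \<omega>)
    have "sample_path (Y T) \<omega> = (\<lambda>t\<in>{0..}. real (card (P.particles {0..t * T} \<omega>)) / T powr (1 + \<beta>))"
      using elim(1) by (simp add: sample_path_def Y_def scaled_count_def P.particle_count_eq)
    also have "\<dots> \<in> monotone_paths"
      using counting_path_monotone[of "{v. alive \<rho> \<omega> v}" "position S \<xi> \<omega>" T "T powr (1 + \<beta>)"] elim T
      by (simp add: P.particles_def)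
    finally show ?case .
  qed
  have Xm: "X t \<in> borel_measurable M'" if "0 \<le> t" for t
    unfolding X_def[abs_def] using L.random_variables[OF that] by measurable
  have X0: "AE \<omega> in M'. \<forall>t\<ge>0. 0 \<le> X t \<omega>"
    using L.nonneg_paths
  proof eventually_elim
    case (elim \<omega>)
    have "L 0 \<omega> \<le> L t \<omega>" if "0 \<le> t" for t using elim that by blast
    then have L_nonneg: "0 \<le> L t \<omega>" if "0 \<le> t" for t using elim that by simp
    show ?case unfolding X_def
      by (intro allI impI mult_nonneg_nonneg less_imp_le[OF c]) (rule L_nonneg)
  qed
  have Xmono: "AE \<omega> in M'. sample_path X \<omega> \<in> monotone_paths"
    using L.sample_path_monotone[OF c] unfolding X_def[abs_def] .
  have laplace: "((\<lambda>T. \<integral>\<omega>. exp (- (\<Sum>t\<in>J. \<theta> t * Y T t \<omega>)) \<partial>M) \<longlongrightarrow> (\<integral>\<omega>. exp (- (\<Sum>t\<in>J. \<theta> t * X t \<omega>)) \<partial>M')) at_top"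
    if J: "finite J" "J \<subseteq> {0..}" and \<theta>: "\<And>t. 0 \<le> \<theta> t" for J and \<theta> :: "real \<Rightarrow> real"
  proof -
    \<comment> \<open>a positive upper bound for the times in \<open>J\<close>\<close>
    define a where "a = 1 + \<Sum>J"
    have "t \<le> \<Sum>J" if "t \<in> J" for t
      by (rule member_le_sum) (use that J in auto)
    then have a_ge: "t \<le> a" if "t \<in> J" for t using that by (force simp: a_def)
    have a: "0 < a" using J by (auto simp: a_def intro!: add_pos_nonneg sum_nonneg)
    define g where "g x = (\<Sum>t\<in>J. \<theta> t * indicator {0..t} x)" for x :: real
    have g_anti: "antimono_on {0..} g"
      unfolding g_def by (intro monotone_onI sum_mono mult_left_mono \<theta>) (auto simp: indicator_def)
    have g_le: "g x \<le> (\<Sum>t\<in>J. \<theta> t)" for x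
      unfolding g_def using \<theta> by (intro sum_mono mult_left_le) (auto simp: indicator_def)
    have g_beyond: "g x = 0" if "a < x" for x
      unfolding g_def by (intro sum.neutral) (use that a_ge in \<open>fastforce simp: indicator_def\<close>)
    have g_borel: "g \<in> borel_measurable borel" unfolding g_def[abs_def] by measurable
    have g0: "0 \<le> g x" for x unfolding g_def using \<theta> by (intro sum_nonneg) auto
    let ?I = "LINT x:{0..a}|lborel. g x powr ?q"
    have "((\<lambda>T. LINT x:{0..a * T}|lborel. 1 - P.D.cluster_limit p (\<lambda>x. T powr - (1 + \<beta>) * g (x / T)) x)
        \<longlongrightarrow> (1 / K) powr ?q * ?I) at_top"
      by (rule C.defect_integral_tendsto[OF g_borel g0 g_le g_anti g_beyond a r moment_r])
    then have lim: "((\<lambda>T. exp (- (\<mu> * (LINT x:{0..a * T}|lborel. 1 - P.D.cluster_limit p (\<lambda>x. T powr - (1 + \<beta>) * g (x / T)) x))))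
        \<longlongrightarrow> exp (- (\<mu> * ((1 / K) powr ?q * ?I)))) at_top"
      by (intro tendsto_intros)
    have left: "\<forall>\<^sub>F T in at_top. exp (- (\<mu> * (LINT x:{0..a * T}|lborel. 1 - P.D.cluster_limit p (\<lambda>x. T powr - (1 + \<beta>) * g (x / T)) x))) =
        (\<integral>\<omega>. exp (- (\<Sum>t\<in>J. \<theta> t * Y T t \<omega>)) \<partial>M)"
      using eventually_gt_at_top[of 0]
    proof eventually_elim
      case (elim T)
      have aT: "0 \<le> a * T" using a elim by simp
      have f: "(\<lambda>x. T powr - (1 + \<beta>) * g (x / T)) = (\<lambda>x. \<Sum>t\<in>J. (\<theta> t * T powr - (1 + \<beta>)) * indicator {0..t * T} x)"
      proof
        fix x
        have "indicator {0..t} (x / T) = (indicator {0..t * T} x :: real)" for t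
          using elim by (auto simp: indicator_def field_simps)
        then show "T powr - (1 + \<beta>) * g (x / T) = (\<Sum>t\<in>J. (\<theta> t * T powr - (1 + \<beta>)) * indicator {0..t * T} x)"
          by (simp add: g_def sum_distrib_left mult_ac)
      qed
      have "(\<integral>\<omega>. exp (- (\<Sum>t\<in>J. \<theta> t * Y T t \<omega>)) \<partial>M) =
          (\<integral>\<omega>. exp (- (\<Sum>t\<in>J. (\<theta> t * T powr - (1 + \<beta>)) * enn2real (particle_count S \<rho> \<xi> \<omega> {0..t * T}))) \<partial>M)"
        by (simp only: Y_def scaled_count_def powr_minus_divide times_divide_eq_right times_divide_eq_left mult_1_right)
      also have "\<dots> = exp (- (\<mu> * (LINT x:{0..a * T}|lborel. 1 -
          P.D.cluster_limit p (\<lambda>x. \<Sum>t\<in>J. (\<theta> t * T powr - (1 + \<beta>)) * indicator {0..t * T} x) x)))"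
        using \<theta> a_ge elim fin_a[OF aT]
        by (intro P.laplace_particle_counts[OF J(1) _ aT]) (auto intro: mult_right_mono)
      finally show ?case unfolding f by simp
    qed
    have right: "(\<integral>\<omega>. exp (- (\<Sum>t\<in>J. \<theta> t * X t \<omega>)) \<partial>M') = exp (- (\<mu> * ((1 / K) powr ?q * ?I)))"
    proof -
      let ?c = "\<mu> powr (1 + \<beta>) / K"
      have "(\<integral>\<omega>. exp (- (\<Sum>t\<in>J. \<theta> t * X t \<omega>)) \<partial>M') = (\<integral>\<omega>. exp (- (\<Sum>t\<in>J. (?c * \<theta> t) * L t \<omega>)) \<partial>M')"
        by (simp add: X_def mult_ac)
      also have "\<dots> = exp (- (LINT x:{0..a}|lborel. (\<Sum>t\<in>J. (?c * \<theta> t) * indicator {0..t} x) powr ?q))"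
        by (intro L.laplace_functional J mult_nonneg_nonneg less_imp_le[OF c] \<theta> a_ge)
      also have "(\<lambda>x. (\<Sum>t\<in>J. (?c * \<theta> t) * indicator {0..t} x) powr ?q) = (\<lambda>x. (\<mu> * (1 / K) powr ?q) * g x powr ?q)"
      proof
        fix x
        have "(\<Sum>t\<in>J. (?c * \<theta> t) * indicator {0..t} x) = ?c * g x"
          by (simp add: g_def sum_distrib_left mult.assoc)
        moreover have "?c powr ?q = \<mu> * (1 / K) powr ?q"
          using mu K beta by (simp add: powr_divide powr_powr)
        ultimately show "(\<Sum>t\<in>J. (?c * \<theta> t) * indicator {0..t} x) powr ?q = (\<mu> * (1 / K) powr ?q) * g x powr ?q"
          by (simp only: powr_mult)
      qed
      finally show ?thesis by simp
    qed
    show ?thesis unfolding right by (rule Lim_transform_eventually[OF lim left])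
  qed
  have pM: "prob_space M" and pM': "prob_space M'" by unfold_locales
  have fdd: "converges_fdd at_top M Y M' X"
    by (rule converges_fdd_of_laplace[OF pM pM' _ Y0 Xm X0 laplace]) (use Ym in auto)
  moreover have "converges_in_law_M1 at_top M Y M' X"
  proof (rule converges_in_law_M1_of_fdd[OF pM pM' _ Xm Xmono fdd])
    show "\<forall>\<^sub>F T in at_top. (\<forall>t\<ge>0. Y T t \<in> borel_measurable M) \<and> (AE \<omega> in M. sample_path (Y T) \<omega> \<in> monotone_paths)"
      using eventually_gt_at_top[of 0] by eventually_elim (use Ym Ymono in auto)
  qed
  ultimately show ?thesis unfolding Y_def X_def[abs_def] by blast
qed

end
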